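(* Let $k,t:\mathbb{N}\to\mathbb{N}$ be functions (constructible in quadratic time) satisfying $\log\log n = o(k(n))$, $k(n)=o(t(n))$ and $t(n)=o(n)$. For any $\delta>0$, there is an algorithm that learns the concept class $\mathrm{PAR}(k)$ of $k$-parities on $n$ variables over the uniform distribution with confidence parameter $\delta$, using $O\!\left(\frac{kn}{t}+\log\binom{t}{k}+\log(1/\delta)\right)$ uniformly random examples and running time $e^{-k/4.01}\binom{t}{k}\cdot\mathrm{poly}(n)\cdot\log(1/\delta)$.
   Context: $\mathrm{PAR}(k)$ is the set of vectors $x\in\{0,1\}^n$ of Hamming weight $k$; each such $x$ is identified with the parity function $a\mapsto\sum_{i=1}^n x_ia_i \pmod 2$ on $\{0,1\}^n$. Learning over the uniform distribution with confidence parameter $\delta$: for an unknown target $f\in\mathrm{PAR}(k)$, the algorithm receives examples $(a,f(a))$ with $a$ drawn independently and uniformly from $\{0,1\}^n$, and with probability at least $1-\delta$ outputs a hypothesis $f^*$ with $\Pr_a[f(a)\neq f^*(a)]<\epsilon$, where the approximation parameter may be taken as $\epsilon=1/2$ (any two distinct parities differ on half of $\{0,1\}^n$). The constant $4.01$ may be replaced by any constant larger than $4$. *)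

theory Defs
  imports
    "HOL-Probability.Probability"
    "HOL-Computational_Algebra.Polynomial"
    "HOL-Library.Landau_Symbols"
    "HOL-Library.Log_Nat"
begin

definition cube :: "nat \<Rightarrow> nat list set" where
  "cube n = {a. set a \<subseteq> {0, 1} \<and> length a = n}"

definition parity_fun :: "nat list \<Rightarrow> nat list \<Rightarrow> nat" where
  "parity_fun x a = (\<Sum>i<length x. x ! i * a ! i) mod 2"

definition hamming_weight :: "nat list \<Rightarrow> nat" where
  "hamming_weight x = card {i. i < length x \<and> x ! i \<noteq> 0}"

definition PAR :: "nat \<Rightarrow> nat \<Rightarrow> nat list set" where
  "PAR n k = {x \<in> cube n. hamming_weight x = k}"

text \<open>
  Algorithms are programs of a structured random-access machine whose memory consists of
  finitely many (those named in the program) infinite arrays of natural numbers; a scalar variable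
  is cell 0 of an array. Running time is logarithmic cost: every value that is computed, read
  or used as an address is charged its bit length, and products and quotients are charged the
  product of the bit lengths of their operands. Subtraction is truncated. The only sources of
  randomness are fair coin flips and requests for a labelled example.
\<close>

datatype expr =
    Num nat
  | Read nat expr
  | Plus expr expr
  | Minus expr expr
  | Times expr expr
  | Quot expr expr

datatype com =
    Skip
  | Assign nat expr expr
  | Flip nat expr
  | Example nat
  | Seq com com
  | If expr com com
  | While expr com

type_synonym memory = "nat \<Rightarrow> nat \<Rightarrow> nat"

record state =
  mem :: memory
  time :: nat
  examples :: nat

definition len :: "nat \<Rightarrow> nat" where
  "len v = 1 + floorlog 2 v"

primrec val :: "memory \<Rightarrow> expr \<Rightarrow> nat" where
  "val m (Num v) = v"
| "val m (Read a e) = m a (val m e)"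
| "val m (Plus e1 e2) = val m e1 + val m e2"
| "val m (Minus e1 e2) = val m e1 - val m e2"
| "val m (Times e1 e2) = val m e1 * val m e2"
| "val m (Quot e1 e2) = val m e1 div val m e2"

primrec cost :: "memory \<Rightarrow> expr \<Rightarrow> nat" where
  "cost m (Num v) = len v"
| "cost m (Read a e) = cost m e + len (m a (val m e))"
| "cost m (Plus e1 e2) = cost m e1 + cost m e2 + len (val m e1 + val m e2)"
| "cost m (Minus e1 e2) = cost m e1 + cost m e2 + len (val m e1 - val m e2)"
| "cost m (Times e1 e2) = cost m e1 + cost m e2 + len (val m e1) * len (val m e2)"
| "cost m (Quot e1 e2) = cost m e1 + cost m e2 + len (val m e1) * len (val m e2)"

definition tick :: "nat \<Rightarrow> state \<Rightarrow> state" where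
  "tick c s = s\<lparr>time := time s + c\<rparr>"

definition store :: "nat \<Rightarrow> nat \<Rightarrow> nat \<Rightarrow> state \<Rightarrow> state" where
  "store a i v s = s\<lparr>mem := (mem s)(a := (mem s a)(i := v))\<rparr>"

definition store_list :: "nat \<Rightarrow> nat list \<Rightarrow> state \<Rightarrow> state" where
  "store_list a vs s =
     s\<lparr>mem := (mem s)(a := (\<lambda>i. if i < length vs then vs ! i else mem s a i))\<rparr>"

partial_function (spmf) while_spmf ::
    "('a \<Rightarrow> bool) \<Rightarrow> ('a \<Rightarrow> 'a spmf) \<Rightarrow> 'a \<Rightarrow> 'a spmf" where
  "while_spmf g b s =
     (if g s then bind_spmf (b s) (while_spmf g b) else return_spmf s)"

text \<open>
  The missing probability mass of the resulting subdistribution is the probability of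
  non-termination. The parameter \<open>ex\<close> is the distribution of a single example;
  each request draws a fresh one, independently of everything before, and stores it in an array.
\<close>

primrec exec :: "nat list spmf \<Rightarrow> com \<Rightarrow> state \<Rightarrow> state spmf" where
  "exec ex Skip = (\<lambda>s. return_spmf (tick 1 s))"
| "exec ex (Assign a e1 e2) = (\<lambda>s.
     return_spmf (tick (1 + cost (mem s) e1 + cost (mem s) e2)
       (store a (val (mem s) e1) (val (mem s) e2) s)))"
| "exec ex (Flip a e) = (\<lambda>s.
     map_spmf (\<lambda>v. tick (1 + cost (mem s) e) (store a (val (mem s) e) v s))
       (spmf_of_set {0, 1}))"
| "exec ex (Example a) = (\<lambda>s.
     map_spmf (\<lambda>vs. tick (1 + length vs) (store_list a vs s)\<lparr>examples := examples s + 1\<rparr>) ex)"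
| "exec ex (Seq c1 c2) = (\<lambda>s. bind_spmf (exec ex c1 s) (exec ex c2))"
| "exec ex (If e c1 c2) = (\<lambda>s.
     if val (mem s) e \<noteq> 0 then exec ex c1 (tick (1 + cost (mem s) e) s)
     else exec ex c2 (tick (1 + cost (mem s) e) s))"
| "exec ex (While e c) = (\<lambda>s.
     map_spmf (\<lambda>s'. tick (1 + cost (mem s') e) s')
       (while_spmf (\<lambda>s'. val (mem s') e \<noteq> 0)
          (\<lambda>s'. exec ex c (tick (1 + cost (mem s') e) s')) s))"

primrec deterministic :: "com \<Rightarrow> bool" where
  "deterministic Skip = True"
| "deterministic (Assign a e1 e2) = True"
| "deterministic (Flip a e) = False"
| "deterministic (Example a) = False"
| "deterministic (Seq c1 c2) = (deterministic c1 \<and> deterministic c2)"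
| "deterministic (If e c1 c2) = (deterministic c1 \<and> deterministic c2)"
| "deterministic (While e c) = deterministic c"

text \<open>
  The input is found in cell 0 of array 0 and all other cells are 0. The output is
  left in array 1: in its cell 0 if it is a number, in its cells \<open>0, \<dots>, n - 1\<close> if it is a vector.
\<close>

definition initial :: "nat \<Rightarrow> state" where
  "initial n = \<lparr>mem = (\<lambda>_ _. 0)(0 := (\<lambda>_. 0)(0 := n)), time = 0, examples = 0\<rparr>"

definition constructible_in_quadratic_time :: "(nat \<Rightarrow> nat) \<Rightarrow> bool" where
  "constructible_in_quadratic_time g \<longleftrightarrow>
     (\<exists>A c. deterministic A \<and>
        (\<forall>n. \<exists>s. exec (return_pmf None) A (initial n) = return_spmf s \<and>
           mem s 1 0 = g n \<and> time s \<le> c * (n\<^sup>2 + 1)))"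

definition uniform_examples :: "nat \<Rightarrow> (nat list \<Rightarrow> nat) \<Rightarrow> nat list spmf" where
  "uniform_examples n f = map_spmf (\<lambda>a. a @ [f a]) (spmf_of_set (cube n))"

definition output_vector :: "nat \<Rightarrow> state \<Rightarrow> nat list" where
  "output_vector n s = map (mem s 1) [0..<n]"

definition error :: "nat \<Rightarrow> (nat list \<Rightarrow> nat) \<Rightarrow> (nat list \<Rightarrow> nat) \<Rightarrow> real" where
  "error n f h = measure_pmf.prob (pmf_of_set (cube n)) {a. f a \<noteq> h a}"

text \<open>
  \<open>A\<close> learns, on \<open>n\<close> variables, the parities with coefficient vector in \<open>X\<close>, with approximation
  parameter \<open>\<epsilon>\<close> and confidence parameter \<open>\<delta>\<close>. The bounds \<open>q\<close> on the number of examples and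
  \<open>T\<close> on the running time hold for every
  outcome of the random choices; the probability of success is over the examples and the coin
  flips of \<open>A\<close>. Hypotheses are parity functions.
\<close>

definition learns_parities ::
    "com \<Rightarrow> nat \<Rightarrow> nat list set \<Rightarrow> real \<Rightarrow> real \<Rightarrow> real \<Rightarrow> real \<Rightarrow> bool" where
  "learns_parities A n X \<epsilon> \<delta> q T \<longleftrightarrow>
     (\<forall>x\<in>X. let r = exec (uniform_examples n (parity_fun x)) A (initial n) in
        lossless_spmf r \<and>
        (\<forall>s\<in>set_spmf r. real (examples s) \<le> q \<and> real (time s) \<le> T) \<and>
        measure (measure_spmf r)
          {s. output_vector n s \<in> cube n \<and>
              error n (parity_fun x) (parity_fun (output_vector n s)) < \<epsilon>} \<ge> 1 - \<delta>)"

end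

theory Submission
  imports Defs "HOL-Real_Asymp.Real_Asymp"
begin

text \<open>
  Partition the variables into \<open>T = t div 2\<close> blocks of size about \<open>2 n / t\<close>. Every \<open>k\<close>-parity is supported
  on some \<open>k\<close> of these blocks, and there are only \<open>T choose k \<le> (t choose k) / 2 ^ k\<close> such choices;
  this halving of the number of blocks is what gains the factor \<open>exp (- k / 4.01)\<close>. For each choice, linear
  algebra over the two-element field finds a parity supported on these blocks and consistent with
  the examples, or reports that there is none. There are at most
  \<open>(T choose k) 2 ^ (k (n/T + 1))\<close> candidates in total and each wrong one survives an example
  with probability \<open>1/2\<close>, so that by the union bound
  \<open>k (n/T + 1) + log (T choose k) + log (1/\<delta>)\<close> examples leave only the target.

  The examples are reduced, as they arrive, to a matrix with \<open>n + 1\<close> rows spanning the vectors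
  orthogonal to all of them. Hence the time per choice of blocks does not depend on \<open>\<delta>\<close>. A restriction of
  the support amounts to further orthogonality constraints, by unit vectors.
\<close>

section \<open>A program logic with time and sample bounds\<close>

text \<open>A parity \<open>z\<close> gives the label of an example iff the vector \<open>z\<close>
  followed by 1 is orthogonal to the example followed by its label. Consistency is thus a
  homogeneous condition in dimension n + 1, and the parities sought are the null vectors with last
  coordinate 1. Orthogonality cannot express Hamming weight, so the union bound has to cover all
  vectors supported on \<open>k\<close> blocks. With t/c blocks the number of choices falls by at
  least c^k, while the exponent k (c n / t + 1) of the candidate count grows only by a constant
  factor, which the O of the sample bound hides; c = 2 suffices because exp (1/4.01) \<le> 2. The
  learner flips no coins: its final memory is a function of the examples, and their number is fixed
  before any is seen. The program can therefore be verified for each list of examples separately,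
  and probability enters only through the law of this list. Costs are logarithmic, so the numbers
  computed by the learner are kept below a bound with O(n) bits.\<close>

primrec draws :: "'a spmf \<Rightarrow> nat \<Rightarrow> 'a list spmf" where
  "draws ex 0 = return_spmf []"
| "draws ex (Suc j) = bind_spmf ex (\<lambda>v. map_spmf (Cons v) (draws ex j))"

text \<open>The law of a concatenation, needed where two programs run in sequence and draw
  \<open>i\<close> and then \<open>j\<close> examples.\<close>

lemma draws_add:
  "draws ex (i + j) = bind_spmf (draws ex i) (\<lambda>xs. map_spmf (append xs) (draws ex j))"
proof (induction i)
  case 0
  have "(@) [] = (id :: 'a list \<Rightarrow> 'a list)" by auto
  then show ?case by simp
next
  case (Suc i)
  then show ?case
    by (auto simp: bind_map_spmf map_spmf_bind_spmf o_def spmf.map_comp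
        intro!: bind_spmf_cong map_spmf_cong)
qed

lemma draws_one: "draws ex (Suc 0) = map_spmf (\<lambda>v. [v]) ex"
  by (simp add: map_spmf_conv_bind_spmf)

lemma lossless_draws: "lossless_spmf ex \<Longrightarrow> lossless_spmf (draws ex j)"
  by (induction j) auto

lemma set_draws: "vs \<in> set_spmf (draws ex j) \<Longrightarrow> length vs = j \<and> set vs \<subseteq> set_spmf ex"
  by (induction j arbitrary: vs) (fastforce simp: set_bind_spmf)+

lemma exec_While:
  "exec ex (While e c) s =
     (if val (mem s) e \<noteq> 0
      then bind_spmf (exec ex c (tick (1 + cost (mem s) e) s)) (exec ex (While e c))
      else return_spmf (tick (1 + cost (mem s) e) s))"
proof (cases "val (mem s) e = 0")
  case True
  then show ?thesis by (simp add: while_spmf.simps[of _ _ s])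
next
  case False
  then show ?thesis by (simp add: while_spmf.simps[of _ _ s] map_spmf_bind_spmf o_def)
qed

text \<open>A syntactic bound on the arrays that are written. It is the frame condition in
  \<open>wp\<close>, so that specifications speak only of the arrays that change.\<close>

primrec mods :: "com \<Rightarrow> nat set" where
  "mods Skip = {}"
| "mods (Assign a e1 e2) = {a}"
| "mods (Flip a e) = {a}"
| "mods (Example a) = {a}"
| "mods (Seq c1 c2) = mods c1 \<union> mods c2"
| "mods (If e c1 c2) = mods c1 \<union> mods c2"
| "mods (While e c) = mods c"

text \<open>
  The unit of time is the square of the bit length of a common bound on all
  intermediate values, so that an expression costs at most its size.
\<close>

definition U :: "nat \<Rightarrow> nat" where "U B = (len B)\<^sup>2"

primrec esize :: "expr \<Rightarrow> nat" where
  "esize (Num v) = 1"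
| "esize (Read a e) = 1 + esize e"
| "esize (Plus e1 e2) = 1 + esize e1 + esize e2"
| "esize (Minus e1 e2) = 1 + esize e1 + esize e2"
| "esize (Times e1 e2) = 1 + esize e1 + esize e2"
| "esize (Quot e1 e2) = 1 + esize e1 + esize e2"

text \<open>Differences and quotients inherit the bound from their first operand, hence the absence
  of a condition on their values.\<close>

primrec bounded_by :: "nat \<Rightarrow> memory \<Rightarrow> expr \<Rightarrow> bool" where
  "bounded_by B m (Num v) = (v \<le> B)"
| "bounded_by B m (Read a e) = (bounded_by B m e \<and> m a (val m e) \<le> B)"
| "bounded_by B m (Plus e1 e2) = (bounded_by B m e1 \<and> bounded_by B m e2 \<and> val m e1 + val m e2 \<le> B)"
| "bounded_by B m (Minus e1 e2) = (bounded_by B m e1 \<and> bounded_by B m e2)"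
| "bounded_by B m (Times e1 e2) = (bounded_by B m e1 \<and> bounded_by B m e2 \<and> val m e1 * val m e2 \<le> B)"
| "bounded_by B m (Quot e1 e2) = (bounded_by B m e1 \<and> bounded_by B m e2)"

lemma len_mono: "x \<le> y \<Longrightarrow> len x \<le> len y"
  by (simp add: len_def floorlog_mono)

lemma U_ge_1: "1 \<le> U B"
  by (simp add: U_def len_def)

lemma len_le_U: "x \<le> B \<Longrightarrow> len x \<le> U B"
  using len_mono[of x B] le_square[of "len B"] unfolding U_def power2_eq_square by linarith

lemma val_le: "bounded_by B m e \<Longrightarrow> val m e \<le> B"
proof (induction e)
  case (Quot e1 e2)
  then show ?case by (auto intro: div_le_dividend order_trans)
qed auto

lemma len_mult_le_U: "x \<le> B \<Longrightarrow> y \<le> B \<Longrightarrow> len x * len y \<le> U B"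
  unfolding U_def power2_eq_square by (intro mult_mono len_mono) auto

lemma cost_le: "bounded_by B m e \<Longrightarrow> cost m e \<le> esize e * U B"
proof (induction e)
  case (Num v)
  then show ?case by (simp add: len_le_U)
next
  case (Read a e)
  then show ?case using len_le_U[of "m a (val m e)" B] by auto
next
  case (Plus e1 e2)
  then show ?case using len_le_U[of "val m e1 + val m e2" B] by (auto simp: algebra_simps)
next
  case (Minus e1 e2)
  then have "len (val m e1 - val m e2) \<le> U B"
    using val_le[of B m e1] by (intro len_le_U) auto
  with Minus show ?case by (auto simp: algebra_simps)
next
  case (Times e1 e2)
  then show ?case using len_mult_le_U[of "val m e1" B "val m e2"] val_le[of B m e1] val_le[of B m e2]
    by (auto simp: algebra_simps)
next
  case (Quot e1 e2)
  then show ?case using len_mult_le_U[of "val m e1" B "val m e2"] val_le[of B m e1] val_le[of B m e2]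
    by (auto simp: algebra_simps)
qed

text \<open>
  \<open>wp ex B c T j Q m\<close>: started in memory \<open>m\<close>, program \<open>c\<close> terminates within \<open>T\<close> units of time,
  draws exactly \<open>j\<close> examples, and its final memory is a function of the list of these
  that satisfies \<open>Q\<close>. In particular no coins are flipped.
\<close>

definition wp :: "nat list spmf \<Rightarrow> nat \<Rightarrow> com \<Rightarrow> nat \<Rightarrow> nat \<Rightarrow>
    (nat list list \<Rightarrow> memory \<Rightarrow> bool) \<Rightarrow> memory \<Rightarrow> bool" where
  "wp ex B c T j Q m \<longleftrightarrow> (\<exists>F d.
     (\<forall>s. mem s = m \<longrightarrow> exec ex c s =
        map_spmf (\<lambda>vs. s\<lparr>mem := F vs, time := time s + d vs, examples := examples s + j\<rparr>) (draws ex j)) \<and>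
     (\<forall>vs\<in>set_spmf (draws ex j). d vs \<le> T * U B \<and> Q vs (F vs) \<and> (\<forall>a. a \<notin> mods c \<longrightarrow> F vs a = m a)))"

lemma wpI:
  assumes "\<And>s. mem s = m \<Longrightarrow> exec ex c s =
        map_spmf (\<lambda>vs. s\<lparr>mem := F vs, time := time s + d vs, examples := examples s + j\<rparr>) (draws ex j)"
    and "\<And>vs. vs \<in> set_spmf (draws ex j) \<Longrightarrow> d vs \<le> T * U B"
    and "\<And>vs. vs \<in> set_spmf (draws ex j) \<Longrightarrow> Q vs (F vs)"
    and "\<And>vs a. vs \<in> set_spmf (draws ex j) \<Longrightarrow> a \<notin> mods c \<Longrightarrow> F vs a = m a"
  shows "wp ex B c T j Q m"
  unfolding wp_def using assms by blast

lemma wp_mono: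
  assumes "wp ex B c T j Q m" "T \<le> T'"
    and "\<And>vs m'. vs \<in> set_spmf (draws ex j) \<Longrightarrow> Q vs m' \<Longrightarrow> (\<And>a. a \<notin> mods c \<Longrightarrow> m' a = m a) \<Longrightarrow> Q' vs m'"
  shows "wp ex B c T' j Q' m"
proof -
  from assms(1) obtain F d where
    1: "\<forall>s. mem s = m \<longrightarrow> exec ex c s =
        map_spmf (\<lambda>vs. s\<lparr>mem := F vs, time := time s + d vs, examples := examples s + j\<rparr>) (draws ex j)"
    and 2: "\<forall>vs\<in>set_spmf (draws ex j). d vs \<le> T * U B \<and> Q vs (F vs) \<and> (\<forall>a. a \<notin> mods c \<longrightarrow> F vs a = m a)"
    unfolding wp_def by blast
  have 3: "T * U B \<le> T' * U B" using assms(2) by simp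
  show ?thesis
    by (rule wpI[where F = F and d = d]) (use 1 2 3 assms(3) in \<open>auto intro: order_trans\<close>)
qed

lemma wp_time: "wp ex B c T j Q m \<Longrightarrow> T \<le> T' \<Longrightarrow> wp ex B c T' j Q m"
  by (rule wp_mono)

lemma wp_skip: "Q [] m \<Longrightarrow> wp ex B Skip 1 0 Q m"
  by (rule wpI[where F = "\<lambda>_. m" and d = "\<lambda>_. 1"]) (use U_ge_1 in \<open>auto simp: tick_def\<close>)

lemma wp_assign:
  assumes "Q [] (m(a := (m a)(val m e1 := val m e2)))" "bounded_by B m e1" "bounded_by B m e2"
  shows "wp ex B (Assign a e1 e2) (1 + esize e1 + esize e2) 0 Q m"
proof (rule wpI[where F = "\<lambda>_. m(a := (m a)(val m e1 := val m e2))" and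
      d = "\<lambda>_. 1 + cost m e1 + cost m e2"])
  show "1 + cost m e1 + cost m e2 \<le> (1 + esize e1 + esize e2) * U B"
    using cost_le[OF assms(2)] cost_le[OF assms(3)] U_ge_1[of B] by (simp add: algebra_simps)
qed (use assms(1) in \<open>auto simp: tick_def store_def\<close>)

lemma wp_example:
  assumes "\<And>v. v \<in> set_spmf ex \<Longrightarrow>
     Q [v] (m(a := (\<lambda>i. if i < length v then v ! i else m a i)))"
    and "\<And>v. v \<in> set_spmf ex \<Longrightarrow> length v \<le> l"
  shows "wp ex B (Example a) (1 + l) (Suc 0) Q m"
proof (rule wpI[where F = "\<lambda>vs. m(a := (\<lambda>i. if i < length (hd vs) then hd vs ! i else m a i))" and
      d = "\<lambda>vs. 1 + length (hd vs)"])
  fix s :: state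
  assume "mem s = m"
  then show "exec ex (Example a) s = map_spmf
          (\<lambda>vs. s\<lparr>mem := m(a := \<lambda>i. if i < length (hd vs) then hd vs ! i else m a i),
                time := time s + (1 + length (hd vs)), examples := examples s + Suc 0\<rparr>)
          (draws ex (Suc 0))"
    unfolding draws_one
    by (auto simp: spmf.map_comp o_def tick_def store_list_def intro!: map_spmf_cong cong: if_cong)
next
  fix vs
  assume "vs \<in> set_spmf (draws ex (Suc 0))"
  then have "1 + length (hd vs) \<le> 1 + l"
    unfolding draws_one using assms(2) by auto
  also have "\<dots> \<le> (1 + l) * U B"
    using mult_le_mono2[OF U_ge_1[of B], of "1 + l"] by simp
  finally show "1 + length (hd vs) \<le> (1 + l) * U B" .
qed (use assms(1) in \<open>auto simp: draws_one simp del: draws.simps cong: if_cong\<close>)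

text \<open>The intermediate memory depends on the examples drawn so far, so the witnesses for
  \<open>c2\<close> form a family indexed by these and are obtained by choice.\<close>

lemma wp_seq:
  assumes 1: "wp ex B c1 T1 j1 Q1 m"
    and 2: "\<And>vs m'. vs \<in> set_spmf (draws ex j1) \<Longrightarrow> Q1 vs m' \<Longrightarrow> (\<And>a. a \<notin> mods c1 \<Longrightarrow> m' a = m a) \<Longrightarrow>
       wp ex B c2 T2 j2 (\<lambda>us. Q (vs @ us)) m'"
  shows "wp ex B (Seq c1 c2) (T1 + T2) (j1 + j2) Q m"
proof -
  from 1 obtain F d where
    F: "\<forall>s. mem s = m \<longrightarrow> exec ex c1 s =
        map_spmf (\<lambda>vs. s\<lparr>mem := F vs, time := time s + d vs, examples := examples s + j1\<rparr>) (draws ex j1)"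
    and F': "\<forall>vs\<in>set_spmf (draws ex j1). d vs \<le> T1 * U B \<and> Q1 vs (F vs) \<and> (\<forall>a. a \<notin> mods c1 \<longrightarrow> F vs a = m a)"
    unfolding wp_def by blast
  have "\<forall>vs\<in>set_spmf (draws ex j1). wp ex B c2 T2 j2 (\<lambda>us. Q (vs @ us)) (F vs)"
    using F' 2 by blast
  note * = bchoice[OF this[unfolded wp_def]]
  from * obtain G where
    "\<forall>vs\<in>set_spmf (draws ex j1). \<exists>e. (\<forall>s. mem s = F vs \<longrightarrow> exec ex c2 s =
        map_spmf (\<lambda>us. s\<lparr>mem := G vs us, time := time s + e us, examples := examples s + j2\<rparr>) (draws ex j2)) \<and>
     (\<forall>us\<in>set_spmf (draws ex j2). e us \<le> T2 * U B \<and> Q (vs @ us) (G vs us) \<and> (\<forall>a. a \<notin> mods c2 \<longrightarrow> G vs us a = F vs a))"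
    ..
  from bchoice[OF this] obtain e where
    G: "\<forall>vs\<in>set_spmf (draws ex j1). (\<forall>s. mem s = F vs \<longrightarrow> exec ex c2 s =
        map_spmf (\<lambda>us. s\<lparr>mem := G vs us, time := time s + e vs us, examples := examples s + j2\<rparr>) (draws ex j2)) \<and>
     (\<forall>us\<in>set_spmf (draws ex j2). e vs us \<le> T2 * U B \<and> Q (vs @ us) (G vs us) \<and> (\<forall>a. a \<notin> mods c2 \<longrightarrow> G vs us a = F vs a))"
    ..
  \<comment> \<open>All lists in the support of \<open>draws ex j1\<close> have length
    \<open>j1\<close>, so cutting at \<open>j1\<close> recovers the examples of each
    program.\<close>
  let ?F = "\<lambda>ws. G (take j1 ws) (drop j1 ws)"
  let ?d = "\<lambda>ws. d (take j1 ws) + e (take j1 ws) (drop j1 ws)"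
  have set: "take j1 ws \<in> set_spmf (draws ex j1) \<and> drop j1 ws \<in> set_spmf (draws ex j2)"
    if "ws \<in> set_spmf (draws ex (j1 + j2))" for ws
  proof -
    from that obtain xs ys where "xs \<in> set_spmf (draws ex j1)" "ys \<in> set_spmf (draws ex j2)" "ws = xs @ ys"
      by (auto simp: draws_add set_bind_spmf)
    moreover from this have "length xs = j1" using set_draws by blast
    ultimately show ?thesis by simp
  qed
  have len: "length vs = j1" if "vs \<in> set_spmf (draws ex j1)" for vs
    using set_draws[OF that] by blast
  show ?thesis
  proof (rule wpI[where F = ?F and d = ?d])
    fix s :: state
    assume "mem s = m"
    then show "exec ex (Seq c1 c2) s = map_spmf
          (\<lambda>vs. s\<lparr>mem := ?F vs, time := time s + ?d vs, examples := examples s + (j1 + j2)\<rparr>)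
          (draws ex (j1 + j2))"
      by (auto simp: F G draws_add bind_map_spmf map_spmf_bind_spmf o_def spmf.map_comp add.assoc
          len intro!: bind_spmf_cong map_spmf_cong)
  next
    fix ws
    assume ws: "ws \<in> set_spmf (draws ex (j1 + j2))"
    note set = set[OF ws]
    show "?d ws \<le> (T1 + T2) * U B"
      using F' G set by (auto simp: algebra_simps intro!: add_mono)
    show "Q ws (?F ws)"
      using G set by (metis append_take_drop_id)
    show "?F ws a = m a" if "a \<notin> mods (Seq c1 c2)" for a
      using F' G set that by auto
  qed
qed

text \<open>The assertion between the programs is the \<open>wp\<close> of the second one. Applied
  to assignments, this amounts to symbolic execution.\<close>

lemma wp_seq0:
  assumes "wp ex B c1 T1 0 (\<lambda>_ m'. (\<forall>a. a \<notin> mods c1 \<longrightarrow> m' a = m a) \<longrightarrow> wp ex B c2 T2 j Q m') m"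
  shows "wp ex B (Seq c1 c2) (T1 + T2) j Q m"
  using wp_seq[OF assms, where ?j2.0 = j and ?T2.0 = T2 and Q = Q] by simp

lemma wp_seq_det:
  assumes "wp ex B c1 T1 0 (\<lambda>_. Q1) m"
    and "\<And>m'. Q1 m' \<Longrightarrow> (\<And>a. a \<notin> mods c1 \<Longrightarrow> m' a = m a) \<Longrightarrow> wp ex B c2 T2 j Q m'"
  shows "wp ex B (Seq c1 c2) (T1 + T2) j Q m"
  by (rule wp_seq0, rule wp_mono[OF assms(1) order_refl]) (use assms(2) in blast)

lemma exec_tick: 
  assumes "\<And>s. mem s = m \<Longrightarrow> exec ex c s =
        map_spmf (\<lambda>vs. s\<lparr>mem := F vs, time := time s + d vs, examples := examples s + j\<rparr>) (draws ex j)"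
    and "mem s = m"
  shows "exec ex c (tick n s) =
        map_spmf (\<lambda>vs. s\<lparr>mem := F vs, time := time s + (n + d vs), examples := examples s + j\<rparr>) (draws ex j)"
  by (subst assms(1)) (simp_all add: assms(2) tick_def add.assoc)

text \<open>The sum of the two bounds replaces their maximum: time bounds stay polynomial
  expressions, and only constants are lost.\<close>

lemma wp_if:
  assumes 1: "val m e \<noteq> 0 \<Longrightarrow> wp ex B c1 T1 j Q m"
    and 2: "val m e = 0 \<Longrightarrow> wp ex B c2 T2 j Q m"
    and b: "bounded_by B m e"
  shows "wp ex B (If e c1 c2) (1 + esize e + (T1 + T2)) j Q m"
proof -
  define c where "c = (if val m e \<noteq> 0 then c1 else c2)"
  have "wp ex B c (T1 + T2) j Q m"
    using 1 2 wp_mono[of ex B c1 T1 j Q m "T1 + T2" Q] wp_mono[of ex B c2 T2 j Q m "T1 + T2" Q]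
    by (auto simp: c_def)
  then obtain F d where
    F: "\<And>s. mem s = m \<Longrightarrow> exec ex c s =
        map_spmf (\<lambda>vs. s\<lparr>mem := F vs, time := time s + d vs, examples := examples s + j\<rparr>) (draws ex j)"
    and F': "\<forall>vs\<in>set_spmf (draws ex j). d vs \<le> (T1 + T2) * U B \<and> Q vs (F vs) \<and> (\<forall>a. a \<notin> mods c \<longrightarrow> F vs a = m a)"
    unfolding wp_def by blast
  have *: "1 + cost m e \<le> (1 + esize e) * U B"
    using cost_le[OF b] U_ge_1[of B] by simp
  have m: "mods c \<subseteq> mods (If e c1 c2)"
    by (auto simp: c_def)
  show ?thesis
  proof (rule wpI[where F = F and d = "\<lambda>vs. 1 + cost m e + d vs"])
    fix s :: state
    assume s: "mem s = m"
    have "exec ex (If e c1 c2) s = exec ex c (tick (1 + cost m e) s)"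
      using s by (simp add: c_def)
    then show "exec ex (If e c1 c2) s = map_spmf
          (\<lambda>vs. s\<lparr>mem := F vs, time := time s + (1 + cost m e + d vs), examples := examples s + j\<rparr>)
          (draws ex j)"
      using exec_tick[OF F s] by simp
  next
    fix vs
    assume "vs \<in> set_spmf (draws ex j)"
    then have "d vs \<le> (T1 + T2) * U B" using F' by blast
    then show "1 + cost m e + d vs \<le> (1 + esize e + (T1 + T2)) * U B"
      using * by (simp add: algebra_simps)
  qed (use F' m in auto)
qed

lemma wp_while_false:
  assumes "val m e = 0" "bounded_by B m e" "Q [] m"
  shows "wp ex B (While e c) (1 + esize e) 0 Q m"
proof (rule wpI[where F = "\<lambda>_. m" and d = "\<lambda>_. 1 + cost m e"])
  show "1 + cost m e \<le> (1 + esize e) * U B"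
    using cost_le[OF assms(2)] U_ge_1[of B] by simp
  show "exec ex (While e c) s = map_spmf (\<lambda>vs. s\<lparr>mem := m, time := time s + (1 + cost m e),
    examples := examples s + 0\<rparr>) (draws ex 0)" if "mem s = m" for s
    using assms that by (subst exec_While) (simp add: tick_def)
qed (use assms in auto)

lemma wp_while_true:
  assumes "val m e \<noteq> 0" "bounded_by B m e" "wp ex B (Seq c (While e c)) T j Q m"
  shows "wp ex B (While e c) (1 + esize e + T) j Q m"
proof -
  from assms(3) obtain F d where
    F: "\<And>s. mem s = m \<Longrightarrow> exec ex (Seq c (While e c)) s =
        map_spmf (\<lambda>vs. s\<lparr>mem := F vs, time := time s + d vs, examples := examples s + j\<rparr>) (draws ex j)"
    and F': "\<forall>vs\<in>set_spmf (draws ex j). d vs \<le> T * U B \<and> Q vs (F vs) \<and>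
       (\<forall>a. a \<notin> mods (Seq c (While e c)) \<longrightarrow> F vs a = m a)"
    unfolding wp_def by blast
  show ?thesis
  proof (rule wpI[where F = F and d = "\<lambda>vs. 1 + cost m e + d vs"])
    fix s :: state
    assume s: "mem s = m"
    have "exec ex (While e c) s = exec ex (Seq c (While e c)) (tick (1 + cost m e) s)"
      using s assms(1) by (subst exec_While) (simp del: exec.simps(7))
    then show "exec ex (While e c) s = map_spmf
          (\<lambda>vs. s\<lparr>mem := F vs, time := time s + (1 + cost m e + d vs), examples := examples s + j\<rparr>)
          (draws ex j)"
      using exec_tick[OF F s] by simp
  next
    fix vs
    assume "vs \<in> set_spmf (draws ex j)"
    then have "d vs \<le> T * U B" using F' by blast
    moreover have "1 + cost m e \<le> (1 + esize e) * U B"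
      using cost_le[OF assms(2)] U_ge_1[of B] by simp
    ultimately show "1 + cost m e + d vs \<le> (1 + esize e + T) * U B"
      by (simp add: algebra_simps)
  qed (use F' in auto)
qed

section \<open>Counting loops and unrolled repetition\<close>

abbreviation V :: "nat \<Rightarrow> expr" where "V a \<equiv> Read a (Num 0)"
abbreviation Set :: "nat \<Rightarrow> expr \<Rightarrow> com" where "Set a e \<equiv> Assign a (Num 0) e"

text \<open>Truncated subtraction makes the guard nonzero exactly as long as the counter is below
  the bound.\<close>

definition For :: "nat \<Rightarrow> nat \<Rightarrow> com \<Rightarrow> com" where
  "For i b c = Seq (Set i (Num 0))
     (While (Minus (V b) (V i)) (Seq c (Set i (Plus (V i) (Num 1)))))"

lemma mods_For [simp]: "mods (For i b c) = insert i (mods c)"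
  by (auto simp: For_def)

text \<open>Induction on the number of remaining rounds. Besides the body, a round costs 6 for the
  test and 6 for the increment; the final failing test costs another 6. The invariant is required of
  the memory with the counter already advanced, so that no body has to mention the
  increment.\<close>

lemma wp_For_aux:
  assumes body: "\<And>j vs m. j < N \<Longrightarrow> length vs = jb * j \<Longrightarrow> I j vs m \<Longrightarrow> m i 0 = j \<Longrightarrow>
      (\<And>a. a \<notin> insert i (mods c) \<Longrightarrow> m a = m0 a) \<Longrightarrow>
      wp ex B c Tb jb (\<lambda>us m'. I (Suc j) (vs @ us) (m'(i := (m' i)(0 := Suc j)))) m"
    and i: "i \<notin> mods c" "b \<notin> mods c" "b \<noteq> i"
    and N: "m0 b 0 = N" "N < B"
  shows "j \<le> N \<Longrightarrow> length vs = jb * j \<Longrightarrow> I j vs m \<Longrightarrow> m i 0 = j \<Longrightarrow> (\<And>a. a \<notin> insert i (mods c) \<Longrightarrow> m a = m0 a) \<Longrightarrow>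
    wp ex B (While (Minus (V b) (V i)) (Seq c (Set i (Plus (V i) (Num 1)))))
      ((N - j) * (Tb + 12) + 6) (jb * (N - j)) (\<lambda>us. I N (vs @ us)) m"
proof (induction "N - j" arbitrary: j vs m)
  case 0
  have "m b 0 = N" using "0.prems"(5)[of b] i N by auto
  then show ?case using 0 N
    by (auto intro!: wp_mono[OF wp_while_false[where Q = "\<lambda>us. I N (vs @ us)"]])
next
  case (Suc x)
  let ?W = "While (Minus (V b) (V i)) (Seq c (Set i (Plus (V i) (Num 1))))"
  have b: "m b 0 = N" using Suc.prems(5)[of b] i N by auto
  have j: "j < N" using Suc by auto
  have "wp ex B (Seq c (Set i (Plus (V i) (Num 1)))) (Tb + 6) (jb + 0)
    (\<lambda>us m'. I (Suc j) (vs @ us) m' \<and> m' i 0 = Suc j) m"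
  proof (rule wp_seq[OF body[OF j Suc.prems(2-5)]])
    fix us m'
    assume *: "I (Suc j) (vs @ us) (m'(i := (m' i)(0 := Suc j)))" "\<And>a. a \<notin> mods c \<Longrightarrow> m' a = m a"
    have "m' i 0 = j" using *(2)[of i] i Suc.prems(4) by auto
    then show "wp ex B (Set i (Plus (V i) (Num 1))) 6 0
          (\<lambda>usa m'. I (Suc j) (vs @ us @ usa) m' \<and> m' i 0 = Suc j) m'"
      using * N(2) j by (intro wp_time[OF wp_assign]) auto
  qed
  then have "wp ex B (Seq (Seq c (Set i (Plus (V i) (Num 1)))) ?W)
    ((Tb + 6) + ((N - Suc j) * (Tb + 12) + 6)) ((jb + 0) + (jb * (N - Suc j))) (\<lambda>us. I N (vs @ us)) m"
  proof (rule wp_seq)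
    fix us m'
    assume *: "us \<in> set_spmf (draws ex (jb + 0))" "I (Suc j) (vs @ us) m' \<and> m' i 0 = Suc j"
      "\<And>a. a \<notin> mods (Seq c (Set i (Plus (V i) (Num 1)))) \<Longrightarrow> m' a = m a"
    have "wp ex B ?W ((N - Suc j) * (Tb + 12) + 6) (jb * (N - Suc j)) (\<lambda>ws. I N ((vs @ us) @ ws)) m'"
    proof (rule Suc.hyps(1))
      show "length (vs @ us) = jb * Suc j" using *(1) Suc.prems(2) by (auto dest!: set_draws)
    qed (use * Suc.prems(5) Suc.hyps(2) j in auto)
    then show "wp ex B ?W ((N - Suc j) * (Tb + 12) + 6) (jb * (N - Suc j)) (\<lambda>ws. I N (vs @ us @ ws)) m'"
      by simp
  qed
  then have "wp ex B ?W (1 + esize (Minus (V b) (V i)) + ((Tb + 6) + ((N - Suc j) * (Tb + 12) + 6)))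
     ((jb + 0) + (jb * (N - Suc j))) (\<lambda>us. I N (vs @ us)) m"
    by (rule wp_while_true[rotated 2]) (use b j N Suc.prems in auto)
  moreover have "N - j = Suc (N - Suc j)" using j by simp
  ultimately show ?case by (simp add: add_ac)
qed

text \<open>The 9 consists of 6 for the last test and 3 for clearing the counter.\<close>

lemma wp_For:
  assumes "I 0 [] (m0(i := (m0 i)(0 := 0)))"
    and "\<And>j vs m. j < N \<Longrightarrow> length vs = jb * j \<Longrightarrow> I j vs m \<Longrightarrow> m i 0 = j \<Longrightarrow>
      (\<And>a. a \<notin> insert i (mods c) \<Longrightarrow> m a = m0 a) \<Longrightarrow>
      wp ex B c Tb jb (\<lambda>us m'. I (Suc j) (vs @ us) (m'(i := (m' i)(0 := Suc j)))) m"
    and "i \<notin> mods c" "b \<notin> mods c" "b \<noteq> i"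
    and "m0 b 0 = N" "N < B"
  shows "wp ex B (For i b c) (N * (Tb + 12) + 9) (jb * N) (I N) m0"
proof -
  let ?W = "While (Minus (V b) (V i)) (Seq c (Set i (Plus (V i) (Num 1))))"
  have "wp ex B ?W ((N - 0) * (Tb + 12) + 6) (jb * (N - 0)) (\<lambda>us. I N ([] @ us)) (m0(i := (m0 i)(0 := 0)))"
  proof (rule wp_For_aux)
    show "wp ex B c Tb jb (\<lambda>us m'. I (Suc j) (vs @ us) (m'(i := (m' i)(0 := Suc j)))) m"
      if "j < N" "length vs = jb * j" "I j vs m" "m i 0 = j"
        "\<And>a. a \<notin> insert i (mods c) \<Longrightarrow> m a = m0 a" for j vs m
      using that by (rule assms(2))
    show "I 0 [] (m0(i := (m0 i)(0 := 0)))" by (rule assms(1))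
  qed (use assms(3-) in auto)
  then have *: "wp ex B ?W (N * (Tb + 12) + 6) (jb * N) (I N) (m0(i := (m0 i)(0 := 0)))"
    by simp
  have "wp ex B (For i b c) (1 + esize (Num 0) + esize (Num 0) + (N * (Tb + 12) + 6)) (jb * N) (I N) m0"
    unfolding For_def by (rule wp_seq0, rule wp_assign) (use * in auto)
  then show ?thesis by (simp add: add_ac)
qed

lemma wp_For0:
  assumes "I 0 (m0(i := (m0 i)(0 := 0)))"
    and "\<And>j m. j < N \<Longrightarrow> I j m \<Longrightarrow> m i 0 = j \<Longrightarrow>
      (\<And>a. a \<notin> insert i (mods c) \<Longrightarrow> m a = m0 a) \<Longrightarrow>
      wp ex B c Tb 0 (\<lambda>us m'. I (Suc j) (m'(i := (m' i)(0 := Suc j)))) m"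
    and "i \<notin> mods c" "b \<notin> mods c" "b \<noteq> i"
    and "m0 b 0 = N" "N < B"
  shows "wp ex B (For i b c) (N * (Tb + 12) + 9) 0 (\<lambda>us. I N) m0"
proof -
  have "wp ex B (For i b c) (N * (Tb + 12) + 9) (0 * N) ((\<lambda>j vs. I j) N) m0"
  proof (rule wp_For)
    show "I 0 (m0(i := (m0 i)(0 := 0)))" by (rule assms(1))
    show "wp ex B c Tb 0 (\<lambda>us m'. I (Suc j) (m'(i := (m' i)(0 := Suc j)))) m"
      if "j < N" "length vs = 0 * j" "I j m" "m i 0 = j"
        "\<And>a. a \<notin> insert i (mods c) \<Longrightarrow> m a = m0 a" for j m and vs :: "nat list list"
      using that(1,3-) by (rule assms(2))
  qed (use assms(3-) in auto)
  then show ?thesis by (simp only: mult_0)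
qed

primrec repeat :: "nat \<Rightarrow> com \<Rightarrow> com" where
  "repeat 0 c = Skip"
| "repeat (Suc l) c = Seq c (repeat l c)"

lemma mods_repeat: "mods (repeat l c) \<subseteq> mods c"
  by (induction l) auto

lemma wp_repeat:
  assumes body: "\<And>vs m. I vs m \<Longrightarrow> (\<And>a. a \<notin> mods c \<Longrightarrow> m a = m0 a) \<Longrightarrow>
      wp ex B c Tb jb (\<lambda>us m'. I (vs @ us) m') m"
    and "I vs m" "\<And>a. a \<notin> mods c \<Longrightarrow> m a = m0 a"
  shows "wp ex B (repeat l c) (l * Tb + 1) (jb * l) (\<lambda>us. I (vs @ us)) m"
  using assms(2,3)
proof (induction l arbitrary: vs m)
  case 0
  then show ?case using wp_skip[of "\<lambda>us. I (vs @ us)" m ex B] by simp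
next
  case (Suc l)
  have "wp ex B (Seq c (repeat l c)) (Tb + (l * Tb + 1)) (jb + jb * l) (\<lambda>us. I (vs @ us)) m"
  proof (rule wp_seq[OF body[OF Suc.prems]])
    fix us m'
    assume "I (vs @ us) m'" "\<And>a. a \<notin> mods c \<Longrightarrow> m' a = m a"
    then have "wp ex B (repeat l c) (l * Tb + 1) (jb * l) (\<lambda>ws. I ((vs @ us) @ ws)) m'"
      by (intro Suc.IH) (use Suc.prems in auto)
    then show "wp ex B (repeat l c) (l * Tb + 1) (jb * l) (\<lambda>ws. I (vs @ us @ ws)) m'"
      by simp
  qed auto
  then show ?case by (simp add: add_ac)
qed

section \<open>Deterministic programs and renaming of arrays\<close>

text \<open>The programs for \<open>k\<close> and \<open>t\<close> are known only through
  \<open>exec\<close>. Renaming their arrays calls for an induction over their runs, which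
  derivation trees offer and the fixed point \<open>while_spmf\<close> does not.\<close>

inductive big_step :: "com \<Rightarrow> memory \<Rightarrow> nat \<Rightarrow> memory \<Rightarrow> bool" where
  Skip: "big_step Skip m 1 m"
| Assign: "big_step (Assign a e1 e2) m (1 + cost m e1 + cost m e2) (m(a := (m a)(val m e1 := val m e2)))"
| Seq: "big_step c1 m d1 m1 \<Longrightarrow> big_step c2 m1 d2 m2 \<Longrightarrow> big_step (Seq c1 c2) m (d1 + d2) m2"
| IfTrue: "val m e \<noteq> 0 \<Longrightarrow> big_step c1 m d m' \<Longrightarrow> big_step (If e c1 c2) m (1 + cost m e + d) m'"
| IfFalse: "val m e = 0 \<Longrightarrow> big_step c2 m d m' \<Longrightarrow> big_step (If e c1 c2) m (1 + cost m e + d) m'"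
| WhileFalse: "val m e = 0 \<Longrightarrow> big_step (While e c) m (1 + cost m e) m"
| WhileTrue: "val m e \<noteq> 0 \<Longrightarrow> big_step c m d1 m1 \<Longrightarrow> big_step (While e c) m1 d2 m2 \<Longrightarrow>
    big_step (While e c) m (1 + cost m e + d1 + d2) m2"

text \<open>Fixed point induction: the support of a least upper bound is the union of the supports,
  so a property of all possible results is admissible.\<close>

lemma while_spmf_induct:
  assumes "s' \<in> set_spmf (while_spmf g b s)"
    and "\<And>s. \<not> g s \<Longrightarrow> R s s"
    and "\<And>s s1 s'. g s \<Longrightarrow> s1 \<in> set_spmf (b s) \<Longrightarrow> R s1 s' \<Longrightarrow> R s s'"
  shows "R s s'"
proof -
  have "\<forall>s. \<forall>s'\<in>set_spmf (while_spmf g b s). R s s'"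
  proof (induction rule: while_spmf.fixp_induct)
    case 1
    show ?case
      by (auto intro!: ccpo.admissibleI simp: fun_lub_def set_lub_spmf)
  next
    case 2
    show ?case by simp
  next
    case (3 w)
    then show ?case using assms(2,3) by (auto simp: set_bind_spmf split: if_splits)
  qed
  then show ?thesis using assms(1) by blast
qed

lemma exec_imp_big_step:
  "deterministic c \<Longrightarrow> s' \<in> set_spmf (exec ex c s) \<Longrightarrow>
     \<exists>d. big_step c (mem s) d (mem s') \<and> time s' = time s + d"
proof (induction c arbitrary: s s')
  case Skip
  then show ?case using big_step.Skip[of "mem s"] by (auto simp: tick_def)
next
  case (Assign a e1 e2)
  then have "mem s' = (mem s)(a := (mem s a)(val (mem s) e1 := val (mem s) e2))"
    "time s' = time s + (1 + cost (mem s) e1 + cost (mem s) e2)"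
    by (simp_all add: tick_def store_def)
  then show ?case using big_step.Assign[of a e1 e2 "mem s"] by metis
next
  case (Seq c1 c2)
  then obtain s1 where s1: "s1 \<in> set_spmf (exec ex c1 s)" "s' \<in> set_spmf (exec ex c2 s1)"
    by (auto simp: set_bind_spmf)
  then show ?case using Seq.IH(1)[OF _ s1(1)] Seq.IH(2)[OF _ s1(2)] Seq.prems
    by (auto simp: add.assoc intro: big_step.intros)
next
  case (If e c1 c2)
  show ?case
  proof (cases "val (mem s) e = 0")
    case True
    then have "\<exists>d. big_step c2 (mem s) d (mem s') \<and> time s' = time s + (1 + cost (mem s) e) + d"
      using If.IH(2)[of s' "tick (1 + cost (mem s) e) s"] If.prems by (simp add: tick_def)
    then show ?thesis using big_step.IfFalse[OF True] by (metis add.assoc)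
  next
    case False
    then have "\<exists>d. big_step c1 (mem s) d (mem s') \<and> time s' = time s + (1 + cost (mem s) e) + d"
      using If.IH(1)[of s' "tick (1 + cost (mem s) e) s"] If.prems by (simp add: tick_def)
    then show ?thesis using big_step.IfTrue[OF False] by (metis add.assoc)
  qed
next
  case (While e c)
  let ?g = "\<lambda>s. val (mem s) e \<noteq> 0"
  let ?b = "\<lambda>s. exec ex c (tick (1 + cost (mem s) e) s)"
  from While.prems obtain s1 where s1: "s1 \<in> set_spmf (while_spmf ?g ?b s)"
    and s': "s' = tick (1 + cost (mem s1) e) s1" by auto
  \<comment> \<open>The exit test is charged outside \<open>while_spmf\<close>; the relation between
    initial and final states therefore adds it to the time of the latter.\<close>
  have "\<exists>d. big_step (While e c) (mem s) d (mem s1) \<and> time s1 + (1 + cost (mem s1) e) = time s + d"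
    using s1
  proof (rule while_spmf_induct)
    fix s
    assume "\<not> ?g s"
    then show "\<exists>d. big_step (While e c) (mem s) d (mem s) \<and> time s + (1 + cost (mem s) e) = time s + d"
      using big_step.WhileFalse[of "mem s" e c] by (intro exI[of _ "1 + cost (mem s) e"]) auto
  next
    fix s s2 s3
    assume g: "?g s" and s2: "s2 \<in> set_spmf (?b s)"
      and IH: "\<exists>d. big_step (While e c) (mem s2) d (mem s3) \<and> time s3 + (1 + cost (mem s3) e) = time s2 + d"
    have "\<exists>d. big_step c (mem s) d (mem s2) \<and> time s2 = time s + (1 + cost (mem s) e) + d"
      using While.IH[OF _ s2] While.prems by (simp add: tick_def)
    with IH obtain d1 d2 where "big_step c (mem s) d1 (mem s2)" "time s2 = time s + (1 + cost (mem s) e) + d1"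
      "big_step (While e c) (mem s2) d2 (mem s3)" "time s3 + (1 + cost (mem s3) e) = time s2 + d2" by blast
    then show "\<exists>d. big_step (While e c) (mem s) d (mem s3) \<and> time s3 + (1 + cost (mem s3) e) = time s + d"
      using big_step.WhileTrue[OF g] by (intro exI[of _ "1 + cost (mem s) e + d1 + d2"]) auto
  qed
  then show ?case by (auto simp: s' tick_def)
qed auto

text \<open>A derivation does not mention the source of examples. Behaviour known for the empty
  source \<open>return_pmf None\<close> thus carries over to the uniform examples.\<close>

lemma big_step_exec:
  "big_step c m d m' \<Longrightarrow> mem s = m \<Longrightarrow> exec ex c s = return_spmf (s\<lparr>mem := m', time := time s + d\<rparr>)"
proof (induction arbitrary: s rule: big_step.induct)
  case (WhileFalse m e c)
  then show ?case by (subst exec_While) (simp add: tick_def)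
next
  case (WhileTrue m e c d1 m1 d2 m2)
  then show ?case by (subst exec_While) (simp add: tick_def add_ac del: exec.simps(7))
qed (auto simp: tick_def store_def add_ac)

section \<open>Injective renaming of arrays\<close>

primrec ren_expr :: "(nat \<Rightarrow> nat) \<Rightarrow> expr \<Rightarrow> expr" where
  "ren_expr f (Num v) = Num v"
| "ren_expr f (Read a e) = Read (f a) (ren_expr f e)"
| "ren_expr f (Plus e1 e2) = Plus (ren_expr f e1) (ren_expr f e2)"
| "ren_expr f (Minus e1 e2) = Minus (ren_expr f e1) (ren_expr f e2)"
| "ren_expr f (Times e1 e2) = Times (ren_expr f e1) (ren_expr f e2)"
| "ren_expr f (Quot e1 e2) = Quot (ren_expr f e1) (ren_expr f e2)"

primrec ren :: "(nat \<Rightarrow> nat) \<Rightarrow> com \<Rightarrow> com" where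
  "ren f Skip = Skip"
| "ren f (Assign a e1 e2) = Assign (f a) (ren_expr f e1) (ren_expr f e2)"
| "ren f (Flip a e) = Flip (f a) (ren_expr f e)"
| "ren f (Example a) = Example (f a)"
| "ren f (Seq c1 c2) = Seq (ren f c1) (ren f c2)"
| "ren f (If e c1 c2) = If (ren_expr f e) (ren f c1) (ren f c2)"
| "ren f (While e c) = While (ren_expr f e) (ren f c)"

lemma val_ren: "(\<lambda>a. M (f a)) = m \<Longrightarrow> val M (ren_expr f e) = val m e"
  by (induction e) auto

lemma cost_ren: "(\<lambda>a. M (f a)) = m \<Longrightarrow> cost M (ren_expr f e) = cost m e"
  by (induction e) (auto simp: val_ren)

lemma mods_ren: "mods (ren f c) \<subseteq> range f"
  by (induction c) auto

text \<open>Injectivity keeps different arrays apart, and reads and writes stay inside the range of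
  \<open>f\<close>. Outside of it \<open>M\<close> is arbitrary, so the renamed program can run
  within the memory of a larger one.\<close>

lemma big_step_ren:
  assumes "inj f"
  shows "big_step c m d m' \<Longrightarrow> (\<lambda>a. M (f a)) = m \<Longrightarrow> \<exists>M'. big_step (ren f c) M d M' \<and> (\<lambda>a. M' (f a)) = m'"
proof (induction arbitrary: M rule: big_step.induct)
  case (Skip m)
  then show ?case using big_step.Skip[of M] by auto
next
  case (Assign a e1 e2 m)
  have "(\<lambda>b. (M(f a := (M (f a))(val m e1 := val m e2))) (f b)) = m(a := (m a)(val m e1 := val m e2))"
    using assms Assign by (auto simp: inj_eq)
  moreover have "big_step (ren f (Assign a e1 e2)) M (1 + cost m e1 + cost m e2)
      (M(f a := (M (f a))(val m e1 := val m e2)))"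
    using big_step.Assign[of "f a" "ren_expr f e1" "ren_expr f e2" M] Assign
    by (simp add: val_ren cost_ren fun_cong[OF Assign])
  ultimately show ?case by blast
next
  case (Seq c1 m d1 m1 c2 d2 m2)
  then show ?case by (fastforce intro: big_step.intros)
next
  case (IfTrue m e c1 d m' c2)
  then show ?case using big_step.IfTrue[of M "ren_expr f e" "ren f c1" d _ "ren f c2"]
    by (fastforce simp: val_ren cost_ren)
next
  case (IfFalse m e c2 d m' c1)
  then show ?case using big_step.IfFalse[of M "ren_expr f e" "ren f c2" d _ "ren f c1"]
    by (fastforce simp: val_ren cost_ren)
next
  case (WhileFalse m e c)
  then show ?case using big_step.WhileFalse[of M "ren_expr f e" "ren f c"]
    by (auto simp: val_ren cost_ren)
next
  case (WhileTrue m e c d1 m1 d2 m2)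
  then obtain M1 M2 where "big_step (ren f c) M d1 M1" "(\<lambda>a. M1 (f a)) = m1"
    "big_step (ren f (While e c)) M1 d2 M2" "(\<lambda>a. M2 (f a)) = m2"
    using WhileTrue.IH(1)[OF WhileTrue.prems] WhileTrue.IH(2) by metis
  then show ?case using big_step.WhileTrue[of M "ren_expr f e" "ren f c" d1 M1 d2 M2] WhileTrue
    by (auto simp: val_ren cost_ren)
qed

lemma big_step_frame: "big_step c m d m' \<Longrightarrow> a \<notin> mods c \<Longrightarrow> m' a = m a"
  by (induction rule: big_step.induct) auto

text \<open>The values of \<open>A\<close> may exceed \<open>B\<close>: its time is given as such,
  not through expression sizes, and a unit \<open>U B\<close> is at least 1.\<close>

lemma wp_ren:
  assumes "deterministic A" "exec (return_pmf None) A (initial n) = return_spmf s"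
    and "time s \<le> T" "inj f" "(\<lambda>a. m (f a)) = mem (initial n)"
  shows "wp ex B (ren f A) T 0 (\<lambda>_ m'. m' (f 1) = mem s 1) m"
proof -
  obtain d where d: "big_step A (mem (initial n)) d (mem s)" "time s = d"
    using exec_imp_big_step[OF assms(1), of s "return_pmf None" "initial n"] assms(2)
    by (auto simp: initial_def)
  obtain m' where m': "big_step (ren f A) m d m'" "(\<lambda>a. m' (f a)) = mem s"
    using big_step_ren[OF assms(4) d(1) assms(5)] by blast
  have "d \<le> T * U B"
    using d(2) assms(3) U_ge_1[of B] by (metis mult.right_neutral mult_le_mono2 order_trans)
  then show ?thesis
    using big_step_exec[OF m'(1)] big_step_frame[OF m'(1)] m'(2)
    by (intro wpI[where F = "\<lambda>_. m'" and d = "\<lambda>_. d"]) (auto dest: fun_cong)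
qed

section \<open>Null spaces over the two-element field\<close>

definition bits :: "nat \<Rightarrow> (nat \<Rightarrow> nat) \<Rightarrow> bool" where
  "bits N v \<longleftrightarrow> (\<forall>j<N. v j \<le> 1)"

text \<open>An integer, as the program accumulates it; only its parity carries meaning.\<close>

definition dot :: "nat \<Rightarrow> (nat \<Rightarrow> nat) \<Rightarrow> (nat \<Rightarrow> nat) \<Rightarrow> nat" where
  "dot N v y = (\<Sum>j<N. v j * y j)"

text \<open>
  The rows of \<open>M\<close> span the space of vectors orthogonal to \<open>Us\<close>, in the strong form that
  each vector \<open>y\<close> of this space is itself the list of coefficients of \<open>y\<close>. This form
  survives the elimination step below without any change of coefficients.
\<close>

definition spans_null :: "nat \<Rightarrow> (nat \<Rightarrow> nat) set \<Rightarrow> (nat \<Rightarrow> nat \<Rightarrow> nat) \<Rightarrow> bool" where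
  "spans_null N Us M \<longleftrightarrow>
     (\<forall>r<N. bits N (M r)) \<and> (\<forall>u\<in>Us. \<forall>r<N. even (dot N u (M r))) \<and>
     (\<forall>y. bits N y \<and> (\<forall>u\<in>Us. even (dot N u y)) \<longrightarrow>
        (\<forall>j<N. (\<Sum>r<N. y r * M r j) mod 2 = y j))"

text \<open>\<open>P\<close> is the pivot row, and arbitrary when every row is already orthogonal to
  \<open>v\<close>. The pivot is added to itself too, which turns it into the zero row; the number
  of rows stays \<open>N\<close>.\<close>

definition eliminates :: "nat \<Rightarrow> (nat \<Rightarrow> nat) \<Rightarrow> (nat \<Rightarrow> nat \<Rightarrow> nat) \<Rightarrow> (nat \<Rightarrow> nat \<Rightarrow> nat) \<Rightarrow> bool" where
  "eliminates N v M M' \<longleftrightarrow> (\<exists>P.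
     (\<forall>r<N. \<forall>j<N. M' r j = (if odd (dot N v (M r)) then (M r j + P j) mod 2 else M r j)) \<and>
     ((\<forall>r<N. even (dot N v (M r))) \<or> (\<exists>p<N. odd (dot N v (M p)) \<and> (\<forall>j<N. P j = M p j))))"

lemma sum_mod_cong:
  fixes f g :: "'a \<Rightarrow> nat"
  assumes "\<And>i. i \<in> A \<Longrightarrow> f i mod 2 = g i mod 2"
  shows "sum f A mod 2 = sum g A mod 2"
proof -
  have "(\<Sum>i\<in>A. f i mod 2) = (\<Sum>i\<in>A. g i mod 2)" using assms by (rule sum.cong[OF refl])
  then show ?thesis by (metis mod_sum_eq)
qed

lemma even_dot_add:
  assumes "\<And>j. j < N \<Longrightarrow> z j = (x j + p j) mod 2"
  shows "even (dot N u z) \<longleftrightarrow> even (dot N u x + dot N u p)"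
proof -
  have "dot N u z mod 2 = (\<Sum>j<N. (u j * z j) mod 2) mod 2"
    unfolding dot_def by (simp add: mod_sum_eq)
  also have "\<dots> = (\<Sum>j<N. (u j * x j + u j * p j) mod 2) mod 2"
    using assms by (auto intro!: arg_cong[of _ _ "\<lambda>x. x mod 2"] sum.cong
        simp: mod_mult_right_eq distrib_left[symmetric])
  also have "\<dots> = (dot N u x + dot N u p) mod 2"
    unfolding dot_def by (simp add: mod_sum_eq sum.distrib)
  finally show ?thesis by (metis even_iff_mod_2_eq_zero)
qed

text \<open>Odd plus odd is even, so the new rows are orthogonal to \<open>v\<close>. If
  \<open>y\<close> is orthogonal to \<open>v\<close>, then the sum of
  \<open>y r * dot N v (M r)\<close> over the rows has the parity of \<open>dot N v y\<close>, by
  bilinearity and because \<open>y\<close> is the combination of the rows with coefficients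
  \<open>y\<close>. Hence \<open>P\<close> is added an even number of times in this combination,
  which does not change.\<close>

lemma spans_null_eliminates:
  assumes "spans_null N Us M" "eliminates N v M M'"
  shows "spans_null N (insert v Us) M'"
proof -
  let ?d = "\<lambda>r. dot N v (M r)"
  from assms(2) obtain P where
    M': "\<And>r j. r < N \<Longrightarrow> j < N \<Longrightarrow> M' r j = (if odd (?d r) then (M r j + P j) mod 2 else M r j)"
    and P: "(\<forall>r<N. even (?d r)) \<or> (\<exists>p<N. odd (?d p) \<and> (\<forall>j<N. P j = M p j))"
    unfolding eliminates_def by blast
  from assms(1) have b: "\<And>r j. r < N \<Longrightarrow> j < N \<Longrightarrow> M r j \<le> 1"
    and s: "\<And>u r. u \<in> Us \<Longrightarrow> r < N \<Longrightarrow> even (dot N u (M r))"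
    and g: "\<And>y j. bits N y \<Longrightarrow> (\<And>u. u \<in> Us \<Longrightarrow> even (dot N u y)) \<Longrightarrow> j < N \<Longrightarrow>
      (\<Sum>r<N. y r * M r j) mod 2 = y j"
    unfolding spans_null_def bits_def by blast+
  have dP: "even (dot N u P) \<longleftrightarrow> even (dot N u (M p))" if "\<forall>j<N. P j = M p j" for u p
    using that by (simp add: dot_def)
  have same: "dot N u (M' r) = dot N u (M r)" if "r < N" "even (?d r)" for u r
    using that M' by (simp add: dot_def)
  have add: "even (dot N u (M' r)) \<longleftrightarrow> even (dot N u (M r) + dot N u P)" if "r < N" "odd (?d r)" for u r
    using that M' by (intro even_dot_add) auto
  have sound: "even (dot N u (M' r))" if u: "u \<in> insert v Us" and r: "r < N" for u r
  proof (cases "even (?d r)")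
    case True
    then show ?thesis using same[OF r] s r u by auto
  next
    case False
    then obtain p where p: "p < N" "odd (?d p)" "\<forall>j<N. P j = M p j" using P r by blast
    then show ?thesis using add[OF r False] dP[OF p(3)] False s r u by auto
  qed
  have gen: "(\<Sum>r<N. y r * M' r j) mod 2 = y j"
    if y: "bits N y" "\<And>u. u \<in> insert v Us \<Longrightarrow> even (dot N u y)" and j: "j < N" for y j
  proof -
    have eq: "(\<Sum>r<N. y r * M r i) mod 2 = y i" if "i < N" for i
      using g[OF y(1) _ that] y(2) by auto
    have "(\<Sum>r<N. y r * ?d r) = (\<Sum>i<N. v i * (\<Sum>r<N. y r * M r i))"
      unfolding dot_def sum_distrib_left by (subst sum.swap) (simp add: mult_ac)
    also have "\<dots> mod 2 = dot N v y mod 2"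
      unfolding dot_def
    proof (rule sum_mod_cong)
      fix i
      assume "i \<in> {..<N}"
      then show "(v i * (\<Sum>r<N. y r * M r i)) mod 2 = (v i * y i) mod 2"
        using eq[of i] by (metis lessThan_iff mod_mult_right_eq)
    qed
    also have "\<dots> = 0" using y(2)[of v] by simp
    finally have even: "(\<Sum>r<N. y r * ?d r) mod 2 = 0" .
    \<comment> \<open>Modulo 2, the case distinction of the elimination becomes the single formula
      \<open>M r j + ?d r * P j\<close>.\<close>
    have "(\<Sum>r<N. y r * M' r j) mod 2 = (\<Sum>r<N. y r * M r j + y r * ?d r * P j) mod 2"
    proof (rule sum_mod_cong)
      fix r
      assume r: "r \<in> {..<N}"
      have *: "M' r j mod 2 = (M r j + ?d r * P j) mod 2"
      proof (cases "even (?d r)")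
        case True
        then have "even (?d r * P j)" by simp
        then show ?thesis using M'[of r j] r j True by (metis add.right_neutral lessThan_iff mod_add_right_eq even_iff_mod_2_eq_zero)
      next
        case False
        then have "(?d r * P j) mod 2 = P j mod 2"
          by (metis mod_mult_left_eq mult_1 odd_iff_mod_2_eq_one)
        moreover have "M' r j = (M r j + P j) mod 2" using M'[of r j] r j False by simp
        ultimately show ?thesis by (metis mod_add_right_eq mod_mod_trivial)
      qed
      have "(y r * M' r j) mod 2 = (y r * (M r j + ?d r * P j)) mod 2"
        using * by (metis mod_mult_right_eq)
      then show "(y r * M' r j) mod 2 = (y r * M r j + y r * ?d r * P j) mod 2"
        by (simp add: algebra_simps)
    qed
    also have "\<dots> = ((\<Sum>r<N. y r * M r j) + (\<Sum>r<N. y r * ?d r) * P j) mod 2"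
      by (simp add: sum.distrib sum_distrib_right)
    also have "\<dots> = (\<Sum>r<N. y r * M r j) mod 2"
    proof -
      have "even ((\<Sum>r<N. y r * ?d r) * P j)"
        using even by (simp only: even_iff_mod_2_eq_zero[symmetric] even_mult_iff simp_thms)
      then show ?thesis by (rule evenE) (simp only: mod_mult_self2)
    qed
    finally show ?thesis using eq[OF j] by simp
  qed
  have "bits N (M' r)" if "r < N" for r
    unfolding bits_def
  proof (intro allI impI)
    fix j
    assume "j < N"
    then show "M' r j \<le> 1" using M'[OF that] b[OF that] by auto
  qed
  then show ?thesis unfolding spans_null_def using sound gen by blast
qed

lemma spans_null_identity:
  assumes "\<And>r j. r < N \<Longrightarrow> j < N \<Longrightarrow> M r j = (if r = j then 1 else 0)"
  shows "spans_null N {} M"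
proof -
  have "(\<Sum>r<N. y r * M r j) mod 2 = y j" if "bits N y" "j < N" for y j
  proof -
    have "(\<Sum>r<N. y r * M r j) = (\<Sum>r<N. if r = j then y r else 0)"
      using assms that by (intro sum.cong) auto
    also have "\<dots> = y j" using that by simp
    finally show ?thesis using that by (auto simp: bits_def)
  qed
  then show ?thesis using assms by (auto simp: spans_null_def bits_def)
qed

lemma spans_null_cong:
  assumes "spans_null N Us M" "\<And>r j. r < N \<Longrightarrow> j < N \<Longrightarrow> M' r j = M r j"
  shows "spans_null N Us M'"
  using assms unfolding spans_null_def bits_def dot_def by simp

text \<open>Since \<open>y\<close> is a combination of the rows, a column that vanishes in all rows
  vanishes in \<open>y\<close>. For the last column this decides by inspection of the rows whether a
  consistent parity exists.\<close>

lemma spans_null_row: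
  assumes "spans_null N Us M" "bits N y" "\<And>u. u \<in> Us \<Longrightarrow> even (dot N u y)" "j < N" "y j = 1"
  shows "\<exists>r<N. M r j = 1"
proof (rule ccontr)
  assume "\<not> ?thesis"
  then have "M r j = 0" if "r < N" for r
    using assms(1,4) that unfolding spans_null_def bits_def by (metis One_nat_def le_Suc_eq le_zero_eq)
  then have "(\<Sum>r<N. y r * M r j) = 0" by (intro sum.neutral) auto
  moreover have "(\<Sum>r<N. y r * M r j) mod 2 = y j"
    using assms unfolding spans_null_def by blast
  ultimately have "y j = 0" by (metis mod_0)
  then show False using assms(5) by simp
qed

section \<open>Elimination as a program\<close>

definition matrix_of :: "nat \<Rightarrow> (nat \<Rightarrow> nat) \<Rightarrow> nat \<Rightarrow> nat \<Rightarrow> nat" where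
  "matrix_of N A r j = A (r * N + j)"

lemma index_eq:
  assumes "j < (N :: nat)" "j' < N"
  shows "r * N + j = r' * N + j' \<longleftrightarrow> r = r' \<and> j = j'"
proof
  assume *: "r * N + j = r' * N + j'"
  have "(r * N + j) div N = r" "(r' * N + j') div N = r'" using assms by auto
  with * show "r = r' \<and> j = j'" by auto
qed auto

lemma index_less: "r < N \<Longrightarrow> j < N \<Longrightarrow> r * N + j < N * (N :: nat)"
  using mult_le_mono1[of "Suc r" N N] by simp

lemma matrix_of_update:
  "j < N \<Longrightarrow> j' < N \<Longrightarrow> matrix_of N (A(r * N + j := x)) r' j' = (if r' = r \<and> j' = j then x else matrix_of N A r' j')"
  using index_eq[of j N j' r r'] by (auto simp: matrix_of_def)

text \<open>At least one of the truncated differences is 0. Addition modulo 2 is thus expressed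
  without a quotient.\<close>

lemma xor_bits: "x \<le> 1 \<Longrightarrow> y \<le> 1 \<Longrightarrow> (x - y) + (y - x) = (x + y) mod (2 :: nat)"
  by (cases x; cases y) auto

text \<open>Cell 0 of array 22 holds the dimension, and that of array 15 the number of the current row.\<close>

abbreviation entry :: "nat \<Rightarrow> expr" where
  "entry aM \<equiv> Read aM (Plus (Times (V 15) (V 22)) (V 16))"

definition dot_prog :: "nat \<Rightarrow> nat \<Rightarrow> com" where
  "dot_prog av aM = For 16 22 (Set 17 (Plus (V 17) (Times (Read av (V 16)) (entry aM))))"

text \<open>The pivot is saved in array 19 because adding it to itself erases it from the
  matrix.\<close>

definition copy_row :: "nat \<Rightarrow> com" where
  "copy_row aM = For 16 22 (Assign 19 (V 16) (entry aM))"

definition add_row :: "nat \<Rightarrow> com" where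
  "add_row aM = For 16 22 (Assign aM (Plus (Times (V 15) (V 22)) (V 16))
     (Plus (Minus (entry aM) (Read 19 (V 16))) (Minus (Read 19 (V 16)) (entry aM))))"

text \<open>The guard is the remainder of the inner product modulo 2. The first odd row becomes the
  pivot; the rows before it are even and stay as they are, so a single pass suffices.\<close>

definition row_prog :: "nat \<Rightarrow> nat \<Rightarrow> com" where
  "row_prog av aM = Seq (Set 17 (Num 0)) (Seq (dot_prog av aM)
     (If (Minus (V 17) (Times (Num 2) (Quot (V 17) (Num 2))))
       (Seq (If (V 18) Skip (Seq (Set 18 (Num 1)) (copy_row aM))) (add_row aM))
       Skip))"

definition elim_prog :: "nat \<Rightarrow> nat \<Rightarrow> com" where
  "elim_prog av aM = Seq (Set 18 (Num 0)) (For 15 22 (row_prog av aM))"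

lemma mods_elim_prog [simp]:
  "mods (dot_prog av aM) = {16, 17}" "mods (copy_row aM) = {16, 19}" "mods (add_row aM) = {16, aM}"
  "mods (row_prog av aM) = {16, 17, 18, 19, aM}"
  "mods (elim_prog av aM) = {15, 16, 17, 18, 19, aM}"
  by (auto simp: dot_prog_def copy_row_def add_row_def row_prog_def elim_prog_def)

text \<open>The bounds on \<open>av\<close> and \<open>aM\<close> separate them from the work arrays
  15 to 19 and from array 22; the bound on \<open>B\<close> covers all matrix addresses, counters
  and inner products.\<close>

context
  fixes av aM N B :: nat and ex :: "nat list spmf"
  assumes av: "av < 15" and aM: "aM < 15" and ne: "av \<noteq> aM" and B: "N * N + N + 4 \<le> B"
begin

lemma neqs: "av \<noteq> 15" "av \<noteq> 16" "av \<noteq> 17" "av \<noteq> 18" "av \<noteq> 19" "av \<noteq> 22"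
  "aM \<noteq> 15" "aM \<noteq> 16" "aM \<noteq> 17" "aM \<noteq> 18" "aM \<noteq> 19" "aM \<noteq> 22" "aM \<noteq> av"
  "15 \<noteq> aM" "16 \<noteq> aM" "17 \<noteq> aM" "18 \<noteq> aM" "19 \<noteq> aM" "22 \<noteq> aM"
  using av aM ne by auto

lemma index_bound: "r < N \<Longrightarrow> j < N \<Longrightarrow> r * N + j \<le> B \<and> r * N \<le> B \<and> r \<le> B \<and> j \<le> B \<and> N \<le> B"
  using index_less[of r N j] B by linarith

lemma wp_dot_prog:
  assumes m: "m 22 0 = N" "m 15 0 = r" "r < N" "m 17 0 = 0"
    and b: "bits N (m av)" "bits N (matrix_of N (m aM) r)"
  shows "wp ex B (dot_prog av aM) (N * 36 + 9) 0
     (\<lambda>_ m'. m' 17 0 = dot N (m av) (matrix_of N (m aM) r)) m"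
proof -
  define I :: "nat \<Rightarrow> memory \<Rightarrow> bool" where
    "I j m' \<longleftrightarrow> m' 17 0 = dot j (m av) (matrix_of N (m aM) r)" for j m'
  \<comment> \<open>24 generously bounds the size of the loop body, and 12 is the overhead of a
    round; numerals of this kind below arise in the same way.\<close>
  have "wp ex B (dot_prog av aM) (N * (24 + 12) + 9) 0 (\<lambda>_. I N) m"
    unfolding dot_prog_def
  proof (rule wp_For0)
    show "I 0 (m(16 := (m 16)(0 := 0)))" using m by (simp add: I_def dot_def)
  next
    fix j m'
    assume j: "j < N" and I: "I j m'" "m' 16 0 = j"
      and fr: "\<And>a. a \<notin> insert 16 (mods (Set 17 (Plus (V 17) (Times (Read av (V 16)) (entry aM))))) \<Longrightarrow> m' a = m a"
    have eq: "m' av = m av" "m' aM = m aM" "m' 15 = m 15" "m' 22 = m 22"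
      using fr neqs by auto
    have bit: "m av j \<le> 1" "m aM (r * N + j) \<le> 1"
      using b j by (auto simp: bits_def matrix_of_def)
    have "dot (Suc j) (m av) (matrix_of N (m aM) r) \<le> (\<Sum>i<Suc j. 1 * 1)"
      unfolding dot_def using b j by (intro sum_mono mult_mono) (auto simp: bits_def)
    then have le: "dot (Suc j) (m av) (matrix_of N (m aM) r) \<le> Suc j" by simp
    have S: "dot (Suc j) (m av) (matrix_of N (m aM) r) = dot j (m av) (matrix_of N (m aM) r) + m av j * m aM (r * N + j)"
      by (simp add: dot_def matrix_of_def)
    have bits2: "m av j * m aM (r * N + j) \<le> 1 * 1" using bit by (intro mult_mono) auto
    show "wp ex B (Set 17 (Plus (V 17) (Times (Read av (V 16)) (entry aM)))) 24 0
      (\<lambda>us m''. I (Suc j) (m''(16 := (m'' 16)(0 := Suc j)))) m'"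
      using le S bit bits2 index_bound[OF m(3) j] B j
      by (intro wp_time[OF wp_assign]) (auto simp: I[unfolded I_def] I_def m eq neqs)
  qed (use neqs B m in auto)
  then show ?thesis by (rule wp_mono) (auto simp: I_def)
qed

lemma wp_copy_row:
  assumes m: "m 22 0 = N" "m 15 0 = r" "r < N" and b: "bits N (matrix_of N (m aM) r)"
  shows "wp ex B (copy_row aM) (N * 36 + 9) 0 (\<lambda>_ m'. \<forall>j<N. m' 19 j = matrix_of N (m aM) r j) m"
proof -
  define I :: "nat \<Rightarrow> memory \<Rightarrow> bool" where
    "I j m' \<longleftrightarrow> (\<forall>j'<j. m' 19 j' = matrix_of N (m aM) r j')" for j m'
  have "wp ex B (copy_row aM) (N * (24 + 12) + 9) 0 (\<lambda>_. I N) m"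
    unfolding copy_row_def
  proof (rule wp_For0)
    show "I 0 (m(16 := (m 16)(0 := 0)))" by (simp add: I_def)
  next
    fix j m'
    assume j: "j < N" and I: "I j m'" "m' 16 0 = j"
      and fr: "\<And>a. a \<notin> insert 16 (mods (Assign 19 (V 16) (entry aM))) \<Longrightarrow> m' a = m a"
    have eq: "m' aM = m aM" "m' 15 = m 15" "m' 22 = m 22"
      using fr neqs by auto
    have bit: "m aM (r * N + j) \<le> 1"
      using b j by (auto simp: bits_def matrix_of_def)
    show "wp ex B (Assign 19 (V 16) (entry aM)) 24 0
      (\<lambda>us m''. I (Suc j) (m''(16 := (m'' 16)(0 := Suc j)))) m'"
      using bit index_bound[OF m(3) j] B j I
      by (intro wp_time[OF wp_assign]) (auto simp: I_def m eq neqs less_Suc_eq matrix_of_def)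
  qed (use neqs B m in auto)
  then show ?thesis by (rule wp_mono) (auto simp: I_def)
qed

lemma wp_add_row:
  assumes m: "m 22 0 = N" "m 15 0 = r" "r < N" and b: "\<forall>r<N. bits N (matrix_of N (m aM) r)" "bits N (m 19)"
  shows "wp ex B (add_row aM) (N * 52 + 9) 0 (\<lambda>_ m'. \<forall>r'<N. \<forall>j<N. matrix_of N (m' aM) r' j =
      (if r' = r then (matrix_of N (m aM) r j + m 19 j) mod 2 else matrix_of N (m aM) r' j)) m"
proof -
  define I :: "nat \<Rightarrow> memory \<Rightarrow> bool" where
    "I j m' \<longleftrightarrow> (\<forall>r'<N. \<forall>j'<N. matrix_of N (m' aM) r' j' =
      (if r' = r \<and> j' < j then (matrix_of N (m aM) r j' + m 19 j') mod 2 else matrix_of N (m aM) r' j'))" for j m'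
  let ?c = "Assign aM (Plus (Times (V 15) (V 22)) (V 16))
     (Plus (Minus (entry aM) (Read 19 (V 16))) (Minus (Read 19 (V 16)) (entry aM)))"
  have "wp ex B (add_row aM) (N * (40 + 12) + 9) 0 (\<lambda>_. I N) m"
    unfolding add_row_def
  proof (rule wp_For0)
    show "I 0 (m(16 := (m 16)(0 := 0)))" by (simp add: I_def neqs)
  next
    fix j m'
    assume j: "j < N" and I: "I j m'" "m' 16 0 = j"
      and fr: "\<And>a. a \<notin> insert 16 (mods ?c) \<Longrightarrow> m' a = m a"
    have eq: "m' 15 = m 15" "m' 22 = m 22" "m' 19 = m 19"
      using fr neqs by auto
    have x: "m' aM (r * N + j) = matrix_of N (m aM) r j"
      using I j m(3) by (auto simp: I_def matrix_of_def)
    have bit: "matrix_of N (m aM) r j \<le> 1" "m 19 j \<le> 1"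
      using b j m(3) by (auto simp: bits_def)
    show "wp ex B ?c 40 0 (\<lambda>us m''. I (Suc j) (m''(16 := (m'' 16)(0 := Suc j)))) m'"
    proof (intro wp_time[OF wp_assign])
      show "I (Suc j) ((m'(aM := (m' aM)(val m' (Plus (Times (V 15) (V 22)) (V 16)) :=
          val m' (Plus (Minus (entry aM) (Read 19 (V 16))) (Minus (Read 19 (V 16)) (entry aM))))))
          (16 := ((m'(aM := (m' aM)(val m' (Plus (Times (V 15) (V 22)) (V 16)) :=
          val m' (Plus (Minus (entry aM) (Read 19 (V 16))) (Minus (Read 19 (V 16)) (entry aM)))))) 16)
            (0 := Suc j)))"
        using I(1) j xor_bits[OF bit] unfolding I_def
        by (auto simp: m eq neqs I(2) x matrix_of_update less_Suc_eq)
    qed (use bit index_bound[OF m(3) j] B in \<open>auto simp: m eq neqs I(2) x\<close>)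
  qed (use neqs B m in auto)
  then show ?thesis by (rule wp_mono) (auto simp: I_def)
qed

lemma wp_elim_prog:
  assumes m: "m 22 0 = N" and b: "bits N (m av)" "\<forall>r<N. bits N (matrix_of N (m aM) r)"
  shows "wp ex B (elim_prog av aM) (N * (N * 200 + 100) + 20) 0
     (\<lambda>_ m'. eliminates N (m av) (matrix_of N (m aM)) (matrix_of N (m' aM))) m"
proof -
  let ?M = "matrix_of N (m aM)"
  let ?d = "\<lambda>r. dot N (m av) (?M r)"
  \<comment> \<open>While the flag is 0, all rows passed are even, so the first conjunct does not
    depend on array 19. This is why storing the pivot there preserves it.\<close>
  define I :: "nat \<Rightarrow> memory \<Rightarrow> bool" where
    "I r m' \<longleftrightarrow>
      (\<forall>r'<N. \<forall>j<N. matrix_of N (m' aM) r' j =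
         (if r' < r \<and> odd (?d r') then (?M r' j + m' 19 j) mod 2 else ?M r' j)) \<and>
      (if m' 18 0 = 0 then \<forall>r'<r. even (?d r')
       else m' 18 0 = 1 \<and> (\<exists>p<r. odd (?d p) \<and> (\<forall>j<N. m' 19 j = ?M p j)))" for r m'
  have "wp ex B (Set 18 (Num 0)) 3 0 (\<lambda>_ m'. m' = m(18 := (m 18)(0 := 0))) m"
    by (intro wp_time[OF wp_assign]) auto
  then have "wp ex B (elim_prog av aM) (3 + (N * ((N * 124 + 80) + 12) + 9)) (0 + 0) (\<lambda>_. I N) m"
    unfolding elim_prog_def
  proof (rule wp_seq)
    fix m0
    assume m0: "m0 = m(18 := (m 18)(0 := 0))"
    show "wp ex B (For 15 22 (row_prog av aM)) (N * ((N * 124 + 80) + 12) + 9) 0 (\<lambda>us. I N) m0"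
    proof (rule wp_For0)
      show "I 0 (m0(15 := (m0 15)(0 := 0)))" by (auto simp: I_def m0 neqs)
    next
      fix r m1
      assume r: "r < N" and I: "I r m1" "m1 15 0 = r"
        and fr: "\<And>a. a \<notin> insert 15 (mods (row_prog av aM)) \<Longrightarrow> m1 a = m0 a"
      have eq: "m1 av = m av" "m1 22 = m 22" using fr neqs by (auto simp: m0)
      have row: "matrix_of N (m1 aM) r' j = ?M r' j" if "r \<le> r'" "r' < N" "j < N" for r' j
        using I that by (auto simp: I_def)
      have bits1: "\<forall>r<N. bits N (matrix_of N (m1 aM) r)"
        using I(1) b(2) by (auto simp: I_def bits_def)
      have d: "dot N (m1 av) (matrix_of N (m1 aM) r) = ?d r"
        using row r eq by (auto simp: dot_def)
      define Q where "Q m' \<longleftrightarrow> I (Suc r) (m'(15 := (m' 15)(0 := Suc r)))" for m'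
      define T where "T = 1 + esize (Minus (V 17) (Times (Num 2) (Quot (V 17) (Num 2)))) +
        ((1 + esize (V 18) + (1 + (3 + (N * 36 + 9))) + (N * 52 + 9)) + 1)"
      have body: "wp ex B (If (Minus (V 17) (Times (Num 2) (Quot (V 17) (Num 2))))
           (Seq (If (V 18) Skip (Seq (Set 18 (Num 1)) (copy_row aM))) (add_row aM)) Skip) T 0 (\<lambda>_. Q) m2"
        if m2: "m2 17 0 = ?d r" and fr2: "\<And>a. a \<notin> {16,17} \<Longrightarrow> m2 a = m1 a" for m2
        unfolding T_def
      proof (rule wp_if)
        have "?d r \<le> (\<Sum>i<N. 1 * 1)"
          unfolding dot_def using b r by (intro sum_mono mult_mono) (auto simp: bits_def)
        then show "bounded_by B m2 (Minus (V 17) (Times (Num 2) (Quot (V 17) (Num 2))))"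
          using B by (auto simp: m2)
      next
        assume "val m2 (Minus (V 17) (Times (Num 2) (Quot (V 17) (Num 2)))) = 0"
        then have ev: "even (?d r)"
          by (simp add: m2 minus_mult_div_eq_mod even_iff_mod_2_eq_zero)
        show "wp ex B Skip 1 0 (\<lambda>_. Q) m2"
          using I(1) ev fr2 unfolding Q_def I_def
          by (intro wp_skip) (auto simp: neqs less_Suc_eq)
      next
        assume "val m2 (Minus (V 17) (Times (Num 2) (Quot (V 17) (Num 2)))) \<noteq> 0"
        then have od: "odd (?d r)"
          by (auto simp: m2 minus_mult_div_eq_mod even_iff_mod_2_eq_zero)
        have eq2: "m2 av = m av" "m2 22 = m 22" "m2 aM = m1 aM" "m2 15 0 = r" "m2 18 = m1 18" "m2 19 = m1 19"
          using fr2 neqs eq I(2) by auto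
        \<comment> \<open>The situation between the choice of the pivot and the addition: row
          \<open>r\<close> is still unchanged, but may itself be the pivot, hence
          \<open>p < Suc r\<close>.\<close>
        define Q1 where "Q1 m3 \<longleftrightarrow> m3 18 0 = 1 \<and> bits N (m3 19) \<and>
             (\<forall>r'<N. \<forall>j<N. matrix_of N (m1 aM) r' j =
               (if r' < r \<and> odd (?d r') then (?M r' j + m3 19 j) mod 2 else ?M r' j)) \<and>
             (\<exists>p<Suc r. odd (?d p) \<and> (\<forall>j<N. m3 19 j = ?M p j))" for m3 :: memory
        have "wp ex B (If (V 18) Skip (Seq (Set 18 (Num 1)) (copy_row aM)))
            (1 + esize (V 18) + (1 + (3 + (N * 36 + 9)))) 0 (\<lambda>_. Q1) m2"
        proof (rule wp_if)
          assume "val m2 (V 18) \<noteq> 0"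
          then have nz: "m1 18 0 \<noteq> 0" by (simp add: eq2)
          with I(1) obtain p where p: "m1 18 0 = 1" "p < r" "odd (?d p)" "\<forall>j<N. m1 19 j = ?M p j"
            unfolding I_def by auto
          have "bits N (m1 19)" using p b(2) r by (simp add: bits_def)
          moreover have "\<exists>p<Suc r. odd (?d p) \<and> (\<forall>j<N. m1 19 j = ?M p j)"
            using p less_SucI by blast
          moreover note I(1)[unfolded I_def, THEN conjunct1]
          ultimately have "Q1 m2"
            unfolding Q1_def eq2 using p(1) by - (rule conjI, assumption, rule conjI, assumption, rule conjI)
          then show "wp ex B Skip 1 0 (\<lambda>_. Q1) m2" by (intro wp_skip)
        next
          assume z: "val m2 (V 18) = 0"
          show "wp ex B (Seq (Set 18 (Num 1)) (copy_row aM)) (3 + (N * 36 + 9)) 0 (\<lambda>_. Q1) m2"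
          proof (rule wp_seq0, intro wp_time[OF wp_assign])
            let ?m3 = "m2(18 := (m2 18)(val m2 (Num 0) := val m2 (Num 1)))"
            have "wp ex B (copy_row aM) (N * 36 + 9) 0 (\<lambda>_ m'. \<forall>j<N. m' 19 j = matrix_of N (?m3 aM) r j) ?m3"
              using m r bits1 by (intro wp_copy_row) (auto simp: eq2 neqs)
            then have "wp ex B (copy_row aM) (N * 36 + 9) 0 (\<lambda>_. Q1) ?m3"
            proof (rule wp_mono)
              fix m4
              assume c: "\<forall>j<N. m4 19 j = matrix_of N (?m3 aM) r j"
                and fr4: "\<And>a. a \<notin> mods (copy_row aM) \<Longrightarrow> m4 a = ?m3 a"
              have "m4 18 0 = 1" using fr4[of 18] by simp
              moreover have *: "m4 19 j = ?M r j" if "j < N" for j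
                using c that row[of r j] r by (simp add: neqs eq2)
              moreover have "bits N (m4 19)"
                using * b(2) r by (simp add: bits_def)
              moreover have "matrix_of N (m1 aM) r' j =
               (if r' < r \<and> odd (?d r') then (?M r' j + m4 19 j) mod 2 else ?M r' j)"
                if "r' < N" "j < N" for r' j
                using I(1) z that by (auto simp: I_def eq2)
              ultimately show "Q1 m4" unfolding Q1_def using od by auto
            qed auto
            then show "(\<forall>a. a \<notin> mods (Set 18 (Num 1)) \<longrightarrow> ?m3 a = m2 a) \<longrightarrow>
              wp ex B (copy_row aM) (N * 36 + 9) 0 (\<lambda>_. Q1) ?m3" ..
          qed (use B in auto)
        next
          show "bounded_by B m2 (V 18)"
            using I(1) B by (auto simp: I_def eq2 split: if_splits)
        qed
        then have "wp ex B (Seq (If (V 18) Skip (Seq (Set 18 (Num 1)) (copy_row aM))) (add_row aM))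
            ((1 + esize (V 18) + (1 + (3 + (N * 36 + 9)))) + (N * 52 + 9)) (0 + 0) (\<lambda>_. Q) m2"
        proof (rule wp_seq)
          fix m3
          assume Q1: "Q1 m3"
            and fr3: "\<And>a. a \<notin> mods (If (V 18) Skip (Seq (Set 18 (Num 1)) (copy_row aM))) \<Longrightarrow> m3 a = m2 a"
          have eq3: "m3 22 0 = N" "m3 15 0 = r" "m3 aM = m1 aM"
            using fr3 eq2 m by (auto simp: neqs)
          have "wp ex B (add_row aM) (N * 52 + 9) 0 (\<lambda>_ m'. \<forall>r'<N. \<forall>j<N. matrix_of N (m' aM) r' j =
            (if r' = r then (matrix_of N (m3 aM) r j + m3 19 j) mod 2 else matrix_of N (m3 aM) r' j)) m3"
            using r Q1 bits1 by (intro wp_add_row) (auto simp: eq3 Q1_def)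
          then show "wp ex B (add_row aM) (N * 52 + 9) 0 (\<lambda>_. Q) m3"
          proof (rule wp_mono)
            fix m4
            assume c: "\<forall>r'<N. \<forall>j<N. matrix_of N (m4 aM) r' j =
              (if r' = r then (matrix_of N (m3 aM) r j + m3 19 j) mod 2 else matrix_of N (m3 aM) r' j)"
              and fr4: "\<And>a. a \<notin> mods (add_row aM) \<Longrightarrow> m4 a = m3 a"
            have "m4 18 = m3 18" "m4 19 = m3 19" using fr4 neqs by auto
            then show "Q m4"
              using c Q1 od row unfolding Q_def I_def Q1_def eq3
              by (auto simp: neqs less_Suc_eq)
          qed auto
        qed
        then show "wp ex B (Seq (If (V 18) Skip (Seq (Set 18 (Num 1)) (copy_row aM))) (add_row aM))
            ((1 + esize (V 18) + (1 + (3 + (N * 36 + 9)))) + (N * 52 + 9)) 0 (\<lambda>_. Q) m2"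
          by (simp only: add_0)
      qed
      have "wp ex B (row_prog av aM) (3 + ((N * 36 + 9) + T)) 0 (\<lambda>_. Q) m1"
        unfolding row_prog_def
      proof (rule wp_seq0, intro wp_time[OF wp_assign])
        let ?m3 = "m1(17 := (m1 17)(val m1 (Num 0) := val m1 (Num 0)))"
        have "wp ex B (dot_prog av aM) (N * 36 + 9) 0
           (\<lambda>_ m'. m' 17 0 = dot N (?m3 av) (matrix_of N (?m3 aM) r)) ?m3"
          using m r bits1 I(2) b(1) by (intro wp_dot_prog) (auto simp: eq neqs)
        then have "wp ex B (dot_prog av aM) (N * 36 + 9) 0
           (\<lambda>_ m2. m2 17 0 = ?d r \<and> (\<forall>a. a \<notin> {16, 17} \<longrightarrow> m2 a = m1 a)) ?m3"
          by (rule wp_mono) (use d in \<open>auto simp: neqs\<close>)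
        then have "wp ex B (Seq (dot_prog av aM) (If (Minus (V 17) (Times (Num 2) (Quot (V 17) (Num 2))))
           (Seq (If (V 18) Skip (Seq (Set 18 (Num 1)) (copy_row aM))) (add_row aM)) Skip))
           ((N * 36 + 9) + T) (0 + 0) (\<lambda>_. Q) ?m3"
          by (rule wp_seq) (use body in blast)
        then show "(\<forall>a. a \<notin> mods (Set 17 (Num 0)) \<longrightarrow> ?m3 a = m1 a) \<longrightarrow>
          wp ex B (Seq (dot_prog av aM) (If (Minus (V 17) (Times (Num 2) (Quot (V 17) (Num 2))))
           (Seq (If (V 18) Skip (Seq (Set 18 (Num 1)) (copy_row aM))) (add_row aM)) Skip))
           ((N * 36 + 9) + T) 0 (\<lambda>_. Q) ?m3" by simp
      qed (use B in auto)
      then show "wp ex B (row_prog av aM) (N * 124 + 80) 0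
          (\<lambda>us m'. I (Suc r) (m'(15 := (m' 15)(0 := Suc r)))) m1"
        unfolding Q_def by (rule wp_time) (simp add: T_def)
    qed (use neqs B m m0 in auto)
  qed
  then have "wp ex B (elim_prog av aM) (3 + (N * ((N * 124 + 80) + 12) + 9)) 0 (\<lambda>_. I N) m" by simp
  then show ?thesis
  proof (rule wp_mono)
    show "3 + (N * ((N * 124 + 80) + 12) + 9) \<le> N * (N * 200 + 100) + 20"
      by (simp add: algebra_simps)
    fix m'
    assume I: "I N m'"
    show "eliminates N (m av) ?M (matrix_of N (m' aM))"
      unfolding eliminates_def using I by (intro exI[of _ "m' 19"]) (auto simp: I_def split: if_splits)
  qed
qed

end

section \<open>Enumerating the subsets of a given size\<close>

text \<open>The combinatorial number system: among the \<open>r\<close>-subsets of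
  \<open>{..<Suc i}\<close>, the \<open>i choose r\<close> sets that avoid \<open>i\<close> come
  first.\<close>

fun unrank :: "nat \<Rightarrow> nat \<Rightarrow> nat \<Rightarrow> nat set" where
  "unrank 0 r s = {}"
| "unrank (Suc i) r s =
     (if s < i choose r then unrank i r s else insert i (unrank i (r - 1) (s - (i choose r))))"

lemma unrank_subset: "unrank i r s \<subseteq> {..<i}"
proof (induction i r s rule: unrank.induct)
  case (2 i r s)
  then show ?case by (auto simp: less_Suc_eq)
qed auto

lemma choose_Suc_pos: "0 < r \<Longrightarrow> Suc i choose r = (i choose r) + (i choose (r - 1))"
  by (cases r) auto

lemma card_unrank: "s < i choose r \<Longrightarrow> card (unrank i r s) = r"
proof (induction i r s rule: unrank.induct)
  case (1 r s)
  then show ?case by (cases r) auto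
next
  case (2 i r s)
  show ?case
  proof (cases "s < i choose r")
    case True
    then show ?thesis using 2 by simp
  next
    case False
    then have r: "0 < r" using 2(3) by (cases r) auto
    have "s - (i choose r) < i choose (r - 1)"
      using 2(3) False choose_Suc_pos[OF r, of i] by linarith
    then have "card (unrank i (r - 1) (s - (i choose r))) = r - 1"
      by (rule 2(2)[OF False])
    moreover have "finite (unrank i (r - 1) (s - (i choose r)))"
      by (rule finite_subset[OF unrank_subset]) simp
    moreover have "i \<notin> unrank i (r - 1) (s - (i choose r))"
      using unrank_subset by blast
    ultimately show ?thesis using False r by simp
  qed
qed

text \<open>The rank is built up by recursion: a set containing the largest element gets the rank of
  the rest, shifted by the number of sets without that element.\<close>

lemma unrank_surj: "S \<subseteq> {..<i} \<Longrightarrow> card S = r \<Longrightarrow> \<exists>s < i choose r. unrank i r s = S"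
proof (induction i arbitrary: S r)
  case 0
  then show ?case by auto
next
  case (Suc i)
  have fin: "finite S" using Suc.prems finite_subset by blast
  show ?case
  proof (cases "i \<in> S")
    case False
    then have "S \<subseteq> {..<i}" using Suc.prems by (auto simp: less_Suc_eq)
    then obtain s where s: "s < i choose r" "unrank i r s = S" using Suc by blast
    moreover have "i choose r \<le> Suc i choose r" by (cases r) auto
    ultimately show ?thesis by (intro exI[of _ s]) auto
  next
    case True
    then have r: "0 < r" using Suc.prems fin by (metis card_gt_0_iff empty_iff)
    have "S - {i} \<subseteq> {..<i}" using Suc.prems by (auto simp: less_Suc_eq)
    moreover have "card (S - {i}) = r - 1" using True Suc.prems by simp
    ultimately obtain s where s: "s < i choose (r - 1)" "unrank i (r - 1) s = S - {i}"
      using Suc.IH by blast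
    then show ?thesis using True choose_Suc_pos[OF r, of i]
      by (intro exI[of _ "s + (i choose r)"]) auto
  qed
qed

text \<open>With its counterpart below, this moves through Pascal's triangle by one product and one
  exact division, without a table of binomial coefficients.\<close>

lemma binomial_step_up: "(n choose j) * (n - j) div Suc j = n choose Suc j"
proof -
  have "(n choose j) * (n - j) = Suc j * (n choose Suc j)"
    by (metis binomial_absorb_comp binomial_absorption mult.commute)
  then show ?thesis by (simp only: nonzero_mult_div_cancel_left)
qed

lemma binomial_step_down: "(Suc b choose r) * (Suc b - r) div Suc b = b choose r"
proof -
  have "(Suc b choose r) * (Suc b - r) = Suc b * (b choose r)"
    by (metis binomial_absorb_comp diff_Suc_1 mult.commute)
  then show ?thesis by (simp only: nonzero_mult_div_cancel_left)
qed

lemma binomial_le_2_power: "n choose k \<le> 2 ^ n"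
proof (cases "k \<le> n")
  case True
  then have "n choose k \<le> (\<Sum>i\<le>n. n choose i)" by (intro member_le_sum) auto
  then show ?thesis by (simp add: choose_row_sum)
qed (simp add: binomial_eq_0)

section \<open>The learning program\<close>

text \<open>
  Arrays: 0 the dimension \<open>n\<close>; 1 the output; 2 the current example; 3 the null space of the
  examples; 4 a working copy of it; 5 a unit vector; 6 the weight \<open>k\<close>; 7 the number of blocks, the
  blocks being the residue classes modulo this number; 8 the number of \<open>k\<close>-sets of
  blocks; 9 the rank of the current set; 10, 11, 12 the rank, the range of ranks and the size that remain
  while unranking; 14 the indicator of the complement of the current set; 22 \<open>n + 1\<close>;
  23 the number of examples that depends on \<open>n\<close>; 24 the number of entries of a matrix.
  The elimination uses 17 for the inner product, 18 for the flag that a pivot row has been met and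
  19 for this row; the other arrays are counters and auxiliary variables.
\<close>

definition init_prog :: com where
  "init_prog = For 20 22 (Assign 3 (Plus (Times (V 20) (V 22)) (V 20)) (Num 1))"

definition binom_prog :: com where
  "binom_prog = Seq (Set 8 (Num 1))
     (For 20 6 (Set 8 (Quot (Times (V 8) (Minus (V 7) (V 20))) (Plus (V 20) (Num 1)))))"

text \<open>Halving array 21 counts the bits of \<open>T choose k\<close>; n + 1 rounds suffice
  since \<open>T choose k\<close> is at most 2^n.\<close>

definition count_prog :: com where
  "count_prog = Seq (Set 23 (Times (V 6) (Plus (Quot (V 0) (V 7)) (Num 1)))) (Seq (Set 21 (V 8))
     (For 20 22 (If (V 21)
       (Seq (Set 21 (Quot (V 21) (Num 2))) (Set 23 (Plus (V 23) (Num 1)))) Skip)))"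

definition sample_prog :: com where
  "sample_prog = Seq (Example 2) (elim_prog 2 3)"

text \<open>Blocks are decided from the largest down: 27 is the current block, and 26 is the number
  of remaining sets that avoid it, obtained by \<open>binomial_step_down\<close>.\<close>

definition unrank_prog :: com where
  "unrank_prog = Seq (Set 10 (V 9)) (Seq (Set 11 (V 8)) (Seq (Set 12 (V 6))
     (For 13 7
       (Seq (Set 27 (Minus (Minus (V 7) (Num 1)) (V 13)))
       (Seq (Set 26 (Quot (Times (V 11) (Minus (Plus (V 27) (Num 1)) (V 12))) (Plus (V 27) (Num 1))))
       (If (Minus (V 26) (V 10))
         (Seq (Set 11 (V 26)) (Assign 14 (V 27) (Num 1)))
         (Seq (Set 10 (Minus (V 10) (V 26))) (Seq (Set 11 (Minus (V 11) (V 26)))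
           (Seq (Set 12 (Minus (V 12) (Num 1))) (Assign 14 (V 27) (Num 0)))))))))))"

definition copy_prog :: com where
  "copy_prog = For 25 24 (Assign 4 (V 25) (Read 3 (V 25)))"

text \<open>The address in array 14 is the residue of the variable modulo the number of blocks. The
  unit vector is erased after use, so array 5 is zero again for the next variable.\<close>

definition restrict_prog :: com where
  "restrict_prog = For 25 0 (If (Read 14 (Minus (V 25) (Times (V 7) (Quot (V 25) (V 7)))))
     (Seq (Assign 5 (V 25) (Num 1)) (Seq (elim_prog 5 4) (Assign 5 (V 25) (Num 0)))) Skip)"

text \<open>A row with last entry 1 is a solution and overwrites earlier ones. It does not matter
  which survives: with high probability all consistent candidates equal the target.\<close>

definition output_prog :: com where
  "output_prog = For 20 22 (If (Read 4 (Plus (Times (V 20) (V 22)) (V 0)))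
     (For 25 0 (Assign 1 (V 25) (Read 4 (Plus (Times (V 20) (V 22)) (V 25))))) Skip)"

definition search_prog :: com where
  "search_prog = For 9 8 (Seq unrank_prog (Seq copy_prog (Seq restrict_prog output_prog)))"

lemma mods_progs [simp]:
  "mods init_prog = {3, 20}" "mods binom_prog = {8, 20}" "mods count_prog = {20, 21, 23}"
  "mods sample_prog = {2, 3, 15, 16, 17, 18, 19}"
  "mods unrank_prog = {10, 11, 12, 13, 14, 26, 27}" "mods copy_prog = {4, 25}"
  "mods restrict_prog = {4, 5, 15, 16, 17, 18, 19, 25}" "mods output_prog = {1, 20, 25}"
  by (auto simp: init_prog_def binom_prog_def count_prog_def sample_prog_def unrank_prog_def
      copy_prog_def restrict_prog_def output_prog_def)

section \<open>Correctness and cost of the subprograms\<close>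

lemma wp_assign_seq:
  assumes "wp ex B c T j Q (m(a := (m a)(val m e1 := val m e2)))" "bounded_by B m e1" "bounded_by B m e2"
  shows "wp ex B (Seq (Assign a e1 e2) c) ((1 + esize e1 + esize e2) + T) j Q m"
  by (rule wp_seq0, rule wp_assign) (use assms in auto)

lemma dot_cong: "(\<And>j. j < N \<Longrightarrow> u j = u' j) \<Longrightarrow> dot N u y = dot N u' y"
  by (simp add: dot_def)

lemma spans_null_insert_cong:
  assumes "spans_null N (insert u Us) M" "\<And>j. j < N \<Longrightarrow> u j = u' j"
  shows "spans_null N (insert u' Us) M"
  using assms(1) dot_cong[of N u u', OF assms(2)] unfolding spans_null_def by simp

text \<open>The first bound on \<open>B\<close> covers the matrix addresses, the second one the
  products formed before the exact divisions of binomial coefficients. The additional coordinate in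
  \<open>N\<close> is that of the label.\<close>

locale block_search =
  fixes n k T B N :: nat and ex :: "nat list spmf"
  assumes T: "1 \<le> T" "k \<le> T" "T \<le> n" and N: "N = Suc n"
    and B: "4 * ((n + 2) * (n + 2)) \<le> B" "(n + 2) * 2 ^ n \<le> B"
    and ex: "\<And>v. v \<in> set_spmf ex \<Longrightarrow> length v = N \<and> set v \<subseteq> {0, 1}"
begin

lemma B_index: "i \<le> N \<Longrightarrow> j \<le> N \<Longrightarrow> i * N + j \<le> B \<and> i * N \<le> B \<and> i * j < B"
proof -
  assume *: "i \<le> N" "j \<le> N"
  have "i * N \<le> N * N" "i * j \<le> N * N"
    using * by (auto intro: mult_le_mono)
  moreover have "4 * ((n + 2) * (n + 2)) = 4 * (N * N) + 8 * N + 4"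
    by (simp add: N algebra_simps)
  ultimately show ?thesis using B * by linarith
qed

lemma B_small: "i \<le> N + 2 \<Longrightarrow> i < B"
  using B N by (simp add: algebra_simps)

lemma B_elim: "N * N + N + 4 \<le> B"
  using B(1) N by (simp add: algebra_simps)

lemma binom_le: assumes "i \<le> n" shows "i choose r < B" "j \<le> n \<Longrightarrow> (i choose r) * j \<le> B"
proof -
  have "i choose r \<le> 2 ^ i" by (rule binomial_le_2_power)
  also have "\<dots> \<le> 2 ^ n" using assms by simp
  finally have *: "i choose r \<le> 2 ^ n" .
  have "(2::nat) ^ n < (n + 2) * 2 ^ n" by simp
  then show "i choose r < B" using * B by linarith
  assume "j \<le> n"
  then have "(i choose r) * j \<le> 2 ^ n * (n + 2)" using * by (intro mult_mono) auto
  then show "(i choose r) * j \<le> B" using B by (simp add: mult.commute)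
qed

definition elim_time :: nat where "elim_time = N * (N * 200 + 100) + 20"

lemma wp_init:
  assumes m: "m 22 0 = N" "m 3 = (\<lambda>_. 0)"
  shows "wp ex B init_prog (N * (20 + 12) + 9) 0
     (\<lambda>_ m'. spans_null N {} (matrix_of N (m' 3))) m"
proof -
  let ?c = "Assign 3 (Plus (Times (V 20) (V 22)) (V 20)) (Num 1)"
  define I :: "nat \<Rightarrow> memory \<Rightarrow> bool" where
    "I r m' \<longleftrightarrow> (\<forall>r'<N. \<forall>j<N. matrix_of N (m' 3) r' j = (if r' = j \<and> r' < r then 1 else 0))" for r m'
  have "wp ex B init_prog (N * (20 + 12) + 9) 0 (\<lambda>_. I N) m"
    unfolding init_prog_def
  proof (rule wp_For0)
    show "I 0 (m(20 := (m 20)(0 := 0)))" by (simp add: I_def m matrix_of_def)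
  next
    fix j m'
    assume j: "j < N" and I: "I j m'" "m' 20 0 = j"
      and fr: "\<And>a. a \<notin> insert 20 (mods ?c) \<Longrightarrow> m' a = m a"
    have eq: "m' 22 0 = N" using fr m by auto
    show "wp ex B ?c 20 0 (\<lambda>us m''. I (Suc j) (m''(20 := (m'' 20)(0 := Suc j)))) m'"
      using j I B_index[of j j] B_small[of N] B_small[of 1]
      by (intro wp_time[OF wp_assign]) (auto simp: I_def eq matrix_of_update less_Suc_eq)
  qed (use m B_small in auto)
  then show ?thesis
    by (rule wp_mono) (auto simp: I_def intro!: spans_null_identity)
qed

lemma wp_binom:
  assumes m: "m 6 0 = k" "m 7 0 = T"
  shows "wp ex B binom_prog (k * (20 + 12) + 20) 0 (\<lambda>_ m'. m' 8 0 = T choose k) m"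
proof -
  let ?c = "Set 8 (Quot (Times (V 8) (Minus (V 7) (V 20))) (Plus (V 20) (Num 1)))"
  define I :: "nat \<Rightarrow> memory \<Rightarrow> bool" where "I j m' \<longleftrightarrow> m' 8 0 = T choose j" for j m'
  define m0 where "m0 = m(8 := (m 8)(0 := 1))"
  have "wp ex B (For 20 6 ?c) (k * (20 + 12) + 9) 0 (\<lambda>_. I k) m0"
  proof (rule wp_For0)
    show "I 0 (m0(20 := (m0 20)(0 := 0)))" by (simp add: I_def m0_def)
  next
    fix j m'
    assume j: "j < k" and I: "I j m'" "m' 20 0 = j"
      and fr: "\<And>a. a \<notin> insert 20 (mods ?c) \<Longrightarrow> m' a = m0 a"
    have eq: "m' 7 0 = T" using fr m by (auto simp: m0_def)
    have T': "T < B" "Suc j < B" using T j B_small N by auto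
    show "wp ex B ?c 20 0 (\<lambda>us m''. I (Suc j) (m''(20 := (m'' 20)(0 := Suc j)))) m'"
      using j I binom_le(1)[OF T(3), of j] binom_le(2)[OF T(3), of "T - j" j] T' T
      by (intro wp_time[OF wp_assign]) (auto simp: I_def eq binomial_step_up)
  qed (use m T N B_small in \<open>auto simp: m0_def\<close>)
  then have "wp ex B binom_prog ((1 + esize (Num 0) + esize (Num 1)) + (k * (20 + 12) + 9)) 0 (\<lambda>_. I k) m"
    unfolding binom_prog_def by (intro wp_assign_seq) (use B_small[of 1] in \<open>auto simp: m0_def\<close>)
  then show ?thesis
    by (rule wp_mono) (auto simp: I_def)
qed

lemma wp_count:
  assumes m: "m 0 0 = n" "m 6 0 = k" "m 7 0 = T" "m 8 0 = T choose k" "m 22 0 = N"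
  shows "wp ex B count_prog (N * (40 + 12) + 40) 0
     (\<lambda>_ m'. m' 23 0 = k * (n div T + 1) + floorlog 2 (T choose k)) m"
proof -
  let ?w = "T choose k"
  let ?base = "k * (n div T + 1)"
  let ?c = "If (V 21) (Seq (Set 21 (Quot (V 21) (Num 2))) (Set 23 (Plus (V 23) (Num 1)))) Skip"
  \<comment> \<open>Each halving of a positive number removes one bit and adds one to array 23, so
    the sum of both is constant.\<close>
  define I :: "nat \<Rightarrow> memory \<Rightarrow> bool" where
    "I j m' \<longleftrightarrow> m' 21 0 = ?w div 2 ^ j \<and> m' 23 0 + floorlog 2 (m' 21 0) = ?base + floorlog 2 ?w" for j :: nat and m' :: memory
  define m0 where "m0 = m(23 := (m 23)(0 := ?base), 21 := (m 21)(0 := ?w))"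
  have w: "?w \<le> 2 ^ n"
    using binomial_le_2_power[of T k] power_increasing[OF T(3), of "2::nat"] by linarith
  have fl: "floorlog 2 ?w \<le> N"
    using w by (auto intro!: floorlog_leI simp: N intro: le_less_trans)
  have kT: "k * (n div T + 1) \<le> N * N"
  proof -
    have "n div T \<le> n" by simp
    then show ?thesis using T by (intro mult_mono) (auto simp: N)
  qed
  have c0: "?base + N \<le> B" using kT B(1) by (simp add: N algebra_simps)
  have wB: "?w < B" using binom_le(1)[OF T(3)] .
  have "wp ex B (For 20 22 ?c) (N * (40 + 12) + 9) 0 (\<lambda>_. I N) m0"
  proof (rule wp_For0)
    show "I 0 (m0(20 := (m0 20)(0 := 0)))" by (simp add: I_def m0_def)
  next
    fix j m'
    assume j: "j < N" and I: "I j m'" "m' 20 0 = j"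
      and fr: "\<And>a. a \<notin> insert 20 (mods ?c) \<Longrightarrow> m' a = m0 a"
    have le: "m' 21 0 \<le> ?w" using I by (simp add: I_def)
    have le2: "m' 23 0 \<le> ?base + N" using I fl by (simp add: I_def)
    have "wp ex B ?c (1 + esize (V 21) + (((1 + esize (Num 0) + esize (Quot (V 21) (Num 2))) + 8) + 1)) 0
      (\<lambda>us m''. I (Suc j) (m''(20 := (m'' 20)(0 := Suc j)))) m'"
    proof (rule wp_if)
      show "bounded_by B m' (V 21)" using le wB by simp
    next
      assume "val m' (V 21) = 0"
      then show "wp ex B Skip 1 0 (\<lambda>us m''. I (Suc j) (m''(20 := (m'' 20)(0 := Suc j)))) m'"
        using I by (intro wp_skip) (auto simp: I_def power_Suc2 div_mult2_eq simp del: power_Suc)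
    next
      assume "val m' (V 21) \<noteq> 0"
      then have pos: "0 < m' 21 0" by simp
      then have f: "floorlog 2 (m' 21 0) = floorlog 2 (m' 21 0 div 2) + 1"
        by (subst compute_floorlog) simp
      then have le3: "m' 23 0 + 1 \<le> ?base + N" using I fl by (simp add: I_def)
      have "Suc (m' 23 0) + floorlog 2 (m' 21 0 div 2) = ?base + floorlog 2 ?w"
        using I(1) f unfolding I_def by linarith
      moreover have "m' 21 0 div 2 = ?w div 2 ^ Suc j"
        using I by (simp add: I_def power_Suc2 div_mult2_eq del: power_Suc)
      ultimately show "wp ex B (Seq (Set 21 (Quot (V 21) (Num 2))) (Set 23 (Plus (V 23) (Num 1))))
        ((1 + esize (Num 0) + esize (Quot (V 21) (Num 2))) + 8) 0
        (\<lambda>us m''. I (Suc j) (m''(20 := (m'' 20)(0 := Suc j)))) m'"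
        using B_small[of 2] B_small[of 1] le wB le3 c0
        by (intro wp_assign_seq wp_time[OF wp_assign]) (auto simp: I_def)
    qed
    then show "wp ex B ?c 40 0 (\<lambda>us m''. I (Suc j) (m''(20 := (m'' 20)(0 := Suc j)))) m'"
      by (rule wp_time) simp
  qed (use m B_small in \<open>auto simp: m0_def\<close>)
  then have "wp ex B count_prog ((1 + esize (Num 0) + esize (Times (V 6) (Plus (Quot (V 0) (V 7)) (Num 1)))) +
     ((1 + esize (Num 0) + esize (V 8)) + (N * (40 + 12) + 9))) 0 (\<lambda>_. I N) m"
    unfolding count_prog_def
    apply (intro wp_assign_seq)
    using c0 wB T B_small[of n] B_small[of k] B_small[of T] B_small[of "Suc (n div T)"] div_le_dividend[of n T]
    by (auto simp: m0_def m N)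
  then show ?thesis
  proof (rule wp_mono)
    fix m'
    assume "I N m'"
    moreover have "?w div 2 ^ N = 0" using w by (simp add: N le_less_trans)
    moreover have "floorlog 2 0 = 0" by (simp add: floorlog_def)
    ultimately show "m' 23 0 = ?base + floorlog 2 ?w" by (auto simp: I_def)
  qed simp
qed

text \<open>A labelled example, read as a vector of length n + 1, is itself the new
  constraint.\<close>

lemma wp_sample:
  assumes m: "m 22 0 = N" "spans_null N Us (matrix_of N (m 3))"
  shows "wp ex B sample_prog (1 + N + elim_time) 1
     (\<lambda>us m'. spans_null N ((!) ` set us \<union> Us) (matrix_of N (m' 3))) m"
proof -
  have "wp ex B (Example 2) (1 + N) (Suc 0) (\<lambda>us m'. \<exists>v. us = [v] \<and> v \<in> set_spmf ex \<and> (\<forall>j<N. m' 2 j = v ! j)) m"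
    using ex by (intro wp_example) auto
  then have "wp ex B sample_prog ((1 + N) + elim_time) (Suc 0 + 0)
     (\<lambda>us m'. spans_null N ((!) ` set us \<union> Us) (matrix_of N (m' 3))) m"
    unfolding sample_prog_def
  proof (rule wp_seq)
    fix us and m' :: memory
    assume "\<exists>v. us = [v] \<and> v \<in> set_spmf ex \<and> (\<forall>j<N. m' 2 j = v ! j)"
    then obtain v where v: "us = [v]" "v \<in> set_spmf ex" "\<forall>j<N. m' 2 j = v ! j" by blast
    assume fr: "\<And>a. a \<notin> mods (Example 2) \<Longrightarrow> m' a = m a"
    have eq: "m' 22 0 = N" "m' 3 = m 3" using fr m by auto
    have "bits N (m' 2)"
      using v(3) ex[OF v(2)] by (fastforce simp: bits_def dest: nth_mem)
    then have "wp ex B (elim_prog 2 3) elim_time 0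
      (\<lambda>_ m''. eliminates N (m' 2) (matrix_of N (m' 3)) (matrix_of N (m'' 3))) m'"
      unfolding elim_time_def using m B_elim
      by (intro wp_elim_prog) (auto simp: eq spans_null_def)
    then show "wp ex B (elim_prog 2 3) elim_time 0
      (\<lambda>usa m'. spans_null N ((!) ` set (us @ usa) \<union> Us) (matrix_of N (m' 3))) m'"
    proof (rule wp_mono)
      fix vs m''
      assume vs: "vs \<in> set_spmf (draws ex 0)"
        and "eliminates N (m' 2) (matrix_of N (m' 3)) (matrix_of N (m'' 3))"
      then have "spans_null N (insert (m' 2) Us) (matrix_of N (m'' 3))"
        using m(2) spans_null_eliminates eq by metis
      then have "spans_null N (insert ((!) v) Us) (matrix_of N (m'' 3))"
        by (rule spans_null_insert_cong) (use v in auto)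
      then show "spans_null N ((!) ` set (us @ vs) \<union> Us) (matrix_of N (m'' 3))"
        using v vs by simp
    qed auto
  qed
  then show ?thesis by simp
qed

lemma wp_sampling:
  assumes m: "m 22 0 = N" "m 23 0 = c" "c < B" "spans_null N {} (matrix_of N (m 3))"
  shows "wp ex B (Seq (For 20 23 sample_prog) (repeat L sample_prog))
     ((c * ((1 + N + elim_time) + 12) + 9) + (L * (1 + N + elim_time) + 1)) (c + L)
     (\<lambda>us m'. spans_null N ((!) ` set us) (matrix_of N (m' 3))) m"
proof -
  define I :: "nat list list \<Rightarrow> memory \<Rightarrow> bool" where
    "I vs m' \<longleftrightarrow> spans_null N ((!) ` set vs) (matrix_of N (m' 3))" for vs m'
  \<comment> \<open>The free \<open>f\<close> serves both uses of the sampling step: in the loop it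
    advances the counter, in the unrolled copies it is \<open>\<lambda>m. m 20\<close> and changes
    nothing.\<close>
  have step: "wp ex B sample_prog (1 + N + elim_time) 1 (\<lambda>us m''. I (vs @ us) (m''(20 := f m''))) m'"
    if "I vs m'" "m' 22 0 = N" for vs m' f
    using wp_sample[OF that(2) that(1)[unfolded I_def]]
    by (rule wp_mono) (auto simp: I_def image_Un Un_commute)
  have "wp ex B (For 20 23 sample_prog) (c * ((1 + N + elim_time) + 12) + 9) (1 * c) ((\<lambda>_. I) c) m"
  proof (rule wp_For)
    show "I [] (m(20 := (m 20)(0 := 0)))" using m by (simp add: I_def)
    show "wp ex B sample_prog (1 + N + elim_time) 1 (\<lambda>us m'. I (vs @ us) (m'(20 := (m' 20)(0 := Suc j)))) m'"
      if "I vs m'" "\<And>a. a \<notin> insert 20 (mods sample_prog) \<Longrightarrow> m' a = m a" for j vs m'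
      using that m by (intro step) auto
  qed (use m in auto)
  then have "wp ex B (Seq (For 20 23 sample_prog) (repeat L sample_prog))
     ((c * ((1 + N + elim_time) + 12) + 9) + (L * (1 + N + elim_time) + 1)) (1 * c + 1 * L) I m"
  proof (rule wp_seq)
    fix vs m'
    assume I: "I vs m'" and fr: "\<And>a. a \<notin> mods (For 20 23 sample_prog) \<Longrightarrow> m' a = m a"
    show "wp ex B (repeat L sample_prog) (L * (1 + N + elim_time) + 1) (1 * L) (\<lambda>us. I (vs @ us)) m'"
    proof (rule wp_repeat[where I = I])
      show "wp ex B sample_prog (1 + N + elim_time) 1 (\<lambda>us. I (ws @ us)) m''"
        if "I ws m''" "\<And>a. a \<notin> mods sample_prog \<Longrightarrow> m'' a = m' a" for ws m''
        using step[of ws m'' "\<lambda>m. m 20"] that fr m by simp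
    qed (use I in auto)
  qed
  then show ?thesis unfolding I_def by simp
qed

lemma wp_unrank:
  assumes m: "m 6 0 = k" "m 7 0 = T" "m 8 0 = T choose k" "m 9 0 = s" "s < T choose k"
  shows "wp ex B unrank_prog (T * (100 + 12) + 30) 0
     (\<lambda>_ m'. \<forall>b<T. m' 14 b = (if b \<in> unrank T k s then 0 else 1)) m"
proof -
  let ?S = "unrank T k s"
  let ?A = "Seq (Set 11 (V 26)) (Assign 14 (V 27) (Num 1))"
  let ?A' = "Seq (Set 10 (Minus (V 10) (V 26))) (Seq (Set 11 (Minus (V 11) (V 26)))
           (Seq (Set 12 (Minus (V 12) (Num 1))) (Assign 14 (V 27) (Num 0))))"
  let ?e = "Quot (Times (V 11) (Minus (Plus (V 27) (Num 1)) (V 12))) (Plus (V 27) (Num 1))"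
  let ?f = "Minus (Minus (V 7) (Num 1)) (V 13)"
  let ?c = "Seq (Set 27 ?f) (Seq (Set 26 ?e) (If (Minus (V 26) (V 10)) ?A ?A'))"
  \<comment> \<open>After \<open>j\<close> rounds the top \<open>j\<close> blocks are decided. The
    rest of the set is again an unranked set, whose size and rank are in arrays 12 and 10.\<close>
  define I :: "nat \<Rightarrow> memory \<Rightarrow> bool" where
    "I j m' \<longleftrightarrow> m' 11 0 = (T - j) choose (m' 12 0) \<and> m' 10 0 < (T - j) choose (m' 12 0) \<and>
       (\<forall>b<T. T - j \<le> b \<longrightarrow> m' 14 b = (if b \<in> ?S then 0 else 1)) \<and>
       ?S \<inter> {..<T - j} = unrank (T - j) (m' 12 0) (m' 10 0)" for j m'
  define m0 where "m0 = m(10 := (m 10)(0 := s), 11 := (m 11)(0 := T choose k), 12 := (m 12)(0 := k))"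
  have TB: "T < B" "k < B" using T B_small N by auto
  have "wp ex B (For 13 7 ?c) (T * (100 + 12) + 9) 0 (\<lambda>_. I T) m0"
  proof (rule wp_For0)
    show "I 0 (m0(13 := (m0 13)(0 := 0)))"
      using m unrank_subset[of T k s] by (auto simp: I_def m0_def)
  next
    fix j m'
    assume j: "j < T" and I: "I j m'" "m' 13 0 = j"
      and fr: "\<And>a. a \<notin> insert 13 (mods ?c) \<Longrightarrow> m' a = m0 a"
    \<comment> \<open>The block decided in this round.\<close>
    define b where "b = T - 1 - j"
    define r where "r = m' 12 0"
    define q where "q = m' 10 0"
    have bT: "T - j = Suc b" "b < T" "T - Suc j = b" using j by (auto simp: b_def)
    have r: "m' 12 0 = r" "m' 10 0 = q" "m' 11 0 = Suc b choose r" "q < Suc b choose r"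
      using I bT by (auto simp: I_def r_def q_def)
    have S14: "m' 14 b' = (if b' \<in> ?S then 0 else 1)" if "b' < T" "b < b'" for b'
      using I that bT by (auto simp: I_def)
    have Sb: "?S \<inter> {..<Suc b} = unrank (Suc b) r q"
      using I bT by (simp add: I_def r)
    have eq: "m' 7 0 = T" using fr m by (auto simp: m0_def)
    \<comment> \<open>Otherwise the binomial coefficient above \<open>q\<close> would be 0.\<close>
    have rb: "r \<le> Suc b" using r(4) by (metis binomial_eq_0 not_less0 not_le)
    have sb: "Suc b \<le> n" using bT T by linarith
    have le: "Suc b choose r < B" "(Suc b choose r) * (Suc b - r) \<le> B"
      using binom_le(1)[OF sb] binom_le(2)[OF sb, of "Suc b - r"] sb by simp_all
    have e: "(Suc b choose r) * (Suc b - r) div Suc b = b choose r" by (rule binomial_step_down)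
    have eB: "b choose r < B" using bT T by (intro binom_le) auto
    have small: "Suc b < B" "r < B" "q < B" "j < B" using bT T N B_small[of "Suc b"] rb le r(4) j TB by auto
    define m2 where "m2 = m'(27 := (m' 27)(0 := b), 26 := (m' 26)(0 := b choose r))"
    have m2: "m2 26 0 = b choose r" "m2 27 0 = b" "m2 10 0 = q" "m2 11 0 = Suc b choose r" "m2 12 0 = r"
      "m2 14 = m' 14"
      by (auto simp: m2_def r)
    have "wp ex B (If (Minus (V 26) (V 10)) ?A ?A') (1 + esize (Minus (V 26) (V 10)) + (20 + 40)) 0
       (\<lambda>us m''. I (Suc j) (m''(13 := (m'' 13)(0 := Suc j)))) m2"
    proof (rule wp_if)
      show "bounded_by B m2 (Minus (V 26) (V 10))" using eB small by (auto simp: m2)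
    next
      assume "val m2 (Minus (V 26) (V 10)) \<noteq> 0"
      then have q: "q < b choose r" by (simp add: m2)
      then have "?S \<inter> {..<Suc b} = unrank b r q" using Sb by simp
      moreover from this have "b \<notin> ?S" using unrank_subset[of b r q] by auto
      ultimately have S: "?S \<inter> {..<b} = unrank b r q" "b \<notin> ?S"
        by (auto simp: lessThan_Suc)
      show "wp ex B ?A 20 0 (\<lambda>us m''. I (Suc j) (m''(13 := (m'' 13)(0 := Suc j)))) m2"
        using q S S14 eB small
        by (intro wp_time[OF wp_assign_seq[OF wp_assign]])
          (auto simp: I_def bT m2 le_less)
    next
      assume "val m2 (Minus (V 26) (V 10)) = 0"
      then have q: "\<not> q < b choose r" by (simp add: m2)
      then have r0: "0 < r" using r(4) by (cases r) auto
      have S: "?S \<inter> {..<Suc b} = insert b (unrank b (r - 1) (q - (b choose r)))"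
        using Sb q by simp
      moreover have "b \<notin> unrank b (r - 1) (q - (b choose r))"
        using unrank_subset by blast
      ultimately have S: "?S \<inter> {..<b} = unrank b (r - 1) (q - (b choose r))" "b \<in> ?S"
        by (auto simp: lessThan_Suc)
      have c: "(Suc b choose r) - (b choose r) = b choose (r - 1)"
        using choose_Suc_pos[OF r0, of b] by simp
      then have "q - (b choose r) < b choose (r - 1)" using q r(4) by linarith
      then show "wp ex B ?A' 40 0 (\<lambda>us m''. I (Suc j) (m''(13 := (m'' 13)(0 := Suc j)))) m2"
        using S S14 eB small le c
        by (intro wp_time[OF wp_assign_seq[OF wp_assign_seq[OF wp_assign_seq[OF wp_assign]]]])
          (auto simp: I_def bT m2 le_less)
    qed
    then have "wp ex B ?c ((1 + esize (Num 0) + esize ?f) + ((1 + esize (Num 0) + esize ?e) +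
        (1 + esize (Minus (V 26) (V 10)) + (20 + 40)))) 0
      (\<lambda>us m''. I (Suc j) (m''(13 := (m'' 13)(0 := Suc j)))) m'"
      apply (intro wp_assign_seq)
      using small le TB e b_def
      by (auto simp: m2_def I(2) eq r)
    then show "wp ex B ?c 100 0 (\<lambda>us m''. I (Suc j) (m''(13 := (m'' 13)(0 := Suc j)))) m'"
      by (rule wp_time) simp
  qed (use m TB in \<open>auto simp: m0_def\<close>)
  then have "wp ex B unrank_prog ((1 + esize (Num 0) + esize (V 9)) + ((1 + esize (Num 0) + esize (V 8)) +
      ((1 + esize (Num 0) + esize (V 6)) + (T * (100 + 12) + 9)))) 0 (\<lambda>_. I T) m"
    unfolding unrank_prog_def
    apply (intro wp_assign_seq)
    using m TB binom_le(1)[OF T(3), of k]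
    by (auto simp: m0_def)
  then show ?thesis by (rule wp_mono) (auto simp: I_def)
qed

lemma wp_copy:
  assumes m: "m 24 0 = N * N" "\<forall>r<N. bits N (matrix_of N (m 3) r)"
  shows "wp ex B copy_prog (N * N * (20 + 12) + 9) 0
     (\<lambda>_ m'. \<forall>r<N. \<forall>j<N. matrix_of N (m' 4) r j = matrix_of N (m 3) r j) m"
proof -
  let ?c = "Assign 4 (V 25) (Read 3 (V 25))"
  define I :: "nat \<Rightarrow> memory \<Rightarrow> bool" where "I j m' \<longleftrightarrow> (\<forall>i<j. m' 4 i = m 3 i)" for j m'
  have bit: "m 3 i \<le> 1" if "i < N * N" for i
  proof -
    have "i div N < N" "i mod N < N" using that N by (auto simp: less_mult_imp_div_less)
    then have "matrix_of N (m 3) (i div N) (i mod N) \<le> 1" using m(2) by (auto simp: bits_def)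
    then show ?thesis by (simp add: matrix_of_def)
  qed
  have NN: "N * N < B" using B_elim by linarith
  have "wp ex B copy_prog (N * N * (20 + 12) + 9) 0 (\<lambda>_. I (N * N)) m"
    unfolding copy_prog_def
  proof (rule wp_For0)
    show "I 0 (m(25 := (m 25)(0 := 0)))" by (simp add: I_def)
  next
    fix j m'
    assume j: "j < N * N" and I: "I j m'" "m' 25 0 = j"
      and fr: "\<And>a. a \<notin> insert 25 (mods ?c) \<Longrightarrow> m' a = m a"
    have eq: "m' 3 = m 3" using fr by auto
    show "wp ex B ?c 20 0 (\<lambda>us m''. I (Suc j) (m''(25 := (m'' 25)(0 := Suc j)))) m'"
      using j I bit[OF j] NN
      by (intro wp_time[OF wp_assign]) (auto simp: I_def eq less_Suc_eq)
  qed (use m NN in auto)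
  then show ?thesis by (rule wp_mono) (auto simp: I_def matrix_of_def index_less)
qed

definition unit_vec :: "nat \<Rightarrow> nat \<Rightarrow> nat" where "unit_vec i = (\<lambda>_. 0)(i := 1)"

lemma wp_restrict:
  assumes m: "m 0 0 = n" "m 7 0 = T" "m 22 0 = N" "m 5 = (\<lambda>_. 0)"
    and S: "\<forall>b<T. m 14 b = (if b \<in> S then 0 else 1)"
    and M: "spans_null N Us (matrix_of N (m 4))"
  shows "wp ex B restrict_prog (n * ((elim_time + 60) + 12) + 9) 0
     (\<lambda>_ m'. m' 5 = (\<lambda>_. 0) \<and>
       spans_null N (unit_vec ` {i. i < n \<and> i mod T \<notin> S} \<union> Us) (matrix_of N (m' 4))) m"
proof -
  let ?e = "Read 14 (Minus (V 25) (Times (V 7) (Quot (V 25) (V 7))))"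
  let ?c = "Seq (Assign 5 (V 25) (Num 1)) (Seq (elim_prog 5 4) (Assign 5 (V 25) (Num 0)))"
  define I :: "nat \<Rightarrow> memory \<Rightarrow> bool" where
    "I j m' \<longleftrightarrow> m' 5 = (\<lambda>_. 0) \<and>
      spans_null N (unit_vec ` {i. i < j \<and> i mod T \<notin> S} \<union> Us) (matrix_of N (m' 4))" for j m'
  have nB: "n < B" using B_small N by auto
  have "wp ex B restrict_prog (n * ((elim_time + 60) + 12) + 9) 0 (\<lambda>_. I n) m"
    unfolding restrict_prog_def
  proof (rule wp_For0)
    show "I 0 (m(25 := (m 25)(0 := 0)))" using m M by (simp add: I_def)
  next
    fix j m'
    assume j: "j < n" and I: "I j m'" "m' 25 0 = j"
      and fr: "\<And>a. a \<notin> insert 25 (mods (If ?e ?c Skip)) \<Longrightarrow> m' a = m a"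
    have eq: "m' 7 0 = T" "m' 22 0 = N" "m' 14 = m 14" using fr m by auto
    have md: "j mod T < T" using T by simp
    have v: "val m' ?e = (if j mod T \<in> S then 0 else 1)"
      using S md by (simp add: eq I(2) minus_mult_div_eq_mod)
    have "wp ex B (If ?e ?c Skip) (1 + esize ?e + ((5 + (elim_time + 5)) + 1)) 0
       (\<lambda>us m''. I (Suc j) (m''(25 := (m'' 25)(0 := Suc j)))) m'"
    proof (rule wp_if)
      have "T * (j div T) \<le> B"
        by (rule order_trans[OF times_div_less_eq_dividend]) (use j nB in simp)
      moreover have "m' 14 (j mod T) \<le> 1" using S md by (simp add: eq)
      moreover have "1 < B" using B_small[of 1] by simp
      ultimately show "bounded_by B m' ?e"
        using j T nB by (auto simp: eq I(2) minus_mult_div_eq_mod)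
    next
      assume "val m' ?e = 0"
      then have "j mod T \<in> S" unfolding v by (simp split: if_splits)
      then have "{i. i < Suc j \<and> i mod T \<notin> S} = {i. i < j \<and> i mod T \<notin> S}"
        by (auto simp: less_Suc_eq)
      then show "wp ex B Skip 1 0 (\<lambda>us m''. I (Suc j) (m''(25 := (m'' 25)(0 := Suc j)))) m'"
        using I(1) by (intro wp_skip) (simp add: I_def)
    next
      assume "val m' ?e \<noteq> 0"
      then have "j mod T \<notin> S" unfolding v by (simp split: if_splits)
      then have S': "{i. i < Suc j \<and> i mod T \<notin> S} = insert j {i. i < j \<and> i mod T \<notin> S}"
        by (auto simp: less_Suc_eq)
      define Us' where "Us' = unit_vec ` {i. i < j \<and> i mod T \<notin> S} \<union> Us"
      have M': "spans_null N Us' (matrix_of N (m' 4))" and z: "m' 5 = (\<lambda>_. 0)"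
        using I(1) by (auto simp: I_def Us'_def)
      define m1 where "m1 = m'(5 := (m' 5)(j := 1))"
      have m1: "m1 22 0 = N" "m1 5 = unit_vec j" "m1 4 = m' 4" "m1 25 0 = j"
        by (auto simp: m1_def eq z unit_vec_def I(2))
      have "wp ex B (elim_prog 5 4) elim_time 0
         (\<lambda>_ m''. eliminates N (m1 5) (matrix_of N (m1 4)) (matrix_of N (m'' 4))) m1"
        unfolding elim_time_def using M' B_elim
        by (intro wp_elim_prog) (auto simp: m1 spans_null_def bits_def unit_vec_def)
      then have "wp ex B (Seq (elim_prog 5 4) (Assign 5 (V 25) (Num 0))) (elim_time + 5) (0 + 0)
         (\<lambda>us m''. I (Suc j) (m''(25 := (m'' 25)(0 := Suc j)))) m1"
      proof (rule wp_seq)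
        fix m2
        assume el: "eliminates N (m1 5) (matrix_of N (m1 4)) (matrix_of N (m2 4))"
          and fr2: "\<And>a. a \<notin> mods (elim_prog 5 4) \<Longrightarrow> m2 a = m1 a"
        have "spans_null N (insert (unit_vec j) Us') (matrix_of N (m2 4))"
          using spans_null_eliminates[OF M'] el by (simp add: m1)
        moreover have "unit_vec ` {i. i < Suc j \<and> i mod T \<notin> S} \<union> Us = insert (unit_vec j) Us'"
          by (simp add: S' Us'_def)
        moreover have "m2 5 = unit_vec j" "m2 25 0 = j" using fr2 by (auto simp: m1)
        \<comment> \<open>Clearing the entry restores the zero vector, which the invariant demands
          of array 5.\<close>
        moreover have "(unit_vec j)(j := 0) = (\<lambda>_. 0)" by (auto simp: unit_vec_def)
        ultimately show "wp ex B (Assign 5 (V 25) (Num 0)) 5 0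
           (\<lambda>us m''. I (Suc j) (m''(25 := (m'' 25)(0 := Suc j)))) m2"
          using nB j by (intro wp_time[OF wp_assign]) (simp_all add: I_def)
      qed
      then have "wp ex B ?c ((1 + esize (V 25) + esize (Num 1)) + (elim_time + 5)) 0
         (\<lambda>us m''. I (Suc j) (m''(25 := (m'' 25)(0 := Suc j)))) m'"
        using nB j B_small[of 1] by (intro wp_assign_seq) (simp_all add: m1_def I(2))
      then show "wp ex B ?c (5 + (elim_time + 5)) 0
         (\<lambda>us m''. I (Suc j) (m''(25 := (m'' 25)(0 := Suc j)))) m'"
        by (rule wp_time) simp
    qed
    then show "wp ex B (If ?e ?c Skip) (elim_time + 60) 0
       (\<lambda>us m''. I (Suc j) (m''(25 := (m'' 25)(0 := Suc j)))) m'"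
      by (rule wp_time) simp
  qed (use m nB in auto)
  then show ?thesis by (rule wp_mono) (auto simp: I_def)
qed

lemma wp_output:
  assumes m: "m 0 0 = n" "m 22 0 = N" "\<forall>r<N. bits N (matrix_of N (m 4) r)"
  shows "wp ex B output_prog (N * ((n * (20 + 12) + 30) + 12) + 9) 0
     (\<lambda>_ m'. (\<forall>r<N. matrix_of N (m 4) r n \<noteq> 1) \<and> m' 1 = m 1 \<or>
        (\<exists>r<N. matrix_of N (m 4) r n = 1 \<and> (\<forall>j<n. m' 1 j = matrix_of N (m 4) r j))) m"
proof -
  let ?W = "matrix_of N (m 4)"
  let ?e = "Read 4 (Plus (Times (V 20) (V 22)) (V 0))"
  let ?a = "Assign 1 (V 25) (Read 4 (Plus (Times (V 20) (V 22)) (V 25)))"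
  \<comment> \<open>Later rows overwrite earlier ones, so it is left open which row with last entry
    1 is stored.\<close>
  define I :: "nat \<Rightarrow> memory \<Rightarrow> bool" where
    "I r m' \<longleftrightarrow> (\<forall>r'<r. ?W r' n \<noteq> 1) \<and> m' 1 = m 1 \<or>
       (\<exists>r'<r. ?W r' n = 1 \<and> (\<forall>j<n. m' 1 j = ?W r' j))" for r m'
  have nB: "n < B" "N < B" "1 < B" using B_small N by auto
  have "wp ex B output_prog (N * ((n * (20 + 12) + 30) + 12) + 9) 0 (\<lambda>_. I N) m"
    unfolding output_prog_def
  proof (rule wp_For0)
    show "I 0 (m(20 := (m 20)(0 := 0)))" by (simp add: I_def)
  next
    fix r m1
    assume r: "r < N" and I: "I r m1" "m1 20 0 = r"
      and fr: "\<And>a. a \<notin> insert 20 (mods (If ?e (For 25 0 ?a) Skip)) \<Longrightarrow> m1 a = m a"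
    have eq: "m1 0 0 = n" "m1 22 0 = N" "m1 4 = m 4" using fr m by auto
    have bit: "m 4 (r * N + j) \<le> 1" if "j < N" for j
      using m(3) r that by (auto simp: bits_def matrix_of_def)
    have v: "val m1 ?e = ?W r n" by (simp add: eq I(2) matrix_of_def)
    have "wp ex B (If ?e (For 25 0 ?a) Skip) (1 + esize ?e + ((n * (20 + 12) + 9) + 1)) 0
       (\<lambda>us m'. I (Suc r) (m'(20 := (m' 20)(0 := Suc r)))) m1"
    proof (rule wp_if)
      show "bounded_by B m1 ?e"
        using bit[of n] B_index[of r n] r nB by (auto simp: eq I(2) N)
    next
      assume "val m1 ?e = 0"
      then have "?W r n \<noteq> 1" unfolding v by simp
      then show "wp ex B Skip 1 0 (\<lambda>us m'. I (Suc r) (m'(20 := (m' 20)(0 := Suc r)))) m1"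
        using I(1) by (intro wp_skip) (auto simp: I_def less_Suc_eq)
    next
      assume "val m1 ?e \<noteq> 0"
      then have W: "?W r n = 1" unfolding v using bit[of n] N by (simp add: matrix_of_def)
      define J :: "nat \<Rightarrow> memory \<Rightarrow> bool" where "J j m' \<longleftrightarrow> (\<forall>i<j. m' 1 i = ?W r i)" for j m'
      have "wp ex B (For 25 0 ?a) (n * (20 + 12) + 9) 0 (\<lambda>_. J n) m1"
      proof (rule wp_For0)
        show "J 0 (m1(25 := (m1 25)(0 := 0)))" by (simp add: J_def)
      next
        fix j m2
        assume j: "j < n" and J: "J j m2" "m2 25 0 = j"
          and fr2: "\<And>a. a \<notin> insert 25 (mods ?a) \<Longrightarrow> m2 a = m1 a"
        have eq2: "m2 22 0 = N" "m2 20 0 = r" "m2 4 = m 4" using fr2 eq I(2) by auto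
        show "wp ex B ?a 20 0 (\<lambda>us m'. J (Suc j) (m'(25 := (m' 25)(0 := Suc j)))) m2"
          using J bit[of j] B_index[of r j] r j nB
          by (intro wp_time[OF wp_assign]) (auto simp: J_def eq2 N less_Suc_eq matrix_of_def)
      qed (use eq nB in auto)
      then show "wp ex B (For 25 0 ?a) (n * (20 + 12) + 9) 0
         (\<lambda>us m'. I (Suc r) (m'(20 := (m' 20)(0 := Suc r)))) m1"
        by (rule wp_mono) (use W in \<open>auto simp: I_def J_def\<close>)
    qed
    then show "wp ex B (If ?e (For 25 0 ?a) Skip) (n * (20 + 12) + 30) 0
       (\<lambda>us m'. I (Suc r) (m'(20 := (m' 20)(0 := Suc r)))) m1"
      by (rule wp_time) simp
  qed (use m nB in auto)
  then show ?thesis by (rule wp_mono) (auto simp: I_def)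
qed

text \<open>With \<open>y n = 1\<close>, orthogonality to an example says that the parity given by
  the first \<open>n\<close> entries of \<open>y\<close> agrees with the label. The weight of
  \<open>y\<close> is not restricted.\<close>

definition solves :: "(nat \<Rightarrow> nat) set \<Rightarrow> nat set \<Rightarrow> (nat \<Rightarrow> nat) \<Rightarrow> bool" where
  "solves Us S y \<longleftrightarrow> bits N y \<and> y n = 1 \<and> (\<forall>u\<in>Us. even (dot N u y)) \<and>
     (\<forall>i<n. i mod T \<notin> S \<longrightarrow> y i = 0)"

text \<open>Any consistent candidate is accepted; that it is the target is a matter of probability,
  not of the program.\<close>

definition found :: "(nat \<Rightarrow> nat) set \<Rightarrow> (nat \<Rightarrow> nat) \<Rightarrow> bool" where
  "found Us z \<longleftrightarrow> (\<exists>S y. S \<subseteq> {..<T} \<and> card S = k \<and> solves Us S y \<and> (\<forall>i<n. z i = y i))"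

lemma dot_unit_vec: "i < N \<Longrightarrow> dot N (unit_vec i) y = y i"
proof -
  assume "i < N"
  have "dot N (unit_vec i) y = (\<Sum>j<N. if j = i then y j else 0)"
    unfolding dot_def unit_vec_def by (intro sum.cong) auto
  then show ?thesis using \<open>i < N\<close> by simp
qed

definition step_time :: nat where
  "step_time = (T * (100 + 12) + 30) + ((N * N * (20 + 12) + 9) +
     ((n * ((elim_time + 60) + 12) + 9) + (N * ((n * (20 + 12) + 30) + 12) + 9)))"

text \<open>The claim is conditional: without a consistent candidate nothing is said about the
  output. In the application the target itself provides one. Every set of \<open>k\<close> blocks is
  examined because \<open>unrank\<close> is onto.\<close>

lemma wp_search:
  assumes m: "m 0 0 = n" "m 6 0 = k" "m 7 0 = T" "m 8 0 = T choose k" "m 22 0 = N" "m 24 0 = N * N"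
      "m 5 = (\<lambda>_. 0)"
    and M: "spans_null N Us (matrix_of N (m 3))"
  shows "wp ex B search_prog ((T choose k) * (step_time + 12) + 9) 0
     (\<lambda>_ m'. \<forall>S y. S \<subseteq> {..<T} \<and> card S = k \<and> solves Us S y \<longrightarrow> found Us (m' 1)) m"
proof -
  let ?c = "Seq unrank_prog (Seq copy_prog (Seq restrict_prog output_prog))"
  define I :: "nat \<Rightarrow> memory \<Rightarrow> bool" where
    "I s m' \<longleftrightarrow> m' 5 = (\<lambda>_. 0) \<and> (\<forall>s'<s. \<forall>y. solves Us (unrank T k s') y \<longrightarrow> found Us (m' 1))" for s m'
  have "wp ex B search_prog ((T choose k) * (step_time + 12) + 9) 0 (\<lambda>_. I (T choose k)) m"
    unfolding search_prog_def
  proof (rule wp_For0)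
    show "I 0 (m(9 := (m 9)(0 := 0)))" using m by (simp add: I_def)
  next
    fix s m1
    assume s: "s < T choose k" and I: "I s m1" "m1 9 0 = s"
      and fr: "\<And>a. a \<notin> insert 9 (mods ?c) \<Longrightarrow> m1 a = m a"
    define S where "S = unrank T k s"
    have eq: "m1 0 0 = n" "m1 6 0 = k" "m1 7 0 = T" "m1 8 0 = T choose k" "m1 22 0 = N" "m1 24 0 = N * N" "m1 3 = m 3"
      using fr m by auto
    have bit3: "\<forall>r<N. bits N (matrix_of N (m 3) r)" using M by (simp add: spans_null_def)
    have "wp ex B unrank_prog (T * (100 + 12) + 30) 0
       (\<lambda>_ m'. \<forall>b<T. m' 14 b = (if b \<in> S then 0 else 1)) m1"
      unfolding S_def by (rule wp_unrank) (use s eq I(2) in auto)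
    then have "wp ex B ?c ((T * (100 + 12) + 30) + ((N * N * (20 + 12) + 9) +
      ((n * ((elim_time + 60) + 12) + 9) + (N * ((n * (20 + 12) + 30) + 12) + 9)))) (0 + 0)
       (\<lambda>us m''. I (Suc s) (m''(9 := (m'' 9)(0 := Suc s)))) m1"
    proof (rule wp_seq)
      fix m2
      assume X: "\<forall>b<T. m2 14 b = (if b \<in> S then 0 else 1)"
        and fr2: "\<And>a. a \<notin> mods unrank_prog \<Longrightarrow> m2 a = m1 a"
      have eq2: "m2 0 0 = n" "m2 7 0 = T" "m2 22 0 = N" "m2 24 0 = N * N" "m2 3 = m 3" "m2 5 = m1 5" "m2 1 = m1 1"
        using fr2 eq by auto
      have "wp ex B copy_prog (N * N * (20 + 12) + 9) 0
        (\<lambda>_ m'. \<forall>r<N. \<forall>j<N. matrix_of N (m' 4) r j = matrix_of N (m2 3) r j) m2"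
        by (rule wp_copy) (use eq2 bit3 in auto)
      then have "wp ex B (Seq copy_prog (Seq restrict_prog output_prog)) ((N * N * (20 + 12) + 9) +
          ((n * ((elim_time + 60) + 12) + 9) + (N * ((n * (20 + 12) + 30) + 12) + 9))) (0 + 0)
         (\<lambda>us m''. I (Suc s) (m''(9 := (m'' 9)(0 := Suc s)))) m2"
      proof (rule wp_seq)
        fix m3
        assume W: "\<forall>r<N. \<forall>j<N. matrix_of N (m3 4) r j = matrix_of N (m2 3) r j"
          and fr3: "\<And>a. a \<notin> mods copy_prog \<Longrightarrow> m3 a = m2 a"
        have eq3: "m3 0 0 = n" "m3 7 0 = T" "m3 22 0 = N" "m3 14 = m2 14" "m3 5 = (\<lambda>_. 0)" "m3 1 = m1 1"
          using fr3 eq2 I(1) by (auto simp: I_def)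
        have "spans_null N Us (matrix_of N (m3 4))"
          by (rule spans_null_cong[OF M]) (use W eq2 in auto)
        then have "wp ex B restrict_prog (n * ((elim_time + 60) + 12) + 9) 0
         (\<lambda>_ m'. m' 5 = (\<lambda>_. 0) \<and>
           spans_null N (unit_vec ` {i. i < n \<and> i mod T \<notin> S} \<union> Us) (matrix_of N (m' 4))) m3"
          using X by (intro wp_restrict) (auto simp: eq3)
        then have "wp ex B (Seq restrict_prog output_prog)
           ((n * ((elim_time + 60) + 12) + 9) + (N * ((n * (20 + 12) + 30) + 12) + 9)) (0 + 0)
           (\<lambda>us m''. I (Suc s) (m''(9 := (m'' 9)(0 := Suc s)))) m3"
        proof (rule wp_seq)
          fix m4
          assume m4: "m4 5 = (\<lambda>_. 0) \<and>
              spans_null N (unit_vec ` {i. i < n \<and> i mod T \<notin> S} \<union> Us) (matrix_of N (m4 4))"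
            and fr4: "\<And>a. a \<notin> mods restrict_prog \<Longrightarrow> m4 a = m3 a"
          let ?Us = "unit_vec ` {i. i < n \<and> i mod T \<notin> S} \<union> Us"
          let ?W = "matrix_of N (m4 4)"
          have eq4: "m4 0 0 = n" "m4 22 0 = N" "m4 1 = m1 1" using fr4 eq3 by auto
          have W4: "spans_null N ?Us ?W" using m4 ..
          then have "wp ex B output_prog (N * ((n * (20 + 12) + 30) + 12) + 9) 0
             (\<lambda>_ m'. (\<forall>r<N. ?W r n \<noteq> 1) \<and> m' 1 = m4 1 \<or>
              (\<exists>r<N. ?W r n = 1 \<and> (\<forall>j<n. m' 1 j = ?W r j))) m4"
            using eq4 by (intro wp_output) (auto simp: spans_null_def)
          then show "wp ex B output_prog (N * ((n * (20 + 12) + 30) + 12) + 9) 0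
             (\<lambda>us m''. I (Suc s) (m''(9 := (m'' 9)(0 := Suc s)))) m4"
          proof (rule wp_mono)
            fix m5
            assume out: "(\<forall>r<N. ?W r n \<noteq> 1) \<and> m5 1 = m4 1 \<or>
                (\<exists>r<N. ?W r n = 1 \<and> (\<forall>j<n. m5 1 j = ?W r j))"
              and fr5: "\<And>a. a \<notin> mods output_prog \<Longrightarrow> m5 a = m4 a"
            have m5: "m5 5 = (\<lambda>_. 0)" using fr5[of 5] m4 by simp
            from out show "I (Suc s) (m5(9 := (m5 9)(0 := Suc s)))"
            proof
              assume *: "(\<forall>r<N. ?W r n \<noteq> 1) \<and> m5 1 = m4 1"
              have "\<not> solves Us S y" for y
              proof
                assume y: "solves Us S y"
                \<comment> \<open>A solution would be in the span of the rows, so its last entry 1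
                  would show in one of them.\<close>
                have "\<exists>r<N. ?W r n = 1"
                proof (rule spans_null_row[OF W4, where y = y and j = n])
                  fix u
                  assume "u \<in> ?Us"
                  moreover have "dot N (unit_vec i) y = y i" if "i < n" for i
                    using that N by (intro dot_unit_vec) simp
                  ultimately show "even (dot N u y)"
                    using y unfolding solves_def by auto
                next
                  show "bits N y" "y n = 1" using y by (simp_all add: solves_def)
                qed (simp add: N)
                then show False using * by blast
              qed
              then show ?thesis
                using I(1) m5 * eq4(3) unfolding I_def S_def by (auto simp: less_Suc_eq)
            next
              assume "\<exists>r<N. ?W r n = 1 \<and> (\<forall>j<n. m5 1 j = ?W r j)"
              then obtain r where r: "r < N" "?W r n = 1" "\<forall>j<n. m5 1 j = ?W r j" by blast
              have b: "bits N (?W r)" and ev: "\<And>u. u \<in> ?Us \<Longrightarrow> even (dot N u (?W r))"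
                using W4 r(1) by (auto simp: spans_null_def)
              have "?W r i = 0" if "i < n" "i mod T \<notin> S" for i
              proof -
                have "i < N" using that N by simp
                then have "even (?W r i)" using ev[of "unit_vec i"] that by (simp add: dot_unit_vec)
                moreover have "?W r i \<le> 1" using b that N by (simp add: bits_def)
                ultimately show ?thesis by (cases "?W r i") auto
              qed
              \<comment> \<open>The rows lie in the null space, so a row with last entry 1 already
                is a solution and no combination has to be computed.\<close>
              then have "solves Us S (?W r)"
                using b ev r(2) by (auto simp: solves_def)
              moreover have "S \<subseteq> {..<T}" "card S = k"
                using unrank_subset card_unrank[OF s] by (auto simp: S_def)
              ultimately have "found Us (m5 1)" using r(3) unfolding found_def by blast
              then show ?thesis using m5 by (simp add: I_def)
            qed
          qed simp
        qed
        then show "wp ex B (Seq restrict_prog output_prog)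
           ((n * ((elim_time + 60) + 12) + 9) + (N * ((n * (20 + 12) + 30) + 12) + 9)) 0
           (\<lambda>us m''. I (Suc s) (m''(9 := (m'' 9)(0 := Suc s)))) m3" by (simp only: add_0)
      qed
      then show "wp ex B (Seq copy_prog (Seq restrict_prog output_prog)) ((N * N * (20 + 12) + 9) +
          ((n * ((elim_time + 60) + 12) + 9) + (N * ((n * (20 + 12) + 30) + 12) + 9))) 0
         (\<lambda>us m''. I (Suc s) (m''(9 := (m'' 9)(0 := Suc s)))) m2" by (simp only: add_0)
    qed
    then show "wp ex B ?c step_time 0 (\<lambda>us m''. I (Suc s) (m''(9 := (m'' 9)(0 := Suc s)))) m1"
      unfolding step_time_def by (simp only: add_0)
  qed (use m binom_le(1)[OF T(3)] in auto)
  then show ?thesis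
  proof (rule wp_mono)
    fix m'
    assume I: "I (T choose k) m'"
    show "\<forall>S y. S \<subseteq> {..<T} \<and> card S = k \<and> solves Us S y \<longrightarrow> found Us (m' 1)"
    proof (intro allI impI)
      fix S y
      assume *: "S \<subseteq> {..<T} \<and> card S = k \<and> solves Us S y"
      then obtain s where "s < T choose k" "unrank T k s = S" using unrank_surj by blast
      then show "found Us (m' 1)" using I * unfolding I_def by blast
    qed
  qed simp
qed

end

section \<open>The complete learner\<close>

text \<open>
  The arrays of the two given programs are moved to the even and to the odd numbers from 30
  on, where they interfere neither with each other nor with the learner.
\<close>

definition ren_k :: "nat \<Rightarrow> nat" where "ren_k a = 2 * a + 30"
definition ren_t :: "nat \<Rightarrow> nat" where "ren_t a = 2 * a + 31"

text \<open>
  The examples that depend on the confidence are requested by \<open>L\<close> copies of the code and not by a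
  loop, since a counter would cost a factor \<open>log L\<close> in time.
\<close>

definition learn_prog :: "com \<Rightarrow> com \<Rightarrow> nat \<Rightarrow> com" where
  "learn_prog Ak At L =
     Seq (Set 30 (V 0)) (Seq (Set 31 (V 0)) (Seq (ren ren_k Ak) (Seq (ren ren_t At)
     (Seq (Set 6 (V 32)) (Seq (Set 7 (Quot (V 33) (Num 2)))
     (Seq (Set 22 (Plus (V 0) (Num 1))) (Seq (Set 24 (Times (V 22) (V 22)))
     (Seq init_prog (Seq binom_prog (Seq count_prog
     (Seq (Seq (For 20 23 sample_prog) (repeat L sample_prog)) search_prog)))))))))))"

context block_search
begin

text \<open>2^\<open>samples\<close> bounds the number of candidates: the first summand counts the
  free coordinates within \<open>k\<close> blocks, the second is the bit length of the number of
  choices of blocks. The \<open>L\<close> examples beyond these bring the failure probability down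
  to 2^(-L).\<close>

definition samples :: nat where
  "samples = k * (n div T + 1) + floorlog 2 (T choose k)"

definition learn_time :: "nat \<Rightarrow> nat \<Rightarrow> nat \<Rightarrow> nat" where
  "learn_time ck ct L = ck + ct + 60 + (N * (20 + 12) + 9) + (k * (20 + 12) + 20) + (N * (40 + 12) + 40) +
     ((samples * ((1 + N + elim_time) + 12) + 9) + (L * (1 + N + elim_time) + 1)) +
     ((T choose k) * (step_time + 12) + 9)"

lemma samples_le: "samples \<le> N * N + N"
proof -
  have "T choose k \<le> 2 ^ n"
    using binomial_le_2_power[of T k] power_increasing[OF T(3), of "2::nat"] by linarith
  then have "floorlog 2 (T choose k) \<le> N"
    by (auto intro!: floorlog_leI simp: N intro: le_less_trans)
  moreover have "k * (n div T + 1) \<le> N * N"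
  proof -
    have "n div T \<le> n" by simp
    then show ?thesis using T by (intro mult_mono) (auto simp: N)
  qed
  ultimately show ?thesis unfolding samples_def by linarith
qed

lemma samples_less_B: "samples < B"
  using samples_le B_elim by linarith

text \<open>Arrays 30 and 31 are the renamed inputs of the two given programs, 32 and 33 their
  renamed outputs. All arrays below 30 are out of their reach, so the learner still finds zeros
  there.\<close>

lemma wp_learn:
  assumes Ak: "deterministic Ak" "exec (return_pmf None) Ak (initial n) = return_spmf sk"
      "mem sk 1 0 = k" "time sk \<le> ck"
    and At: "deterministic At" "exec (return_pmf None) At (initial n) = return_spmf st"
      "mem st 1 0 = t" "time st \<le> ct"
    and t: "T = t div 2" "t \<le> n"
  shows "wp ex B (learn_prog Ak At L) (learn_time ck ct L) (samples + L)
     (\<lambda>vs m'. \<forall>S y. S \<subseteq> {..<T} \<and> card S = k \<and> solves ((!) ` set vs) S y \<longrightarrow> found ((!) ` set vs) (m' 1))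
     (mem (initial n))"
proof -
  let ?Q = "\<lambda>vs m'. \<forall>S y. S \<subseteq> {..<T} \<and> card S = k \<and> solves ((!) ` set vs) S y \<longrightarrow> found ((!) ` set vs) (m' 1)"
  \<comment> \<open>The memory after \<open>n\<close> has been copied to the input cells of both
    renamed programs.\<close>
  define m1 where "m1 = (mem (initial n))(30 := (\<lambda>_. 0)(0 := n), 31 := (\<lambda>_. 0)(0 := n))"
  have nB: "n < B" "N < B" "k < B" "2 < B" "1 < B" "t < B"
    using B_small[of n] B_small[of N] B_small[of k] B_small[of 2] B_small[of 1] B_small[of t] T N t(2) by auto
  have NN: "N * N \<le> B" using B_elim by linarith
  have "wp ex B (Seq init_prog (Seq binom_prog (Seq count_prog
     (Seq (Seq (For 20 23 sample_prog) (repeat L sample_prog)) search_prog))))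
      ((N * (20 + 12) + 9) + ((k * (20 + 12) + 20) + ((N * (40 + 12) + 40) +
        (((samples * ((1 + N + elim_time) + 12) + 9) + (L * (1 + N + elim_time) + 1)) +
        ((T choose k) * (step_time + 12) + 9))))) (samples + L) ?Q m"
    if m: "m 0 0 = n" "m 6 0 = k" "m 7 0 = T" "m 22 0 = N" "m 24 0 = N * N"
      "m 3 = (\<lambda>_. 0)" "m 5 = (\<lambda>_. 0)" for m
  proof (rule wp_seq_det[OF wp_init])
    fix m2
    assume M2: "spans_null N {} (matrix_of N (m2 3))" and fr2: "\<And>a. a \<notin> mods init_prog \<Longrightarrow> m2 a = m a"
    have eq2: "m2 0 0 = n" "m2 6 0 = k" "m2 7 0 = T" "m2 22 0 = N" "m2 24 0 = N * N" "m2 5 = (\<lambda>_. 0)"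
      using fr2 m by auto
    show "wp ex B (Seq binom_prog (Seq count_prog
       (Seq (Seq (For 20 23 sample_prog) (repeat L sample_prog)) search_prog)))
        ((k * (20 + 12) + 20) + ((N * (40 + 12) + 40) +
        (((samples * ((1 + N + elim_time) + 12) + 9) + (L * (1 + N + elim_time) + 1)) +
        ((T choose k) * (step_time + 12) + 9)))) (samples + L) ?Q m2"
    proof (rule wp_seq_det[OF wp_binom])
      fix m3
      assume M3: "m3 8 0 = T choose k" and fr3: "\<And>a. a \<notin> mods binom_prog \<Longrightarrow> m3 a = m2 a"
      have eq3: "m3 0 0 = n" "m3 6 0 = k" "m3 7 0 = T" "m3 22 0 = N" "m3 24 0 = N * N" "m3 5 = (\<lambda>_. 0)" "m3 3 = m2 3"
        using fr3 eq2 by auto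
      show "wp ex B (Seq count_prog
       (Seq (Seq (For 20 23 sample_prog) (repeat L sample_prog)) search_prog))
        ((N * (40 + 12) + 40) +
        (((samples * ((1 + N + elim_time) + 12) + 9) + (L * (1 + N + elim_time) + 1)) +
        ((T choose k) * (step_time + 12) + 9))) (samples + L) ?Q m3"
      proof (rule wp_seq_det[OF wp_count])
        fix m4
        assume M4: "m4 23 0 = k * (n div T + 1) + floorlog 2 (T choose k)"
          and fr4: "\<And>a. a \<notin> mods count_prog \<Longrightarrow> m4 a = m3 a"
        have eq4: "m4 0 0 = n" "m4 6 0 = k" "m4 7 0 = T" "m4 22 0 = N" "m4 24 0 = N * N" "m4 5 = (\<lambda>_. 0)"
          "m4 3 = m2 3" "m4 8 0 = T choose k" "m4 23 0 = samples"
          using fr4 eq3 M3 M4 by (auto simp: samples_def)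
        have "wp ex B (Seq (For 20 23 sample_prog) (repeat L sample_prog))
           ((samples * ((1 + N + elim_time) + 12) + 9) + (L * (1 + N + elim_time) + 1)) (samples + L)
           (\<lambda>us m'. spans_null N ((!) ` set us) (matrix_of N (m' 3))) m4"
          using eq4 M2 samples_less_B by (intro wp_sampling) auto
        then have "wp ex B (Seq (Seq (For 20 23 sample_prog) (repeat L sample_prog)) search_prog)
          (((samples * ((1 + N + elim_time) + 12) + 9) + (L * (1 + N + elim_time) + 1)) +
            ((T choose k) * (step_time + 12) + 9)) ((samples + L) + 0) ?Q m4"
        proof (rule wp_seq)
          fix vs m5
          assume M5: "spans_null N ((!) ` set vs) (matrix_of N (m5 3))"
            and fr5: "\<And>a. a \<notin> mods (Seq (For 20 23 sample_prog) (repeat L sample_prog)) \<Longrightarrow> m5 a = m4 a"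
          have fr5': "m5 a = m4 a" if "a \<notin> {2, 3, 15, 16, 17, 18, 19, 20}" for a
            by (rule fr5) (use that mods_repeat[of L sample_prog] in auto)
          have "wp ex B search_prog ((T choose k) * (step_time + 12) + 9) 0 (\<lambda>_. ?Q vs) m5"
            by (rule wp_search) (use M5 fr5' eq4 in auto)
          then show "wp ex B search_prog ((T choose k) * (step_time + 12) + 9) 0 (\<lambda>us. ?Q (vs @ us)) m5"
            by (rule wp_mono) auto
        qed
        then show "wp ex B (Seq (Seq (For 20 23 sample_prog) (repeat L sample_prog)) search_prog)
          (((samples * ((1 + N + elim_time) + 12) + 9) + (L * (1 + N + elim_time) + 1)) +
            ((T choose k) * (step_time + 12) + 9)) (samples + L) ?Q m4" by (simp only: add_0_right)
      qed (use eq3 M3 in auto)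
    qed (use eq2 in auto)
  qed (use m in auto)
  note main = this
  define R where "R = Seq init_prog (Seq binom_prog (Seq count_prog
     (Seq (Seq (For 20 23 sample_prog) (repeat L sample_prog)) search_prog)))"
  define TR where "TR = (N * (20 + 12) + 9) + ((k * (20 + 12) + 20) + ((N * (40 + 12) + 40) +
        (((samples * ((1 + N + elim_time) + 12) + 9) + (L * (1 + N + elim_time) + 1)) +
        ((T choose k) * (step_time + 12) + 9))))"
  note main = main[folded R_def TR_def]
  let ?P = "Seq (Set 6 (V 32)) (Seq (Set 7 (Quot (V 33) (Num 2)))
     (Seq (Set 22 (Plus (V 0) (Num 1))) (Seq (Set 24 (Times (V 22) (V 22))) R)))"
  let ?TP = "(1 + esize (Num 0) + esize (V 32)) + ((1 + esize (Num 0) + esize (Quot (V 33) (Num 2))) +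
     ((1 + esize (Num 0) + esize (Plus (V 0) (Num 1))) + ((1 + esize (Num 0) + esize (Times (V 22) (V 22))) + TR)))"
  have prep: "wp ex B ?P ?TP (samples + L) ?Q m"
    if m: "m 0 0 = n" "m 32 0 = k" "m 33 0 = t" "m 3 = (\<lambda>_. 0)" "m 5 = (\<lambda>_. 0)" for m
  proof -
    define m' where "m' = m(6 := (m 6)(0 := k), 7 := (m 7)(0 := T), 22 := (m 22)(0 := N), 24 := (m 24)(0 := N * N))"
    have "wp ex B R TR (samples + L) ?Q m'" by (rule main) (use m in \<open>auto simp: m'_def\<close>)
    then show ?thesis
      using m nB NN t(1) by (intro wp_assign_seq) (auto simp: m'_def N)
  qed
  have inj: "inj ren_k" "inj ren_t" by (auto simp: inj_def ren_k_def ren_t_def)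
  have "wp ex B (ren ren_k Ak) ck 0 (\<lambda>_ m'. m' (ren_k 1) = mem sk 1) m1"
    by (rule wp_ren[OF Ak(1,2,4) inj(1)]) (auto simp: ren_k_def m1_def initial_def fun_eq_iff)
  then have "wp ex B (Seq (ren ren_k Ak) (Seq (ren ren_t At) ?P)) (ck + (ct + ?TP)) (samples + L) ?Q m1"
  proof (rule wp_seq_det)
    fix m2
    assume k2: "m2 (ren_k 1) = mem sk 1" and fr2: "\<And>a. a \<notin> mods (ren ren_k Ak) \<Longrightarrow> m2 a = m1 a"
    have fr2': "m2 a = m1 a" if "a \<notin> range ren_k" for a
      using that mods_ren[of ren_k Ak] fr2 by blast
    have "wp ex B (ren ren_t At) ct 0 (\<lambda>_ m'. m' (ren_t 1) = mem st 1) m2"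
    proof (rule wp_ren[OF At(1,2,4) inj(2)])
      have "m2 (ren_t a) = m1 (ren_t a)" for a
        by (rule fr2') (auto simp: ren_k_def ren_t_def, presburger)
      then show "(\<lambda>a. m2 (ren_t a)) = mem (initial n)"
        by (auto simp: ren_t_def m1_def initial_def fun_eq_iff)
    qed
    then show "wp ex B (Seq (ren ren_t At) ?P) (ct + ?TP) (samples + L) ?Q m2"
    proof (rule wp_seq_det)
      fix m3
      assume t3: "m3 (ren_t 1) = mem st 1" and fr3: "\<And>a. a \<notin> mods (ren ren_t At) \<Longrightarrow> m3 a = m2 a"
      have fr3': "m3 a = m2 a" if "a \<notin> range ren_t" for a
        using that mods_ren[of ren_t At] fr3 by blast
      have small: "a \<notin> range ren_k" "a \<notin> range ren_t" if "a < 30" for a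
        using that by (auto simp: ren_k_def ren_t_def)
      have "m3 a = m1 a" if "a < 30" for a using small[OF that] fr2' fr3' by simp
      moreover have "m3 32 = m2 32" by (rule fr3') (auto simp: ren_t_def)
      ultimately show "wp ex B ?P ?TP (samples + L) ?Q m3"
        using k2 t3 Ak(3) At(3) by (intro prep) (auto simp: m1_def initial_def ren_k_def ren_t_def)
    qed
  qed
  then have "wp ex B (learn_prog Ak At L) ((1 + esize (Num 0) + esize (V 0)) + ((1 + esize (Num 0) + esize (V 0)) +
      (ck + (ct + ?TP)))) (samples + L) ?Q (mem (initial n))"
    unfolding learn_prog_def R_def[symmetric]
    using nB by (intro wp_assign_seq) (auto simp: m1_def initial_def)
  then show ?thesis
    by (rule wp_time) (simp add: learn_time_def TR_def)
qed

end

section \<open>Few candidates survive the examples\<close>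

text \<open>Independence of the draws. An event is treated as a Boolean random variable, so that its
  probability is the mass of \<open>True\<close> and \<open>spmf_bind\<close> applies.\<close>

lemma prob_all_draws:
  "measure (measure_spmf (draws ex m)) {vs. \<forall>v\<in>set vs. P v} = measure (measure_spmf ex) {v. P v} ^ m"
proof -
  let ?p = "measure (measure_spmf ex) {v. P v}"
  have "spmf (map_spmf (\<lambda>vs. \<forall>v\<in>set vs. P v) (draws ex m)) True = ?p ^ m"
  proof (induction m)
    case 0
    then show ?case by simp
  next
    case (Suc m)
    have "map_spmf (\<lambda>vs. \<forall>v\<in>set vs. P v) (draws ex (Suc m)) =
      bind_spmf ex (\<lambda>v. map_spmf (\<lambda>vs. P v \<and> (\<forall>v\<in>set vs. P v)) (draws ex m))"
      by (simp add: map_spmf_bind_spmf spmf.map_comp o_def)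
    moreover have "spmf (map_spmf (\<lambda>vs. P v \<and> (\<forall>v\<in>set vs. P v)) (draws ex m)) True =
        ?p ^ m * indicator {v. P v} v" for v
      using Suc by (auto simp: indicator_def spmf_map vimage_def)
    ultimately have "spmf (map_spmf (\<lambda>vs. \<forall>v\<in>set vs. P v) (draws ex (Suc m))) True =
        (\<integral>v. ?p ^ m * indicator {v. P v} v \<partial>measure_spmf ex)"
      by (simp only: spmf_bind)
    also have "\<dots> = ?p ^ m * ?p" by simp
    finally show ?case by simp
  qed
  then show ?thesis by (simp add: spmf_map vimage_def)
qed

section \<open>A uniform example refutes a wrong parity with probability 1/2\<close>

lemma finite_cube [simp]: "finite (cube n)"
  using finite_lists_length_eq[of "{0, 1 :: nat}" n] by (simp add: cube_def)

lemma cube_nonempty [simp]: "cube n \<noteq> {}"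
proof -
  have "replicate n 0 \<in> cube n" by (auto simp: cube_def)
  then show ?thesis by blast
qed

lemma cube_nth: "a \<in> cube n \<Longrightarrow> i < n \<Longrightarrow> a ! i \<le> 1"
  unfolding cube_def by (auto dest!: nth_mem)

text \<open>Flipping coordinate \<open>i\<close> is an involution of the cube; as \<open>w i\<close>
  is odd, it exchanges the points with even sum and those with odd sum.\<close>

lemma card_even_cube:
  fixes w :: "nat \<Rightarrow> nat"
  assumes i: "i < n" "odd (w i)"
  shows "2 * card {a \<in> cube n. even (\<Sum>j<n. w j * a ! j)} = card (cube n)"
proof -
  let ?s = "\<lambda>a. \<Sum>j<n. w j * a ! j"
  let ?E = "{a \<in> cube n. even (?s a)}" and ?O = "{a \<in> cube n. odd (?s a)}"
  let ?f = "\<lambda>a :: nat list. a[i := 1 - a ! i]"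
  have f: "?f a \<in> cube n \<and> ?f (?f a) = a \<and> (even (?s (?f a)) \<longleftrightarrow> odd (?s a))" if a: "a \<in> cube n" for a
  proof -
    have l: "length a = n" and ai: "a ! i \<le> 1" using a i cube_nth[OF a i(1)] by (auto simp: cube_def)
    have c: "?f a \<in> cube n" using a ai set_update_subset_insert[of a i "1 - a ! i"] unfolding cube_def by auto
    have ff: "?f (?f a) = a" using l ai i by (auto intro!: nth_equalityI simp: nth_list_update)
    have s: "?s b = w i * b ! i + (\<Sum>j\<in>{..<n} - {i}. w j * b ! j)" for b
      using i by (subst sum.remove[of _ i]) auto
    have "(\<Sum>j\<in>{..<n} - {i}. w j * ?f a ! j) = (\<Sum>j\<in>{..<n} - {i}. w j * a ! j)"
      by (intro sum.cong) auto
    moreover have "?f a ! i = 1 - a ! i" using l i by simp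
    ultimately have "?s (?f a) + ?s a = w i * (1 - a ! i + a ! i) + 2 * (\<Sum>j\<in>{..<n} - {i}. w j * a ! j)"
      unfolding s[of "?f a"] s[of a] by (simp add: algebra_simps)
    moreover have "1 - a ! i + a ! i = 1" using ai by simp
    ultimately have "?s (?f a) + ?s a = w i + 2 * (\<Sum>j\<in>{..<n} - {i}. w j * a ! j)" by simp
    then have "odd (?s (?f a) + ?s a)" using i(2) by simp
    then show ?thesis using c ff by simp
  qed
  have "bij_betw ?f ?E ?O"
    by (rule bij_betw_byWitness[where f' = ?f]) (use f in auto)
  then have "card ?E = card ?O" by (rule bij_betw_same_card)
  moreover have "card (?E \<union> ?O) = card ?E + card ?O"
    by (rule card_Un_disjoint) auto
  moreover have "?E \<union> ?O = cube n" by auto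
  ultimately show ?thesis by simp
qed

definition extend :: "nat \<Rightarrow> nat list \<Rightarrow> nat \<Rightarrow> nat" where
  "extend n z i = (if i < n then z ! i else 1)"

lemma dot_example:
  "a \<in> cube n \<Longrightarrow> dot (Suc n) ((!) (a @ [b])) (extend n z) = (\<Sum>j<n. z ! j * a ! j) + b"
  by (simp add: dot_def extend_def nth_append cube_def mult.commute)

text \<open>\<open>z\<close> survives an example labelled by \<open>x\<close> iff the integer vector
  \<open>z + x\<close> has an even inner product with it, and this vector is odd wherever
  \<open>z\<close> and \<open>x\<close> differ.\<close>

lemma prob_consistent:
  assumes x: "x \<in> cube n" and z: "z \<in> cube n" and ne: "z \<noteq> x"
  shows "measure (measure_spmf (uniform_examples n (parity_fun x)))
    {v. even (dot (Suc n) ((!) v) (extend n z))} = 1 / 2"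
proof -
  let ?P = "\<lambda>v. even (dot (Suc n) ((!) v) (extend n z))"
  let ?w = "\<lambda>j. z ! j + x ! j"
  have lx: "length x = n" "length z = n" using x z by (auto simp: cube_def)
  then obtain i where i: "i < n" "z ! i \<noteq> x ! i" using ne nth_equalityI[of z x] by auto
  then have odd: "odd (?w i)" using cube_nth[OF x i(1)] cube_nth[OF z i(1)] by (auto simp: le_Suc_eq)
  have "?P (a @ [parity_fun x a]) \<longleftrightarrow> even (\<Sum>j<n. ?w j * a ! j)" if a: "a \<in> cube n" for a
    using a by (simp add: dot_example parity_fun_def lx distrib_right sum.distrib even_add)
  then have eq: "cube n \<inter> {a. ?P (a @ [parity_fun x a])} = {a \<in> cube n. even (\<Sum>j<n. ?w j * a ! j)}"
    by blast
  have m1: "measure (measure_spmf (uniform_examples n (parity_fun x))) {v. ?P v} =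
      card {a \<in> cube n. even (\<Sum>j<n. ?w j * a ! j)} / card (cube n)"
    unfolding uniform_examples_def by (simp add: measure_map_spmf vimage_def measure_spmf_of_set eq)
  have m2: "real (card (cube n)) = 2 * real (card {a \<in> cube n. even (\<Sum>j<n. ?w j * a ! j)})"
    using card_even_cube[OF i(1), of ?w] odd by simp
  have m3: "0 < real (card (cube n))" by (simp add: card_gt_0_iff)
  have "p = 1 / 2" if "p = c / d" "d = 2 * c" "0 < d" for p c d :: real
    using that by simp
  from this[OF m1 m2 m3] show ?thesis .
qed

lemma prob_wrong_candidate:
  assumes x: "x \<in> cube n" and Z: "Z \<subseteq> cube n"
  shows "measure (measure_spmf (draws (uniform_examples n (parity_fun x)) m))
    {vs. \<exists>z\<in>Z - {x}. \<forall>v\<in>set vs. even (dot (Suc n) ((!) v) (extend n z))} \<le> card Z * (1 / 2) ^ m"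
proof -
  let ?M = "measure_spmf (draws (uniform_examples n (parity_fun x)) m)"
  let ?A = "\<lambda>z. {vs. \<forall>v\<in>set vs. even (dot (Suc n) ((!) v) (extend n z))}"
  have fin: "finite Z" using Z finite_subset finite_cube by blast
  have "{vs. \<exists>z\<in>Z - {x}. \<forall>v\<in>set vs. even (dot (Suc n) ((!) v) (extend n z))} = (\<Union>z\<in>Z - {x}. ?A z)"
    by auto
  then have "measure ?M {vs. \<exists>z\<in>Z - {x}. \<forall>v\<in>set vs. even (dot (Suc n) ((!) v) (extend n z))} \<le>
     (\<Sum>z\<in>Z - {x}. measure ?M (?A z))"
    using fin by (auto intro!: measure_spmf.finite_measure_subadditive_finite)
  also have "\<dots> = (\<Sum>z\<in>Z - {x}. (1 / 2) ^ m)"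
  proof (rule sum.cong[OF refl])
    fix z
    assume "z \<in> Z - {x}"
    then have "z \<in> cube n" "z \<noteq> x" using Z by auto
    then have "measure (measure_spmf (uniform_examples n (parity_fun x)))
      {v. even (dot (Suc n) ((!) v) (extend n z))} = 1 / 2"
      by (rule prob_consistent[OF x])
    then show "measure ?M (?A z) = (1 / 2) ^ m" by (simp only: prob_all_draws)
  qed
  also have "\<dots> = card (Z - {x}) * (1 / 2) ^ m" by simp
  also have "\<dots> \<le> card Z * (1 / 2) ^ m"
    using fin by (intro mult_right_mono) (auto intro: card_mono)
  finally show ?thesis .
qed

text \<open>All that linear algebra can return: vectors supported on \<open>k\<close> blocks,
  whatever their weight. The union bound therefore runs over these and not over the
  \<open>k\<close>-parities.\<close>

definition candidates :: "nat \<Rightarrow> nat \<Rightarrow> nat \<Rightarrow> nat list set" where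
  "candidates n k T = {z \<in> cube n. \<exists>S\<subseteq>{..<T}. card S = k \<and> (\<forall>i<n. i mod T \<notin> S \<longrightarrow> z ! i = 0)}"

text \<open>On a residue class modulo \<open>T\<close>, the map \<open>i div T\<close> is
  injective.\<close>

lemma card_residue_class: "0 < T \<Longrightarrow> card {i. i < n \<and> i mod T = b} \<le> n div T + 1"
proof -
  assume T: "0 < T"
  have "inj_on (\<lambda>i. i div T) {i. i < n \<and> i mod T = b}"
    by (auto simp: inj_on_def) (metis div_mult_mod_eq)
  moreover have "(\<lambda>i. i div T) ` {i. i < n \<and> i mod T = b} \<subseteq> {..n div T}"
    by (auto intro: div_le_mono)
  ultimately show ?thesis
    using card_inj_on_le[of "\<lambda>i. i div T" "{i. i < n \<and> i mod T = b}" "{..n div T}"] by simp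
qed

lemma card_candidates:
  assumes T: "0 < T"
  shows "card (candidates n k T) \<le> (T choose k) * 2 ^ (k * (n div T + 1))"
proof -
  let ?F = "{S. S \<subseteq> {..<T} \<and> card S = k}"
  let ?Z = "\<lambda>S. {z \<in> cube n. \<forall>i<n. i mod T \<notin> S \<longrightarrow> z ! i = 0}"
  have fin: "finite ?F" by (rule finite_subset[of _ "Pow {..<T}"]) auto
  have Z: "card (?Z S) \<le> 2 ^ (k * (n div T + 1))" if S: "S \<in> ?F" for S
  proof -
    let ?I = "{i. i < n \<and> i mod T \<in> S}"
    have fS: "finite S" using S finite_subset by blast
    have "inj_on (\<lambda>z. {i. i < n \<and> z ! i = 1}) (?Z S)"
    proof (rule inj_onI)
      fix y z
      assume *: "y \<in> ?Z S" "z \<in> ?Z S" "{i. i < n \<and> y ! i = 1} = {i. i < n \<and> z ! i = 1}"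
      have "y ! i = z ! i" if "i < n" for i
      proof -
        have "y ! i = 1 \<longleftrightarrow> z ! i = 1" using *(3) that by auto
        moreover have "y ! i \<le> 1" "z ! i \<le> 1" using * cube_nth that by blast+
        ultimately show ?thesis by arith
      qed
      then show "y = z" using * by (intro nth_equalityI) (auto simp: cube_def)
    qed
    moreover have "(\<lambda>z. {i. i < n \<and> z ! i = 1}) ` ?Z S \<subseteq> Pow ?I" by force
    ultimately have "card (?Z S) \<le> card (Pow ?I)" by (rule card_inj_on_le) simp
    also have "\<dots> = 2 ^ card ?I" by (simp add: card_Pow)
    also have "card ?I \<le> k * (n div T + 1)"
    proof -
      have "?I = (\<Union>b\<in>S. {i. i < n \<and> i mod T = b})" by auto
      then have "card ?I \<le> (\<Sum>b\<in>S. card {i. i < n \<and> i mod T = b})"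
        using card_UN_le[OF fS] by simp
      also have "\<dots> \<le> (\<Sum>b\<in>S. n div T + 1)" by (intro sum_mono card_residue_class T)
      also have "\<dots> = k * (n div T + 1)" using S by simp
      finally show ?thesis .
    qed
    finally show ?thesis by simp
  qed
  have "candidates n k T = (\<Union>S\<in>?F. ?Z S)" unfolding candidates_def by auto
  then have "card (candidates n k T) \<le> (\<Sum>S\<in>?F. card (?Z S))"
    using card_UN_le[OF fin] by simp
  also have "\<dots> \<le> (\<Sum>S\<in>?F. 2 ^ (k * (n div T + 1)))" by (intro sum_mono Z)
  also have "\<dots> = (T choose k) * 2 ^ (k * (n div T + 1))"
    using n_subsets[of "{..<T}" k] by simp
  finally show ?thesis .
qed

text \<open>The \<open>k\<close> ones meet at most \<open>k\<close> blocks; if they meet fewer,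
  other blocks fill the set up to size \<open>k\<close>, which is possible because of
  \<open>k \<le> T\<close>.\<close>

lemma PAR_candidates:
  assumes x: "x \<in> PAR n k" and T: "0 < T" "k \<le> T"
  shows "x \<in> candidates n k T"
proof -
  have c: "x \<in> cube n" and w: "card {i. i < length x \<and> x ! i \<noteq> 0} = k" and l: "length x = n"
    using x by (auto simp: PAR_def hamming_weight_def cube_def)
  let ?S = "(\<lambda>i. i mod T) ` {i. i < length x \<and> x ! i \<noteq> 0}"
  have "card ?S \<le> k" using card_image_le[of "{i. i < length x \<and> x ! i \<noteq> 0}"] w by auto
  moreover have "?S \<subseteq> {..<T}" using T by auto
  ultimately obtain S where "?S \<subseteq> S" "S \<subseteq> {..<T}" "card S = k"
    using exists_subset_between[of ?S k "{..<T}"] T by auto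
  moreover from this have "\<forall>i<n. i mod T \<notin> S \<longrightarrow> x ! i = 0" using l by auto
  ultimately show ?thesis using c unfolding candidates_def by blast
qed

lemma lossless_uniform_examples: "lossless_spmf (uniform_examples n f)"
  by (simp add: uniform_examples_def)

text \<open>The final state is a function of the list of examples, so the success probability is
  computed in \<open>draws\<close>. Time and sample bounds hold on the whole support.\<close>

lemma learn_prog_learns:
  assumes T: "1 \<le> T" "k \<le> T" "T \<le> n"
    and B: "4 * ((n + 2) * (n + 2)) \<le> B" "(n + 2) * 2 ^ n \<le> B"
    and Ak: "deterministic Ak" "exec (return_pmf None) Ak (initial n) = return_spmf sk"
      "mem sk 1 0 = k" "time sk \<le> ck"
    and At: "deterministic At" "exec (return_pmf None) At (initial n) = return_spmf st"
      "mem st 1 0 = t" "time st \<le> ct"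
    and t: "T = t div 2" "t \<le> n"
    and q: "real (block_search.samples n k T + L) \<le> q"
    and time: "real (block_search.learn_time n k T (Suc n) ck ct L * U B) \<le> tm"
    and \<delta>: "(1 / 2) ^ L \<le> \<delta>"
  shows "learns_parities (learn_prog Ak At L) n (PAR n k) (1 / 2) \<delta> q tm"
  unfolding learns_parities_def Let_def
proof
  fix x
  assume x: "x \<in> PAR n k"
  then have xc: "x \<in> cube n" by (simp add: PAR_def)
  define ex where "ex = uniform_examples n (parity_fun x)"
  let ?N = "Suc n"
  let ?m = "block_search.samples n k T + L"
  have pf: "parity_fun x a \<le> 1" for a unfolding parity_fun_def by linarith
  interpret block_search n k T B ?N ex
  proof
    fix v
    assume "v \<in> set_spmf ex"
    then obtain a where "a \<in> cube n" "v = a @ [parity_fun x a]"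
      by (auto simp: ex_def uniform_examples_def)
    then show "length v = ?N \<and> set v \<subseteq> {0, 1}"
      using pf[of a] by (auto simp: cube_def le_Suc_eq)
  qed (use T B in auto)
  let ?sol = "\<lambda>vs m'. \<forall>S y. S \<subseteq> {..<T} \<and> card S = k \<and> solves ((!) ` set vs) S y \<longrightarrow> found ((!) ` set vs) (m' 1)"
  obtain F d where
    Fd: "(\<forall>s. mem s = mem (initial n) \<longrightarrow> exec ex (learn_prog Ak At L) s =
        map_spmf (\<lambda>vs. s\<lparr>mem := F vs, time := time s + d vs, examples := examples s + ?m\<rparr>) (draws ex ?m)) \<and>
      (\<forall>vs\<in>set_spmf (draws ex ?m). d vs \<le> learn_time ck ct L * U B \<and> ?sol vs (F vs) \<and>
        (\<forall>a. a \<notin> mods (learn_prog Ak At L) \<longrightarrow> F vs a = mem (initial n) a))"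
    using wp_learn[OF Ak At t, of L, unfolded wp_def] by (elim exE) (rule that)
  then have F: "d vs \<le> learn_time ck ct L * U B \<and> ?sol vs (F vs)" if "vs \<in> set_spmf (draws ex ?m)" for vs
    using that by simp
  let ?g = "\<lambda>vs. (initial n)\<lparr>mem := F vs, time := time (initial n) + d vs, examples := examples (initial n) + ?m\<rparr>"
  let ?r = "exec ex (learn_prog Ak At L) (initial n)"
  have r: "?r = map_spmf ?g (draws ex ?m)" using Fd by simp
  have ll: "lossless_spmf ex" by (simp add: ex_def lossless_uniform_examples)
  let ?good = "{s. output_vector n s \<in> cube n \<and>
              error n (parity_fun x) (parity_fun (output_vector n s)) < 1 / 2}"
  let ?bad = "{vs. \<exists>z\<in>candidates n k T - {x}. \<forall>v\<in>set vs. even (dot ?N ((!) v) (extend n z))}"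
  let ?M = "measure_spmf (draws ex ?m)"
  \<comment> \<open>The target is consistent, so the search succeeds and the output is a consistent
    candidate; outside \<open>?bad\<close> the only such candidate is the target, and the error is
    0.\<close>
  have sub: "set_spmf (draws ex ?m) - ?bad \<subseteq> ?g -` ?good"
  proof
    fix vs
    assume vs: "vs \<in> set_spmf (draws ex ?m) - ?bad"
    let ?Us = "(!) ` set vs"
    have xcand: "x \<in> candidates n k T" using PAR_candidates[OF x] T by simp
    then obtain S where S: "S \<subseteq> {..<T}" "card S = k" "\<forall>i<n. i mod T \<notin> S \<longrightarrow> x ! i = 0"
      unfolding candidates_def by blast
    have "even (dot ?N ((!) v) (extend n x))" if "v \<in> set vs" for v
    proof -
      have "v \<in> set_spmf ex" using that vs set_draws by blast
      then obtain a where a: "a \<in> cube n" "v = a @ [parity_fun x a]"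
        by (auto simp: ex_def uniform_examples_def)
      have "length x = n" using xc by (simp add: cube_def)
      then show ?thesis using a by (simp add: dot_example parity_fun_def)
    qed
    then have "solves ?Us S (extend n x)"
      using S(3) cube_nth[OF xc] by (auto simp: solves_def bits_def extend_def)
    then have "found ?Us (F vs 1)" using F vs S by blast
    then obtain S' y where y: "S' \<subseteq> {..<T}" "card S' = k" "solves ?Us S' y" "\<forall>i<n. F vs 1 i = y i"
      unfolding found_def by blast
    define z where "z = map (F vs 1) [0..<n]"
    have zi: "z ! i = y i" if "i < n" for i using that y(4) by (simp add: z_def)
    have yb: "y i \<le> 1" if "i < n" for i using y(3) that by (simp add: solves_def bits_def)
    have "F vs 1 i \<in> {0, 1}" if "i < n" for i
    proof -
      have "F vs 1 i \<le> 1" using that y(4) yb[of i] by simp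
      then show ?thesis by auto
    qed
    moreover have "set z = F vs 1 ` {..<n}" by (auto simp: z_def)
    ultimately have "set z \<subseteq> {0, 1}" by (simp add: image_subset_iff)
    then have zc: "z \<in> cube n" by (simp add: cube_def z_def)
    have ext: "extend n z i = y i" if "i < ?N" for i
      using that zi y(3) by (auto simp: extend_def solves_def less_Suc_eq)
    have "dot ?N u (extend n z) = dot ?N u y" for u
      unfolding dot_def using ext by (intro sum.cong) auto
    then have "\<forall>v\<in>set vs. even (dot ?N ((!) v) (extend n z))" using y(3) by (auto simp: solves_def)
    moreover have "\<forall>i<n. i mod T \<notin> S' \<longrightarrow> z ! i = 0" using y(3) zi by (auto simp: solves_def)
    then have "z \<in> candidates n k T" using zc y(1,2) unfolding candidates_def by blast
    ultimately have "z = x" using vs by blast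
    moreover have "output_vector n (?g vs) = z" by (simp add: output_vector_def z_def)
    moreover have "error n (parity_fun x) (parity_fun x) = 0" by (simp add: error_def)
    ultimately show "vs \<in> ?g -` ?good" using xc by simp
  qed
  have "measure ?M ?bad \<le> card (candidates n k T) * (1 / 2) ^ ?m"
    unfolding ex_def using xc by (rule prob_wrong_candidate) (auto simp: candidates_def)
  also have "\<dots> \<le> (2 ^ samples) * (1 / 2) ^ ?m"
  proof -
    have "T choose k \<le> 2 ^ floorlog 2 (T choose k)"
      using floorlog_bounds[of "T choose k" 2] T by (simp add: less_imp_le zero_less_binomial)
    then have "(T choose k) * 2 ^ (k * (n div T + 1)) \<le> 2 ^ floorlog 2 (T choose k) * 2 ^ (k * (n div T + 1))"
      by (rule mult_le_mono1)
    then have "card (candidates n k T) \<le> 2 ^ samples"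
      using card_candidates[of T n k] T unfolding samples_def power_add by (simp only: mult.commute) linarith
    then have "real (card (candidates n k T)) \<le> real (2 ^ samples)" by (rule of_nat_mono)
    then show ?thesis by (intro mult_right_mono) auto
  qed
  also have "\<dots> = (1 / 2) ^ L" by (simp add: power_add power_one_over)
  also have "\<dots> \<le> \<delta>" by (rule \<delta>)
  finally have bad: "measure ?M ?bad \<le> \<delta>" .
  \<comment> \<open>The draws are lossless and their support is covered by the bad and the good
    event.\<close>
  have "1 = measure ?M (space ?M)"
    using lossless_draws[OF ll, of ?m] by (simp only: lossless_spmf_def weight_spmf_def)
  also have "\<dots> \<le> measure ?M (?bad \<union> ?g -` ?good)"
    by (rule measure_spmf.finite_measure_mono_AE) (use sub in auto)
  also have "\<dots> \<le> measure ?M ?bad + measure ?M (?g -` ?good)"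
    by (rule measure_Un_le) auto
  finally have good: "1 - \<delta> \<le> measure (measure_spmf ?r) ?good"
    using bad unfolding r measure_map_spmf by linarith
  have "real (examples s) \<le> q \<and> real (time s) \<le> tm" if "s \<in> set_spmf ?r" for s
  proof -
    from that obtain vs where vs: "vs \<in> set_spmf (draws ex ?m)" "s = ?g vs" by (auto simp: r)
    then have "examples s = ?m" "time s \<le> learn_time ck ct L * U B"
      using F[OF vs(1)] by (simp_all add: initial_def)
    then show ?thesis using q time by (metis of_nat_mono order_trans)
  qed
  moreover have "lossless_spmf ?r" using lossless_draws[OF ll] by (simp add: r)
  ultimately show "lossless_spmf (exec (uniform_examples n (parity_fun x)) (learn_prog Ak At L) (initial n)) \<and>
         (\<forall>s\<in>set_spmf (exec (uniform_examples n (parity_fun x)) (learn_prog Ak At L) (initial n)).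
             real (examples s) \<le> q \<and> real (time s) \<le> tm) \<and>
         1 - \<delta> \<le> measure (measure_spmf (exec (uniform_examples n (parity_fun x)) (learn_prog Ak At L) (initial n)))
           {s. output_vector n s \<in> cube n \<and>
              error n (parity_fun x) (parity_fun (output_vector n s)) < 1 / 2}"
    using good unfolding ex_def by blast
qed

section \<open>Asymptotics\<close>

text \<open>The step from \<open>k\<close> to k + 1 multiplies the coefficients by (T - k)/(k + 1)
  and (t - k)/(k + 1), and 2 (T - k) \<le> t - k.\<close>

lemma binomial_half_le: "2 * T \<le> t \<Longrightarrow> 2 ^ k * (T choose k) \<le> t choose k"
proof (induction k)
  case 0
  then show ?case by simp
next
  case (Suc k)
  have step: "Suc k * (m choose Suc k) = (m - k) * (m choose k)" for m
    by (metis binomial_absorb_comp binomial_absorption)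
  have "Suc k * (2 ^ Suc k * (T choose Suc k)) = 2 * 2 ^ k * (Suc k * (T choose Suc k))"
    by (simp only: power_Suc mult_ac)
  also have "\<dots> = (2 * (T - k)) * (2 ^ k * (T choose k))"
    unfolding step by (simp only: mult_ac)
  also have "\<dots> \<le> (t - k) * (t choose k)"
    using Suc by (intro mult_le_mono) auto
  also have "\<dots> = Suc k * (t choose Suc k)" using step[of t] by simp
  finally show ?case by (simp only: Suc_mult_le_cancel1)
qed

text \<open>The estimate exp x \<le> 1 + x + x^2 on the unit interval gives 7/4 at x = 1/2.\<close>

lemma exp_le_2: "exp (1 / 4.01 :: real) \<le> 2"
proof -
  have "exp (1 / 4.01 :: real) \<le> exp (1 / 2)" by simp
  also have "exp (1 / 2 :: real) \<le> 1 + 1 / 2 + (1 / 2)\<^sup>2" by (rule exp_bound) auto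
  also have "\<dots> \<le> 2" by (simp add: power2_eq_square)
  finally show ?thesis .
qed

lemma binomial_half_exp:
  assumes "2 * T \<le> t"
  shows "real (T choose k) \<le> exp (- real k / 4.01) * real (t choose k)"
proof -
  have "exp (real k / 4.01) = exp (1 / 4.01) ^ k"
    by (simp add: exp_of_nat_mult[symmetric])
  also have "\<dots> \<le> 2 ^ k" using exp_le_2 by (intro power_mono) auto
  finally have "exp (real k / 4.01) * real (T choose k) \<le> 2 ^ k * real (T choose k)"
    by (intro mult_right_mono) auto
  also have "\<dots> = real (2 ^ k * (T choose k))" by simp
  also have "\<dots> \<le> real (t choose k)" using binomial_half_le[OF assms] of_nat_mono by blast
  finally show ?thesis by (simp add: exp_minus field_simps)
qed

section \<open>Running time and sample size in terms of the parameters\<close>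

definition value_bound :: "nat \<Rightarrow> nat" where
  "value_bound n = 4 * ((n + 2) * (n + 2)) * 2 ^ n"

lemma value_bound: "4 * ((n + 2) * (n + 2)) \<le> value_bound n" "(n + 2) * 2 ^ n \<le> value_bound n"
proof -
  have "n + 2 \<le> 4 * ((n + 2) * (n + 2))" by (simp add: algebra_simps)
  then show "(n + 2) * 2 ^ n \<le> value_bound n" unfolding value_bound_def by (rule mult_le_mono1)
qed (simp add: value_bound_def)

text \<open>From n + 2 < 2^(n + 2) the value bound is at most 2^(3 n + 6), so its length is linear
  in \<open>n\<close> and the unit of time quadratic.\<close>

lemma U_value_bound: "U (value_bound n) \<le> 16 * (n + 2) ^ 2"
proof -
  have "n + 2 < 2 ^ (n + 2)" by (rule less_exp)
  then have "value_bound n \<le> 4 * (2 ^ (n + 2) * 2 ^ (n + 2)) * 2 ^ n"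
    unfolding value_bound_def by (intro mult_le_mono) auto
  also have "\<dots> = 2 ^ (3 * n + 6)"
  proof -
    have e: "3 * n + 6 = 2 + ((n + 2) + (n + 2)) + n" by simp
    show ?thesis unfolding e power_add by simp
  qed
  also have "\<dots> < 2 ^ (3 * n + 7)" by simp
  finally have "floorlog 2 (value_bound n) \<le> 3 * n + 7" by (intro floorlog_leI) auto
  then have "len (value_bound n) \<le> 4 * (n + 2)" by (simp add: len_def)
  then have "(len (value_bound n))\<^sup>2 \<le> (4 * (n + 2))\<^sup>2" by (rule power_mono) simp
  also have "(4 * (n + 2))\<^sup>2 = 16 * (n + 2)\<^sup>2" by (simp only: power_mult_distrib) simp
  finally show ?thesis unfolding U_def .
qed

context block_search
begin

text \<open>The examples contribute a term with factor \<open>L\<close>, the search one with factor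
  \<open>T choose k\<close>. Both factors are at least 1, so their product dominates each term. The
  power 4 comes from a quadratic number of eliminations of quadratic cost; 9000 is generous.\<close>

lemma learn_time_le:
  assumes "ck \<le> a * (n\<^sup>2 + 1)" "ct \<le> b * (n\<^sup>2 + 1)" "1 \<le> L"
  shows "learn_time ck ct L \<le> (a + b + 9000) * (n + 2) ^ 4 * (L * (T choose k))"
proof -
  \<comment> \<open>With n + 2, both \<open>N * N + N\<close> and \<open>n\<^sup>2 + 1\<close> are
    at most x^2.\<close>
  define x where "x = n + 2"
  define C where "C = T choose k"
  define E where "E = 1 + N + elim_time"
  have x: "N \<le> x" "n \<le> x" "T \<le> x" "k \<le> x" "1 \<le> x" using T N by (auto simp: x_def)
  have C: "1 \<le> C" using T by (simp add: C_def Suc_le_eq zero_less_binomial)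
  have p: "x \<le> x ^ 2" "x ^ 2 \<le> x ^ 3" "x ^ 3 \<le> x ^ 4" "1 \<le> x ^ 2"
    using x(5) by (auto intro: power_increasing simp: self_le_power)
  have NN: "N * N \<le> x ^ 2" "n * N \<le> x ^ 2" "N * n \<le> x ^ 2" unfolding power2_eq_square using x by (auto intro: mult_le_mono)
  have el: "elim_time \<le> 320 * x ^ 2"
    unfolding elim_time_def using NN(1) x(1) p by (simp add: algebra_simps)
  have E: "E \<le> 330 * x ^ 2" using el x p unfolding E_def by linarith
  have nel: "n * elim_time \<le> 320 * x ^ 3"
    using mult_le_mono[OF x(2) el] by (simp add: power3_eq_cube power2_eq_square algebra_simps)
  have NNn: "N * (n * 32) \<le> 32 * x ^ 2" using NN by simp
  have "step_time = T * 112 + 30 + (N * N * 32 + 9 + (n * elim_time + n * 72 + 9 + (N * (n * 32) + N * 42 + 9)))"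
    unfolding step_time_def by (simp add: algebra_simps)
  also have "\<dots> \<le> 1000 * x ^ 3"
    using nel NN NNn x p by linarith
  finally have st: "step_time + 12 \<le> 1012 * x ^ 4" using p x by linarith
  have s: "samples * (E + 12) \<le> 342 * x ^ 4"
  proof -
    have "samples * (E + 12) \<le> x ^ 2 * (342 * x ^ 2)"
    proof (rule mult_le_mono)
      have "N * N + N \<le> x ^ 2" by (simp add: x_def N power2_eq_square)
      then show "samples \<le> x ^ 2" using samples_le by linarith
    qed (use E p in linarith)
    also have "\<dots> = 342 * (x ^ 2 * x ^ 2)" by (simp only: mult_ac)
    also have "x ^ 2 * x ^ 2 = x ^ 4" by (simp only: power_add[symmetric]) simp
    finally show ?thesis .
  qed
  have LE: "L * E \<le> (330 * x ^ 4) * L"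
    using mult_le_mono2[of E "330 * x ^ 4" L] E p by (simp add: mult.commute)
  have CS: "C * (step_time + 12) \<le> (1012 * x ^ 4) * C"
    using mult_le_mono2[OF st, of C] by (simp add: mult.commute)
  have n2: "n\<^sup>2 + 1 \<le> x ^ 2" by (simp add: x_def power2_eq_square)
  have ck: "ck \<le> a * x ^ 4" "ct \<le> b * x ^ 4"
    using assms(1,2) n2 p by (meson le_trans mult_le_mono2)+
  have "learn_time ck ct L = ck + ct + 60 + (N * 32 + 9) + (k * 32 + 20) + (N * 52 + 40) +
     ((samples * (E + 12) + 9) + (L * E + 1)) + (C * (step_time + 12) + 9)"
    unfolding learn_time_def E_def C_def by simp
  also have "\<dots> \<le> a * x ^ 4 + b * x ^ 4 + 1000 * x ^ 4 + (330 * x ^ 4) * L + (1012 * x ^ 4) * C"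
    using ck s LE CS x p by linarith
  also have "\<dots> \<le> (a + b + 1000) * x ^ 4 * (L * C) + (330 * x ^ 4) * (L * C) + (1012 * x ^ 4) * (L * C)"
  proof (intro add_mono mult_le_mono2)
    have "a * x ^ 4 + b * x ^ 4 + 1000 * x ^ 4 = (a + b + 1000) * x ^ 4 * 1" by (simp add: algebra_simps)
    also have "\<dots> \<le> (a + b + 1000) * x ^ 4 * (L * C)"
      using assms(3) C by (intro mult_le_mono2) (simp add: Suc_le_eq)
    finally show "a * x ^ 4 + b * x ^ 4 + 1000 * x ^ 4 \<le> (a + b + 1000) * x ^ 4 * (L * C)" .
  qed (use assms(3) C in \<open>simp_all add: Suc_le_eq\<close>)
  also have "\<dots> = (a + b + 2342) * x ^ 4 * (L * C)" by (simp add: algebra_simps)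
  also have "\<dots> \<le> (a + b + 9000) * x ^ 4 * (L * C)" by (intro mult_le_mono1) simp
  finally show ?thesis unfolding x_def C_def .
qed

end

text \<open>Rounding is absorbed by constants: t \<le> 3 (t div 2) yields 3 k n / t, the summand
  \<open>k\<close> is at most k n / t because of t \<le> n, and the 1 from the bit length is at most
  k n / t too; hence 5.\<close>

lemma samples_real_le:
  assumes "1 \<le> k" "4 * k \<le> t" "t \<le> n"
  shows "real (block_search.samples n k (t div 2)) \<le>
    5 * (real k * real n / real t) + ln (real (t choose k)) / ln 2"
proof -
  let ?T = "t div 2"
  let ?r = "real k * real n / real t"
  have t: "0 < t" "4 \<le> t" using assms by auto
  have T: "1 \<le> ?T" "k \<le> ?T" using assms by auto
  have "t \<le> 3 * ?T" using t by linarith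
  then have tT: "real t \<le> 3 * real ?T" by linarith
  have r: "real k \<le> ?r" "1 \<le> ?r"
  proof -
    have "real k * 1 \<le> real k * (real n / real t)" using assms t by (intro mult_left_mono) (auto simp: field_simps)
    then show "real k \<le> ?r" by simp
    then show "1 \<le> ?r" using assms(1) by linarith
  qed
  have "real (n div ?T) \<le> real n / real ?T" by (rule of_nat_div_le_of_nat)
  also have "\<dots> \<le> 3 * (real n / real t)"
    using tT t T by (simp add: field_simps mult_left_mono)
  finally have "real k * real (n div ?T) \<le> real k * (3 * (real n / real t))"
    by (intro mult_left_mono) auto
  moreover have "real (k * (n div ?T + 1)) = real k * real (n div ?T) + real k"
    by (simp add: algebra_simps)
  moreover have "real k * (3 * (real n / real t)) = 3 * ?r" by simp
  ultimately have a: "real (k * (n div ?T + 1)) \<le> 4 * ?r"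
    using r(1) by linarith
  have C: "0 < ?T choose k" using T by (simp add: zero_less_binomial)
  have Ct: "?T choose k \<le> t choose k"
    by (rule binomial_right_mono) simp
  have "1 \<le> real (?T choose k)" using C by linarith
  then have "0 \<le> log 2 (real (?T choose k))" using T by (intro zero_le_log_cancel_iff[THEN iffD2]) auto
  then have "real (nat \<lfloor>log 2 (real (?T choose k))\<rfloor>) \<le> log 2 (real (?T choose k))" by linarith
  then have "real (floorlog 2 (?T choose k)) \<le> log 2 (real (?T choose k)) + 1"
    using C by (simp add: floorlog_def)
  also have "\<dots> = ln (real (?T choose k)) / ln 2 + 1" by (simp add: log_def)
  also have "\<dots> \<le> ln (real (t choose k)) / ln 2 + ?r"
    using C Ct r by (intro add_mono divide_right_mono) (auto simp: ln_mono)
  finally have b: "real (floorlog 2 (?T choose k)) \<le> ln (real (t choose k)) / ln 2 + ?r" .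
  \<comment> \<open>\<open>samples\<close> depends neither on \<open>B\<close> nor on the source of
    examples, so the empty source may stand in, for which the locale assumption on examples is
    vacuous.\<close>
  interpret block_search n k ?T "value_bound n" "Suc n" "return_pmf None"
    by unfold_locales (use T assms value_bound in auto)
  have "real samples = real (k * (n div ?T + 1)) + real (floorlog 2 (?T choose k))"
    unfolding samples_def by (rule of_nat_add)
  then show ?thesis using a b by linarith
qed

text \<open>As ln (ln n) is eventually positive, its domination by \<open>k\<close> forces k \<ge>
  1. Then 4 k \<le> t yields both t \<ge> 4 and k \<le> t div 2.\<close>

lemma eventually_parameters:
  fixes k t :: "nat \<Rightarrow> nat"
  assumes "(\<lambda>n. ln (ln (real n))) \<in> o(\<lambda>n. real (k n))"
    and "(\<lambda>n. real (k n)) \<in> o(\<lambda>n. real (t n))"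
    and "(\<lambda>n. real (t n)) \<in> o(\<lambda>n. real n)"
  shows "eventually (\<lambda>n. 1 \<le> k n \<and> 4 * k n \<le> t n \<and> t n \<le> n) sequentially"
proof -
  have "eventually (\<lambda>n. norm (ln (ln (real n))) \<le> 1 * norm (real (k n))) sequentially"
    using landau_o.smallD[OF assms(1), of 1] by simp
  moreover have "eventually (\<lambda>n. norm (real (k n)) \<le> 1 / 4 * norm (real (t n))) sequentially"
    using landau_o.smallD[OF assms(2), of "1 / 4"] by simp
  moreover have "eventually (\<lambda>n. norm (real (t n)) \<le> 1 * norm (real n)) sequentially"
    using landau_o.smallD[OF assms(3), of 1] by simp
  moreover have "eventually (\<lambda>n. ln (ln (real n)) > 0) sequentially"
    by real_asymp
  ultimately show ?thesis
  proof eventually_elim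
    case (elim n)
    then have "0 < real (k n)" "4 * real (k n) \<le> real (t n)" "real (t n) \<le> real n" by auto
    then show ?case by linarith
  qed
qed

theorem theorem1:
  fixes k t :: "nat \<Rightarrow> nat" and \<delta>\<^sub>0 :: real
  assumes "constructible_in_quadratic_time k"
    and "constructible_in_quadratic_time t"
    and "(\<lambda>n. ln (ln (real n))) \<in> o(\<lambda>n. real (k n))"
    and "(\<lambda>n. real (k n)) \<in> o(\<lambda>n. real (t n))"
    and "(\<lambda>n. real (t n)) \<in> o(\<lambda>n. real n)"
    and "0 < \<delta>\<^sub>0" and "\<delta>\<^sub>0 < 1"
  shows "\<exists>(C :: real) (p :: real poly) (n\<^sub>0 :: nat).
    \<forall>\<delta>. 0 < \<delta> \<and> \<delta> \<le> \<delta>\<^sub>0 \<longrightarrow>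
      (\<exists>A. \<forall>n\<ge>n\<^sub>0.
         learns_parities A n (PAR n (k n)) (1/2) \<delta>
           (C * (real (k n) * real n / real (t n) + ln (real (t n choose k n)) + ln (1 / \<delta>)))
           (exp (- real (k n) / 4.01) * real (t n choose k n) * poly p (real n) * ln (1 / \<delta>)))"
proof -
  obtain Ak a where Ak: "deterministic Ak"
    "\<forall>n. \<exists>s. exec (return_pmf None) Ak (initial n) = return_spmf s \<and> mem s 1 0 = k n \<and> time s \<le> a * (n\<^sup>2 + 1)"
    using assms(1) unfolding constructible_in_quadratic_time_def by blast
  obtain At b where At: "deterministic At"
    "\<forall>n. \<exists>s. exec (return_pmf None) At (initial n) = return_spmf s \<and> mem s 1 0 = t n \<and> time s \<le> b * (n\<^sup>2 + 1)"
    using assms(2) unfolding constructible_in_quadratic_time_def by blast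
  obtain n0 where n0: "\<And>n. n \<ge> n0 \<Longrightarrow> 1 \<le> k n \<and> 4 * k n \<le> t n \<and> t n \<le> n"
    using eventually_parameters[OF assms(3-5)] unfolding eventually_sequentially by blast
  \<comment> \<open>Chosen so that L \<le> log 2 (1/\<delta>) + 1 \<le> c ln (1/\<delta>): the 1
    from rounding up is at most ln (1/\<delta>) divided by ln (1/\<open>\<delta>\<^sub>0\<close>),
    which is positive as \<open>\<delta>\<^sub>0\<close> is less than 1.\<close>
  define c where "c = 1 / ln 2 + 1 / ln (1 / \<delta>\<^sub>0)"
  \<comment> \<open>16 comes from the unit of time and \<open>a + b + 9000\<close> from the number
    of units; the degree 6 of \<open>p\<close> is 4 for the latter plus 2 for the former.\<close>
  define K where "K = 16 * real (a + b + 9000) * c"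
  define p :: "real poly" where "p = smult K ([:2, 1:] ^ 6)"
  have ln0: "0 < ln (1 / \<delta>\<^sub>0)" using assms(6,7) by (simp add: ln_div)
  have c: "0 < c" using ln0 by (simp add: c_def add_pos_pos)
  have "\<forall>n\<ge>n0. learns_parities (learn_prog Ak At (nat \<lceil>log 2 (1 / \<delta>)\<rceil>)) n (PAR n (k n)) (1/2) \<delta>
           ((5 + 1 / ln 2 + c) * (real (k n) * real n / real (t n) + ln (real (t n choose k n)) + ln (1 / \<delta>)))
           (exp (- real (k n) / 4.01) * real (t n choose k n) * poly p (real n) * ln (1 / \<delta>))"
    if \<delta>: "0 < \<delta>" "\<delta> \<le> \<delta>\<^sub>0" for \<delta>
  proof (intro allI impI)
    fix n
    assume "n \<ge> n0"
    then have kt: "1 \<le> k n" "4 * k n \<le> t n" "t n \<le> n" using n0 by auto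
    \<comment> \<open>The least number of additional examples with 2^(-L) \<le> \<delta>. It is the
      only way in which the program depends on \<open>\<delta>\<close>, and it does not involve
      \<open>n\<close>.\<close>
    define L where "L = nat \<lceil>log 2 (1 / \<delta>)\<rceil>"
    define T where "T = t n div 2"
    have T: "1 \<le> T" "k n \<le> T" "T \<le> n" using kt by (auto simp: T_def)
    have lnd: "ln (1 / \<delta>\<^sub>0) \<le> ln (1 / \<delta>)"
      using \<delta> assms(6) by (simp add: ln_div)
    have pos: "0 < log 2 (1 / \<delta>)" using lnd ln0 \<delta> by (simp add: log_def)
    have L: "1 \<le> L" "log 2 (1 / \<delta>) \<le> real L" "real L \<le> log 2 (1 / \<delta>) + 1"
      using pos unfolding L_def by linarith+
    have "real L \<le> ln (1 / \<delta>) / ln 2 + ln (1 / \<delta>) / ln (1 / \<delta>\<^sub>0)"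
      using L(3) lnd ln0 unfolding log_def by (smt (verit) le_divide_eq_1_pos)
    then have Lc: "real L \<le> c * ln (1 / \<delta>)" by (simp add: c_def algebra_simps)
    have Ld: "(1 / 2) ^ L \<le> \<delta>"
    proof -
      have "1 / \<delta> = 2 powr (log 2 (1 / \<delta>))" using \<delta> by simp
      also have "\<dots> \<le> 2 powr (real L)" using L by simp
      also have "\<dots> = 2 ^ L" by (simp add: powr_realpow)
      finally show ?thesis using \<delta> by (simp add: field_simps power_one_over)
    qed
    obtain sk where sk: "exec (return_pmf None) Ak (initial n) = return_spmf sk" "mem sk 1 0 = k n" "time sk \<le> a * (n\<^sup>2 + 1)"
      using Ak(2) by blast
    obtain st where st: "exec (return_pmf None) At (initial n) = return_spmf st" "mem st 1 0 = t n" "time st \<le> b * (n\<^sup>2 + 1)"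
      using At(2) by blast
    let ?C = "real (t n choose k n)"
    let ?r = "real (k n) * real n / real (t n)"
    have "0 < t n choose k n" using kt by (simp add: zero_less_binomial)
    then have "1 \<le> ?C" by linarith
    then have lnC: "0 \<le> ln ?C" by (rule ln_ge_zero)
    have r: "0 \<le> ?r" by simp
    have lnd0: "0 < ln (1 / \<delta>)" using lnd ln0 by linarith
    have ln2: "0 < (1 :: real) / ln 2" by simp
    have pp: "poly p (real n) = K * (real n + 2) ^ 6" by (simp add: p_def poly_power add.commute)
    show "learns_parities (learn_prog Ak At (nat \<lceil>log 2 (1 / \<delta>)\<rceil>)) n (PAR n (k n)) (1/2) \<delta>
           ((5 + 1 / ln 2 + c) * (?r + ln ?C + ln (1 / \<delta>)))
           (exp (- real (k n) / 4.01) * ?C * poly p (real n) * ln (1 / \<delta>))"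
      unfolding L_def[symmetric]
    proof (rule learn_prog_learns[OF T value_bound Ak(1) sk At(1) st T_def kt(3) _ _ Ld])
      have "real (block_search.samples n (k n) T) \<le> 5 * ?r + 1 / ln 2 * ln ?C"
        using samples_real_le[OF kt] by (simp add: T_def)
      moreover have "5 * ?r \<le> (5 + 1 / ln 2 + c) * ?r" using r c ln2 by (intro mult_right_mono) auto
      moreover have "1 / ln 2 * ln ?C \<le> (5 + 1 / ln 2 + c) * ln ?C" using lnC c by (intro mult_right_mono) auto
      moreover have "c * ln (1 / \<delta>) \<le> (5 + 1 / ln 2 + c) * ln (1 / \<delta>)" using lnd0 ln2 by (intro mult_right_mono) auto
      ultimately have "real (block_search.samples n (k n) T + L) \<le>
         (5 + 1 / ln 2 + c) * ?r + (5 + 1 / ln 2 + c) * ln ?C + (5 + 1 / ln 2 + c) * ln (1 / \<delta>)"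
        using Lc by simp
      also have "\<dots> = (5 + 1 / ln 2 + c) * (?r + ln ?C + ln (1 / \<delta>))" by (simp only: distrib_left)
      finally show "real (block_search.samples n (k n) T + L) \<le> (5 + 1 / ln 2 + c) * (?r + ln ?C + ln (1 / \<delta>))" .
    next
      interpret block_search n "k n" T "value_bound n" "Suc n" "return_pmf None"
        by unfold_locales (use T value_bound in auto)
      have "learn_time (a * (n\<^sup>2 + 1)) (b * (n\<^sup>2 + 1)) L * U (value_bound n) \<le>
         (a + b + 9000) * (n + 2) ^ 4 * (L * (T choose k n)) * (16 * (n + 2) ^ 2)"
        using learn_time_le[OF order_refl order_refl L(1)] U_value_bound by (rule mult_le_mono)
      also have "\<dots> = 16 * (a + b + 9000) * (n + 2) ^ 6 * (L * (T choose k n))"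
      proof -
        have e: "(n + 2) ^ 6 = (n + 2) ^ 4 * (n + 2) ^ 2" by (simp only: power_add[symmetric]) simp
        show ?thesis unfolding e by (simp only: mult_ac)
      qed
      finally have "real (learn_time (a * (n\<^sup>2 + 1)) (b * (n\<^sup>2 + 1)) L * U (value_bound n)) \<le>
         real (16 * (a + b + 9000) * (n + 2) ^ 6 * (L * (T choose k n)))"
        by (rule of_nat_mono)
      also have "\<dots> = (16 * real (a + b + 9000) * (real n + 2) ^ 6) * (real L * real (T choose k n))"
        by (simp add: add.commute)
      also have "\<dots> \<le> (16 * real (a + b + 9000) * (real n + 2) ^ 6) *
          ((c * ln (1 / \<delta>)) * (exp (- real (k n) / 4.01) * ?C))"
        using Lc c lnd0 by (intro mult_left_mono mult_mono binomial_half_exp) (auto simp: T_def)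
      also have "\<dots> = exp (- real (k n) / 4.01) * ?C * poly p (real n) * ln (1 / \<delta>)"
        by (simp only: pp K_def mult_ac)
      finally show "real (learn_time (a * (n\<^sup>2 + 1)) (b * (n\<^sup>2 + 1)) L * U (value_bound n)) \<le>
         exp (- real (k n) / 4.01) * ?C * poly p (real n) * ln (1 / \<delta>)" .
    qed
  qed
  then show ?thesis by blast
qed

end
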